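(* For each $n\ge1$, the coefficients of the Chebyshev-Blaschke product $f_{n,\tau}$, i.e. the functions $\pm S_{n,j}$ ($1\le j\le\lfloor n/2\rfloor$) occurring in $$f_{n,\tau}(z)=z^{(1-(-1)^n)/2}\,\frac{z^{2\lfloor n/2\rfloor}+\sum_{j=1}^{\lfloor n/2\rfloor}(-1)^jS_{n,j}(\tau)z^{2\lfloor n/2\rfloor-2j}}{1+\sum_{j=1}^{\lfloor n/2\rfloor}(-1)^jS_{n,j}(\tau)z^{2j}},$$ are in the field $$\mathbb{Q}\left(\sqrt{k},\ \sqrt{k\circ s_n},\ \frac{\omega_1\circ s_n}{\omega_1}\right),$$ where $s_n(\tau)=n\tau$. Consequently $f_{n,\tau}$ is defined over the ring $$\mathbb{Z}\left[\sqrt{k},\ \sqrt{k\circ s_n},\ \frac{\omega_1\circ s_n}{\omega_1}\right],$$ i.e. $f_{n,\tau}$ can be written as a quotient of two polynomials in $z$ with coefficients in this ring. Moreover, the functions $$\tau\mapsto\frac{\vartheta_2((2i-1)\pi/2n,\tau)}{\vartheta_3((2i-1)\pi/2n,\tau)},\qquad i=1,\dots,\lfloor n/2\rfloor,$$ are algebraic over this field.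
   Context: $\mathbb{H}$ is the open upper half plane and $\mathcal{M}(\mathbb{H})$ the field of meromorphic functions on $\mathbb{H}$; all fields and rings in the claim are subfields/subrings of $\mathcal{M}(\mathbb{H})$. For $\tau\in\mathbb{H}$ put $q=e^{2\pi i\tau}$, $q^s=e^{2\pi i s\tau}$, and $$\vartheta_2(v,\tau)=\sum_{m=-\infty}^\infty q^{(m+1/2)^2}e^{(2m+1)iv},\qquad \vartheta_3(v,\tau)=\sum_{m=-\infty}^\infty q^{m^2}e^{2miv},$$ $$\omega_1(\tau)=\vartheta_3^2(0,\tau),\qquad \sqrt{k(\tau)}=\frac{\vartheta_2(0,\tau)}{\vartheta_3(0,\tau)},\qquad k(\tau)=\frac{\vartheta_2^2(0,\tau)}{\vartheta_3^2(0,\tau)}.$$ The Chebyshev-Blaschke product $f_{n,\tau}$ ($\tau\in\mathbb{R}_{>0}i$) is the finite Blaschke product $\mathbb{D}\to\mathbb{D}$ defined by $f_{n,\tau}(z)=\sqrt{k(n\tau)}\,cd(n\omega_1(n\tau)u,n\tau)$ where $z=\sqrt{k(\tau)}\,cd(\omega_1(\tau)u,\tau)$, with $cd=cn/dn$ the quotient of Jacobi elliptic functions; since $\sqrt{k(\tau)}\,cd(\omega_1(\tau)u,\tau)=\vartheta_2(u,\tau)/\vartheta_3(u,\tau)$, this says $f_{n,\tau}\big(\vartheta_2(u,\tau)/\vartheta_3(u,\tau)\big)=\vartheta_2(nu,n\tau)/\vartheta_3(nu,n\tau)$. Explicitly, $$f_{n,\tau}(z)=z^{(1-(-1)^n)/2}\prod_{i=1}^{\lfloor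 n/2\rfloor}\frac{z^2-b_i}{1-b_iz^2},\qquad b_i(\tau)=\frac{\vartheta_2^2((2i-1)\pi/2n,\tau)}{\vartheta_3^2((2i-1)\pi/2n,\tau)}.$$ For $1\le j\le\lfloor n/2\rfloor$, $S_{n,j}=\sum_{1\le i_1<\cdots<i_j\le\lfloor n/2\rfloor}b_{i_1}\cdots b_{i_j}$. The $b_i$ and $S_{n,j}$ are meromorphic functions of $\tau\in\mathbb{H}$, and the formula for $f_{n,\tau}$ is regarded as a rational function in $z$ with coefficients in $\mathcal{M}(\mathbb{H})$. *)

theory Defs
  imports
    "HOL-Complex_Analysis.Complex_Analysis"
    "HOL-Algebra.Algebraic_Closure_Type"
    "HOL-Algebra.Finite_Extensions"
    "HOL-Algebra.Generated_Fields"
    "HOL-Computational_Algebra.Computational_Algebra"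
begin

section \<open>The field of meromorphic functions on the upper half plane\<close>

definition upper_half_plane :: "complex set" where
  "upper_half_plane = {\<tau>. Im \<tau> > 0}"

lemma open_upper_half_plane [simp]: "open upper_half_plane"
  by (simp add: upper_half_plane_def open_halfspace_Im_gt)

lemma connected_upper_half_plane [simp]: "connected upper_half_plane"
  by (simp add: upper_half_plane_def convex_connected convex_halfspace_Im_gt)

lemma i_in_upper_half_plane [simp]: "\<i> \<in> upper_half_plane"
  by (simp add: upper_half_plane_def)

text \<open>
  \<^const>\<open>meromorphic_on\<close> puts no condition on the values at the singularities, so a meromorphic
  function is an equivalence class of such functions modulo equality outside a set without
  limit points in the upper half plane.
\<close>

definition mero_rel :: "(complex \<Rightarrow> complex) \<Rightarrow> (complex \<Rightarrow> complex) \<Rightarrow> bool" where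
  "mero_rel f g \<longleftrightarrow> f meromorphic_on upper_half_plane \<and> g meromorphic_on upper_half_plane \<and>
     (\<forall>\<^sub>\<approx>z\<in>upper_half_plane. f z = g z)"

lemma part_equivp_mero_rel: "part_equivp mero_rel"
proof (rule part_equivpI)
  show "\<exists>f. mero_rel f f"
    by (rule exI[of _ "\<lambda>_. 0"]) (auto simp: mero_rel_def)
  show "symp mero_rel"
    by (auto simp: symp_def mero_rel_def elim!: eventually_mono)
  show "transp mero_rel"
    unfolding transp_def mero_rel_def by auto (erule (1) eventually_elim2, simp)
qed

quotient_type mero = "complex \<Rightarrow> complex" / partial: mero_rel
  by (rule part_equivp_mero_rel)

lemma mero_nonzero_cosparse:
  assumes "f meromorphic_on upper_half_plane" "\<not>(\<forall>\<^sub>\<approx>z\<in>upper_half_plane. f z = 0)"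
  shows "\<forall>\<^sub>\<approx>z\<in>upper_half_plane. f z \<noteq> 0"
  using meromorphic_imp_constant_or_avoid[OF assms(1), of 0] assms(2) by auto

instantiation mero :: field
begin

lift_definition zero_mero :: mero is "\<lambda>_. 0"
  by (auto simp: mero_rel_def)
lift_definition one_mero :: mero is "\<lambda>_. 1"
  by (auto simp: mero_rel_def)
lift_definition plus_mero :: "mero \<Rightarrow> mero \<Rightarrow> mero" is "\<lambda>f g z. f z + g z"
  by (auto simp: mero_rel_def intro!: meromorphic_intros) (erule (1) eventually_elim2, simp)
lift_definition minus_mero :: "mero \<Rightarrow> mero \<Rightarrow> mero" is "\<lambda>f g z. f z - g z"
  by (auto simp: mero_rel_def intro!: meromorphic_intros) (erule (1) eventually_elim2, simp)
lift_definition uminus_mero :: "mero \<Rightarrow> mero" is "\<lambda>f z. - f z"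
  by (auto simp: mero_rel_def intro!: meromorphic_intros elim!: eventually_mono)
lift_definition times_mero :: "mero \<Rightarrow> mero \<Rightarrow> mero" is "\<lambda>f g z. f z * g z"
  by (auto simp: mero_rel_def intro!: meromorphic_intros) (erule (1) eventually_elim2, simp)
lift_definition divide_mero :: "mero \<Rightarrow> mero \<Rightarrow> mero" is "\<lambda>f g z. f z / g z"
  by (auto simp: mero_rel_def intro!: meromorphic_intros) (erule (1) eventually_elim2, simp)
lift_definition inverse_mero :: "mero \<Rightarrow> mero" is "\<lambda>f z. inverse (f z)"
  by (auto simp: mero_rel_def intro!: meromorphic_intros elim!: eventually_mono)

instance
proof
  show "(0::mero) \<noteq> 1"
  proof (transfer, rule notI)
    assume "mero_rel (\<lambda>_. 0) (\<lambda>_. 1)"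
    hence "\<forall>\<^sub>\<approx>z\<in>upper_half_plane. False" by (simp add: mero_rel_def)
    thus False using i_in_upper_half_plane by (simp add: eventually_cosparse_open_eq)
  qed
next
  fix a :: mero assume "a \<noteq> 0"
  thus "inverse a * a = 1"
  proof transfer
    fix f assume f: "mero_rel f f" "\<not>mero_rel f (\<lambda>_. 0)"
    hence mero: "f meromorphic_on upper_half_plane" by (simp add: mero_rel_def)
    hence "\<forall>\<^sub>\<approx>z\<in>upper_half_plane. f z \<noteq> 0"
      using f by (intro mero_nonzero_cosparse) (auto simp: mero_rel_def)
    thus "mero_rel (\<lambda>z. inverse (f z) * f z) (\<lambda>_. 1)"
      using mero by (auto simp: mero_rel_def intro!: meromorphic_intros elim!: eventually_mono)
  qed
qed (transfer; auto simp: mero_rel_def field_simps intro!: meromorphic_intros)+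

end

text \<open>The class of a function that is meromorphic on the upper half plane (and 0 otherwise).\<close>

lift_definition Mero :: "(complex \<Rightarrow> complex) \<Rightarrow> mero" is
  "\<lambda>f. if f meromorphic_on upper_half_plane then f else (\<lambda>_. 0)"
  by (auto simp: mero_rel_def)

lemma Mero_eq_iff:
  assumes "f meromorphic_on upper_half_plane" "g meromorphic_on upper_half_plane"
  shows "Mero f = Mero g \<longleftrightarrow> (\<forall>\<^sub>\<approx>z\<in>upper_half_plane. f z = g z)"
  using assms by transfer (auto simp: mero_rel_def)

section \<open>Theta functions\<close>

text \<open>The nome is \<open>exp (2 \<pi> \<i> \<tau>)\<close>, not the more common \<open>exp (\<pi> \<i> \<tau>)\<close>.\<close>

definition theta2 :: "complex \<Rightarrow> complex \<Rightarrow> complex" where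
  "theta2 v \<tau> = (\<Sum>\<^sub>\<infinity>m::int. exp (2 * of_real pi * \<i> * (of_int m + 1/2)\<^sup>2 * \<tau>) *
                               exp ((2 * of_int m + 1) * \<i> * v))"

definition theta3 :: "complex \<Rightarrow> complex \<Rightarrow> complex" where
  "theta3 v \<tau> = (\<Sum>\<^sub>\<infinity>m::int. exp (2 * of_real pi * \<i> * (of_int m)\<^sup>2 * \<tau>) *
                               exp (2 * of_int m * \<i> * v))"

definition omega1 :: "complex \<Rightarrow> complex" where
  "omega1 \<tau> = (theta3 0 \<tau>)\<^sup>2"

definition sqrt_k :: "complex \<Rightarrow> complex" where
  "sqrt_k \<tau> = theta2 0 \<tau> / theta3 0 \<tau>"

lemma summable_exp_abs_int: "(\<lambda>m::int. exp (- \<bar>real_of_int m\<bar>)) summable_on UNIV"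
proof -
  have s: "(\<lambda>n::nat. exp (- real n)) summable_on UNIV"
  proof -
    have "summable (\<lambda>n::nat. (exp (-1) :: real) ^ n)"
      by (rule summable_geometric) auto
    hence "summable (\<lambda>n::nat. exp (- real n))"
      by (simp add: exp_of_nat_mult [symmetric])
    thus ?thesis
      by (intro norm_summable_imp_summable_on) auto
  qed
  have "(\<lambda>m::int. exp (- \<bar>real_of_int m\<bar>)) summable_on (range int)"
    by (subst summable_on_reindex) (use s in \<open>auto simp: o_def\<close>)
  moreover have "(\<lambda>m::int. exp (- \<bar>real_of_int m\<bar>)) summable_on (range (\<lambda>n. - int n))"
    by (subst summable_on_reindex) (use s in \<open>auto simp: o_def inj_on_def\<close>)
  ultimately have "(\<lambda>m::int. exp (- \<bar>real_of_int m\<bar>)) summable_on (range int \<union> range (\<lambda>n. - int n))"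
    by (rule summable_on_union)
  moreover have "range int \<union> range (\<lambda>n. - int n) = UNIV"
  proof -
    have "m \<in> range int \<union> range (\<lambda>n. - int n)" for m
      by (cases m rule: int_cases2) auto
    thus ?thesis by blast
  qed
  ultimately show ?thesis by simp
qed

lemma theta_term_bound:
  fixes s \<delta> :: real
  assumes "\<delta> > 0"
  obtains C where "\<And>(m::int) \<tau>. Im \<tau> \<ge> \<delta> \<Longrightarrow>
    norm (exp (2 * of_real pi * \<i> * (of_real (of_int m + s))\<^sup>2 * \<tau>) *
          exp (2 * of_real (of_int m + s) * \<i> * v)) \<le> C * exp (- \<bar>real_of_int m\<bar>)"
proof
  define b where "b = 2 * \<bar>Im v\<bar> + 1"
  define a where "a = 2 * pi * \<delta>"
  have a: "a > 0" using assms by (simp add: a_def)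
  fix m :: int and \<tau> :: complex
  assume \<tau>: "Im \<tau> \<ge> \<delta>"
  define x where "x = of_int m + s"
  have "norm (exp (2 * of_real pi * \<i> * (of_real x)\<^sup>2 * \<tau>) * exp (2 * of_real x * \<i> * v)) =
        exp (- (2 * pi * x\<^sup>2 * Im \<tau>) - 2 * x * Im v)"
    by (simp add: norm_mult exp_diff exp_minus field_simps power2_eq_square)
  also have "\<dots> \<le> exp (b\<^sup>2 / (4 * a) + \<bar>s\<bar> - \<bar>real_of_int m\<bar>)"
  proof (subst exp_le_cancel_iff)
    have "- (x * Im v) \<le> \<bar>x\<bar> * \<bar>Im v\<bar>"
      by (metis abs_ge_minus_self abs_mult)
    moreover have "2 * pi * x\<^sup>2 * Im \<tau> \<ge> 2 * pi * x\<^sup>2 * \<delta>"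
      using \<tau> by (intro mult_left_mono) auto
    moreover have "b * \<bar>x\<bar> = 2 * (\<bar>x\<bar> * \<bar>Im v\<bar>) + \<bar>x\<bar>"
      by (simp add: b_def algebra_simps)
    moreover have "a * \<bar>x\<bar>\<^sup>2 = 2 * pi * x\<^sup>2 * \<delta>"
      by (simp add: a_def)
    ultimately have 1: "- (2 * pi * x\<^sup>2 * Im \<tau>) - 2 * x * Im v \<le> - a * \<bar>x\<bar>\<^sup>2 + b * \<bar>x\<bar> - \<bar>x\<bar>"
      by linarith
    have "0 \<le> (2 * a * \<bar>x\<bar> - b)\<^sup>2 / (4 * a)"
      using a by simp
    also have "\<dots> = a * \<bar>x\<bar>\<^sup>2 - b * \<bar>x\<bar> + b\<^sup>2 / (4 * a)"
      using a by (simp add: power2_eq_square field_simps)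
    finally have 2: "- a * \<bar>x\<bar>\<^sup>2 + b * \<bar>x\<bar> \<le> b\<^sup>2 / (4 * a)" by simp
    have 3: "\<bar>x\<bar> \<ge> \<bar>real_of_int m\<bar> - \<bar>s\<bar>" unfolding x_def by linarith
    show "- (2 * pi * x\<^sup>2 * Im \<tau>) - 2 * x * Im v \<le> b\<^sup>2 / (4 * a) + \<bar>s\<bar> - \<bar>real_of_int m\<bar>"
      using 1 2 3 by linarith
  qed
  also have "\<dots> = exp (b\<^sup>2 / (4 * a) + \<bar>s\<bar>) * exp (- \<bar>real_of_int m\<bar>)"
    by (simp add: exp_diff exp_minus field_simps)
  finally show "norm (exp (2 * of_real pi * \<i> * (of_real (of_int m + s))\<^sup>2 * \<tau>) *
      exp (2 * of_real (of_int m + s) * \<i> * v)) \<le>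
      exp (b\<^sup>2 / (4 * a) + \<bar>s\<bar>) * exp (- \<bar>real_of_int m\<bar>)"
    by (simp add: x_def)
qed

lemma theta_holomorphic_aux:
  fixes s :: real
  shows "(\<lambda>\<tau>. \<Sum>\<^sub>\<infinity>m::int. exp (2 * of_real pi * \<i> * (of_real (of_int m + s))\<^sup>2 * \<tau>) *
            exp (2 * of_real (of_int m + s) * \<i> * v)) holomorphic_on upper_half_plane"
    (is "?F holomorphic_on _")
proof -
  let ?f = "\<lambda>(m::int) \<tau>. exp (2 * of_real pi * \<i> * (of_real (of_int m + s))\<^sup>2 * \<tau>) *
            exp (2 * of_real (of_int m + s) * \<i> * v)"
  have "?F analytic_on {t}" if t: "t \<in> upper_half_plane" for t
  proof -
    define r where "r = Im t / 2"
    have r: "r > 0" using t by (simp add: r_def upper_half_plane_def)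
    obtain C where C: "\<And>m \<tau>. Im \<tau> \<ge> r \<Longrightarrow> norm (?f m \<tau>) \<le> C * exp (- \<bar>real_of_int m\<bar>)"
      using theta_term_bound[OF r, of s v] by blast
    have im: "Im \<tau> \<ge> r" if "\<tau> \<in> cball t r" for \<tau>
      using that abs_Im_le_cmod[of "t - \<tau>"] by (simp add: dist_norm r_def)
    have "uniform_limit (cball t r) (\<lambda>Y \<tau>. \<Sum>m\<in>Y. ?f m \<tau>) ?F (finite_subsets_at_top UNIV)"
      by (rule Weierstrass_m_test_general[where M = "\<lambda>m. C * exp (- \<bar>real_of_int m\<bar>)"])
         (use C im in \<open>auto intro!: summable_on_cmult_right summable_exp_abs_int\<close>)
    moreover have "\<forall>\<^sub>F Y in finite_subsets_at_top UNIV.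
        continuous_on (cball t r) (\<lambda>\<tau>. \<Sum>m\<in>Y. ?f m \<tau>) \<and>
        (\<lambda>\<tau>. \<Sum>m\<in>Y. ?f m \<tau>) holomorphic_on ball t r"
      by (intro always_eventually allI conjI continuous_intros holomorphic_intros)
    ultimately have "?F holomorphic_on ball t r"
      by (auto intro: holomorphic_uniform_limit)
    thus ?thesis
      using r by (auto simp: analytic_at_ball)
  qed
  thus ?thesis
    using analytic_imp_holomorphic analytic_on_analytic_at by blast
qed

lemma theta2_holomorphic: "theta2 v holomorphic_on upper_half_plane"
  using theta_holomorphic_aux[of "1/2" v]
  unfolding theta2_def[abs_def] by (simp add: algebra_simps)

lemma theta3_holomorphic: "theta3 v holomorphic_on upper_half_plane"
  using theta_holomorphic_aux[of 0 v]
  unfolding theta3_def[abs_def] by simp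

lemma theta_meromorphic [meromorphic_intros]:
  "theta2 v meromorphic_on upper_half_plane" "theta3 v meromorphic_on upper_half_plane"
  using theta2_holomorphic[of v] theta3_holomorphic[of v]
  by (auto intro!: analytic_on_imp_meromorphic_on simp: analytic_on_open)

lemma theta_scaled_meromorphic:
  assumes "n \<ge> (1::nat)"
  shows "(\<lambda>\<tau>. theta2 v (of_nat n * \<tau>)) meromorphic_on upper_half_plane"
        "(\<lambda>\<tau>. theta3 v (of_nat n * \<tau>)) meromorphic_on upper_half_plane"
proof -
  have *: "(\<lambda>\<tau>. of_nat n * \<tau>) ` upper_half_plane \<subseteq> upper_half_plane"
    using assms by (auto simp: upper_half_plane_def)
  have "(theta2 v \<circ> (\<lambda>\<tau>. of_nat n * \<tau>)) holomorphic_on upper_half_plane"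
       "(theta3 v \<circ> (\<lambda>\<tau>. of_nat n * \<tau>)) holomorphic_on upper_half_plane"
    by (rule holomorphic_on_compose_gen[OF _ _ *] theta2_holomorphic theta3_holomorphic
          holomorphic_intros)+
  thus "(\<lambda>\<tau>. theta2 v (of_nat n * \<tau>)) meromorphic_on upper_half_plane"
       "(\<lambda>\<tau>. theta3 v (of_nat n * \<tau>)) meromorphic_on upper_half_plane"
    by (auto intro!: analytic_on_imp_meromorphic_on simp: analytic_on_open o_def)
qed

section \<open>Chebyshev-Blaschke products\<close>

definition finite_blaschke_product :: "(complex \<Rightarrow> complex) \<Rightarrow> bool" where
  "finite_blaschke_product f \<longleftrightarrow>
     (\<exists>c as. norm c = 1 \<and> (\<forall>a\<in>set as. norm a < 1) \<and>
        (\<forall>z\<in>ball 0 1. f z = c * (\<Prod>a\<leftarrow>as. (z - a) / (1 - cnj a * z))))"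

text \<open>
  Here \<open>\<tau>\<close> lies on the positive imaginary axis.  The argument \<open>z = sqrt_k \<tau> * cd (omega1 \<tau> * u, \<tau>)\<close>
  is written as \<open>theta2 u \<tau> / theta3 u \<tau>\<close>, and similarly for the value at \<open>z\<close>.  Only the values of
  \<open>f\<close> on the open unit disc matter; \<open>u\<close> ranges over all complex parameters of points of the disc.
\<close>

definition chebyshev_blaschke :: "nat \<Rightarrow> complex \<Rightarrow> (complex \<Rightarrow> complex) \<Rightarrow> bool" where
  "chebyshev_blaschke n \<tau> f \<longleftrightarrow> finite_blaschke_product f \<and>
     (\<forall>u. theta3 u \<tau> \<noteq> 0 \<and> norm (theta2 u \<tau> / theta3 u \<tau>) < 1 \<longrightarrow>
        f (theta2 u \<tau> / theta3 u \<tau>) =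
          theta2 (of_nat n * u) (of_nat n * \<tau>) / theta3 (of_nat n * u) (of_nat n * \<tau>))"

definition cb_sqrt_b :: "nat \<Rightarrow> nat \<Rightarrow> complex \<Rightarrow> complex" where
  "cb_sqrt_b n i \<tau> =
     theta2 ((2 * of_nat i - 1) * of_real pi / (2 * of_nat n)) \<tau> /
     theta3 ((2 * of_nat i - 1) * of_real pi / (2 * of_nat n)) \<tau>"

definition cb_b :: "nat \<Rightarrow> nat \<Rightarrow> complex \<Rightarrow> complex" where
  "cb_b n i \<tau> =
     (theta2 ((2 * of_nat i - 1) * of_real pi / (2 * of_nat n)) \<tau>)\<^sup>2 /
     (theta3 ((2 * of_nat i - 1) * of_real pi / (2 * of_nat n)) \<tau>)\<^sup>2"

text \<open>The elementary symmetric functions of the \<open>b\<^sub>i\<close>, \<open>1 \<le> i \<le> \<lfloor>n/2\<rfloor>\<close>.\<close>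

definition cb_S :: "nat \<Rightarrow> nat \<Rightarrow> complex \<Rightarrow> complex" where
  "cb_S n j \<tau> = (\<Sum>I | I \<subseteq> {1..n div 2} \<and> card I = j. \<Prod>i\<in>I. cb_b n i \<tau>)"

lemma cb_meromorphic:
  "cb_sqrt_b n i meromorphic_on upper_half_plane"
  "cb_b n i meromorphic_on upper_half_plane"
  "cb_S n j meromorphic_on upper_half_plane"
proof -
  show "cb_sqrt_b n i meromorphic_on upper_half_plane"
    unfolding cb_sqrt_b_def[abs_def] by (intro meromorphic_intros)
  show b: "cb_b n i meromorphic_on upper_half_plane" for i
    unfolding cb_b_def[abs_def] by (intro meromorphic_intros)
  show "cb_S n j meromorphic_on upper_half_plane"
    unfolding cb_S_def[abs_def] by (intro meromorphic_intros b)
qed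

text \<open>
  The product formula as a rational function over the meromorphic functions on the upper half
  plane; note that \<open>n mod 2 = (1 - (-1)^n)/2\<close>.
\<close>

definition cb_rational :: "nat \<Rightarrow> mero poly fract" where
  "cb_rational n = Fract (Polynomial.monom 1 (n mod 2)) 1 *
     (\<Prod>i=1..n div 2. Fract [:- Mero (cb_b n i), 0, 1:] [:1, 0, - Mero (cb_b n i):])"

section \<open>The coefficient field and ring\<close>

definition cb_generators :: "nat \<Rightarrow> mero set" where
  "cb_generators n = {Mero sqrt_k, Mero (\<lambda>\<tau>. sqrt_k (of_nat n * \<tau>)),
                      Mero (\<lambda>\<tau>. omega1 (of_nat n * \<tau>) / omega1 \<tau>)}"

lemma cb_generators_meromorphic:
  assumes "n \<ge> 1"
  shows "sqrt_k meromorphic_on upper_half_plane"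
        "(\<lambda>\<tau>. sqrt_k (of_nat n * \<tau>)) meromorphic_on upper_half_plane"
        "(\<lambda>\<tau>. omega1 (of_nat n * \<tau>) / omega1 \<tau>) meromorphic_on upper_half_plane"
  unfolding sqrt_k_def[abs_def] omega1_def
  by (intro meromorphic_intros theta_scaled_meromorphic assms)+

text \<open>The subfield generated by a set contains 1, hence the rational numbers.\<close>

definition cb_field :: "nat \<Rightarrow> mero set" where
  "cb_field n = generate_field ring_of_type_algebra (cb_generators n)"

definition cb_ring :: "nat \<Rightarrow> mero set" where
  "cb_ring n = generate_ring ring_of_type_algebra (cb_generators n)"

end

theory Submission
  imports Defs
begin

text \<open>
  For fixed \<open>\<tau>\<close> write \<open>Z\<^sub>\<tau>(u) = \<theta>\<^sub>2(u, \<tau>) / \<theta>\<^sub>3(u, \<tau>)\<close>, a multiple of the elliptic function \<open>cd\<close>. The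
  Chebyshev-Blaschke product is the rational function \<open>f\<close> with \<open>f(Z\<^sub>\<tau>(u)) = Z\<^bsub>n\<tau>\<^esub>(n u)\<close>. That
  its coefficients lie in the field generated by \<open>\<surd>k\<close>, \<open>\<surd>k \<circ> s\<^sub>n\<close> and \<open>(\<omega>\<^sub>1 \<circ> s\<^sub>n) / \<omega>\<^sub>1\<close>
  is the algebraic shadow of a fact about isogenies: such a map is determined by its effect on the
  invariant differential and by one value.
  
  On the analytic side, \<open>Z\<^sub>\<tau>\<close> satisfies \<open>Z'\<^sup>2 = \<omega>\<^sub>1\<^sup>2 (k - Z\<^sup>2) (1 - k Z\<^sup>2)\<close> (\<open>theta_quot_ode\<close>). The
  constant \<open>\<omega>\<^sub>1\<^sup>2\<close> comes from Jacobi's formula \<open>\<theta>\<^sub>1'(0) = \<theta>\<^sub>2(0) \<theta>\<^sub>3(0) \<theta>\<^sub>4(0)\<close> for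
  \<open>\<theta>\<^sub>1(v) = \<theta>\<^sub>2(v - \<pi>/2)\<close> and \<open>\<theta>\<^sub>4(v) = \<theta>\<^sub>3(v + \<pi>/2)\<close> (\<open>jacobi_derivative_formula\<close>).
  The chain rule turns this into the differential equation (\<open>cb_ode\<close>)
  \<open>f'(z)\<^sup>2 (k - z\<^sup>2) (1 - k z\<^sup>2) = n\<^sup>2 \<rho>\<^sup>2 (k\<^sub>n - f\<^sup>2) (1 - k\<^sub>n f\<^sup>2)\<close>, where \<open>\<rho> = (\<omega>\<^sub>1 \<circ> s\<^sub>n) / \<omega>\<^sub>1\<close>
  and \<open>k\<^sub>n = k \<circ> s\<^sub>n\<close>, and the value at \<open>u = 0\<close> is \<open>f(\<surd>k) = \<surd>k\<^sub>n\<close>.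
  
  On the algebraic side, \<open>z = \<surd>k\<close> is a simple zero of \<open>(k - z\<^sup>2) (1 - k z\<^sup>2)\<close>. The differentiated
  equation then determines the Taylor coefficients of \<open>f\<close> at \<open>\<surd>k\<close> one after the other by field
  operations, so they all lie in the field (\<open>ode_series_descends\<close>). A continued fraction argument
  (\<open>rational_power_series_descends\<close>) passes from the power series to numerator and denominator.
  The remaining claims are then formal: a common denominator gives coefficients in the ring, and
  \<open>Z\<^sub>\<tau>((2i - 1)\<pi>/2n)\<close> is a root of the numerator.
  
  The explicit product formula for \<open>f\<close> rests on \<open>\<Prod>\<^sub>j \<theta>(u + s\<^sub>j, \<tau>) = c \<theta>(n u, n \<tau>)\<close> with centred
  shifts \<open>s\<^sub>j\<close> and one constant \<open>c\<close> for \<open>\<theta>\<^sub>2\<close> and \<open>\<theta>\<^sub>3\<close> (\<open>theta_multiplication\<close>), and on the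
  addition formulas, which express each Blaschke factor as a product of two such shifted quotients.
  The addition and doubling formulas come from multiplying out the double series
  \<open>\<theta>\<^sub>3(x + y) \<theta>\<^sub>3(x - y)\<close>. Those that double \<open>\<tau>\<close> also give, by comparison with the limit at the cusp, that \<open>\<theta>\<^sub>3\<close> has no real zeros and that the constant in Jacobi's formula
  is 1.
  
  Identities in the field of meromorphic functions are checked on the imaginary axis only, where
  \<open>\<bar>Z\<^sub>\<tau>(x)\<bar> < 1\<close> for real \<open>x\<close>, so that all denominators are visibly different from 0.
\<close>

section \<open>Theta series and their product formulas\<close>

text \<open>
  The shift \<open>s\<close> is 0 for \<open>\<theta>\<^sub>3\<close> and \<open>1/2\<close> for \<open>\<theta>\<^sub>2\<close>, so that one convergence proof serves both
  series; a single exponential makes identities between terms identities between exponents.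
\<close>

definition theta_term :: "real \<Rightarrow> complex \<Rightarrow> complex \<Rightarrow> int \<Rightarrow> complex" where
  "theta_term s v \<tau> m =
     exp (2 * of_real pi * \<i> * (of_real (of_int m + s))\<^sup>2 * \<tau> + 2 * of_real (of_int m + s) * \<i> * v)"

lemma theta_term_0: "theta_term 0 v \<tau> m = exp (2 * of_real pi * \<i> * (of_int m)\<^sup>2 * \<tau> + 2 * of_int m * \<i> * v)"
  by (simp add: theta_term_def)

lemma theta_term_half:
  "theta_term (1/2) v \<tau> m =
     exp (2 * of_real pi * \<i> * ((of_int m)\<^sup>2 + of_int m) * \<tau> + of_real pi * \<i> * \<tau> / 2 + (2 * of_int m + 1) * \<i> * v)"
proof -
  have *: "(z + 1/2)\<^sup>2 = z\<^sup>2 + z + 1/4" "2 * (z + 1/2) = 2 * z + 1" for z :: complex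
    by (simp_all add: power2_eq_square algebra_simps)
  show ?thesis
    unfolding theta_term_def of_real_add of_real_of_int_eq of_real_divide of_real_1 of_real_numeral *
    by (rule arg_cong[of _ _ exp]) (simp add: algebra_simps)
qed

lemma theta2_eq_infsum: "theta2 v \<tau> = infsum (theta_term (1/2) v \<tau>) UNIV"
  unfolding theta2_def theta_term_def exp_add by (simp add: algebra_simps)

lemma theta3_eq_infsum: "theta3 v \<tau> = infsum (theta_term 0 v \<tau>) UNIV"
  unfolding theta3_def theta_term_def exp_add by (simp add: algebra_simps)

lemma theta_term_abs_summable:
  assumes "Im \<tau> > 0"
  shows "(\<lambda>m. norm (theta_term s v \<tau> m)) summable_on UNIV"
proof -
  obtain C where C: "\<And>(m::int) t. Im t \<ge> Im \<tau> \<Longrightarrow>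
    norm (exp (2 * of_real pi * \<i> * (of_real (of_int m + s))\<^sup>2 * t) *
          exp (2 * of_real (of_int m + s) * \<i> * v)) \<le> C * exp (- \<bar>real_of_int m\<bar>)"
    using theta_term_bound[OF assms] by blast
  show ?thesis
    by (rule Infinite_Sum.abs_summable_on_comparison_test'[where g = "\<lambda>m. C * exp (- \<bar>real_of_int m\<bar>)"])
       (use C[of \<tau>] in \<open>auto simp: theta_term_def exp_add intro!: summable_on_cmult_right summable_exp_abs_int\<close>)
qed

lemma theta_term_summable:
  assumes "Im \<tau> > 0"
  shows "theta_term s v \<tau> summable_on UNIV"
  by (rule abs_summable_summable[OF theta_term_abs_summable[OF assms]])

text \<open>
  For \<open>\<bar>Im v\<bar> \<le> R\<close> every term is dominated by the terms at \<open>v = \<plusminus>\<i> R\<close>, so the series converges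
  locally uniformly in \<open>v\<close>.
\<close>

lemma theta_term_holomorphic_sum:
  assumes "Im \<tau> > 0"
  shows "(\<lambda>v. infsum (theta_term s v \<tau>) UNIV) holomorphic_on UNIV"
proof -
  have "(\<lambda>v. infsum (theta_term s v \<tau>) UNIV) analytic_on {w}" for w
  proof -
    define R where "R = norm w + 1"
    have im: "\<bar>Im v\<bar> \<le> R" if "v \<in> cball w 1" for v
      using that abs_Im_le_cmod[of v] norm_triangle_sub[of v w]
      by (simp add: R_def dist_norm norm_minus_commute)
    define M where "M m = norm (theta_term s (\<i> * of_real R) \<tau> m) + norm (theta_term s (- \<i> * of_real R) \<tau> m)" for m
    have "M summable_on UNIV"
      unfolding M_def using assms by (intro summable_on_add theta_term_abs_summable)
    moreover have "norm (theta_term s v \<tau> m) \<le> M m" if v: "v \<in> cball w 1" for v m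
    proof -
      define x where "x = real_of_int m + s"
      have N: "norm (theta_term s v' \<tau> m) = exp (- (2 * pi * x\<^sup>2 * Im \<tau>) - 2 * x * Im v')" for v'
        by (simp add: theta_term_def x_def power2_eq_square)
      have "- (x * Im v) \<le> R * \<bar>x\<bar>"
        using im[OF v] abs_ge_minus_self[of "x * Im v"] mult_left_mono[of "\<bar>Im v\<bar>" R "\<bar>x\<bar>"]
        by (auto simp: abs_mult mult.commute)
      hence "norm (theta_term s v \<tau> m) \<le> exp (- (2 * pi * x\<^sup>2 * Im \<tau>) + 2 * (R * \<bar>x\<bar>))"
        unfolding N by simp
      also have "\<dots> \<le> exp (- (2 * pi * x\<^sup>2 * Im \<tau>) - 2 * x * R) + exp (- (2 * pi * x\<^sup>2 * Im \<tau>) - 2 * x * (- R))"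
      proof -
        have "exp (a + b) \<le> exp (a - b) + exp (a - (-b))" "exp (a + (-b)) \<le> exp (a - b) + exp (a - (-b))" for a b :: real
          by simp_all
        note * = this[of "- (2 * pi * x\<^sup>2 * Im \<tau>)" "2 * x * R"]
        show ?thesis
        proof (cases "x \<ge> 0")
          case True
          hence "2 * (R * \<bar>x\<bar>) = 2 * x * R" by simp
          thus ?thesis using *(1) by (simp only: mult_minus_right)
        next
          case False
          hence "2 * (R * \<bar>x\<bar>) = - (2 * x * R)" by simp
          thus ?thesis using *(2) by (simp only: mult_minus_right)
        qed
      qed
      also have "\<dots> = M m"
        unfolding M_def N by simp
      finally show ?thesis .
    qed
    ultimately have "uniform_limit (cball w 1) (\<lambda>Y v. \<Sum>m\<in>Y. theta_term s v \<tau> m)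
        (\<lambda>v. infsum (theta_term s v \<tau>) UNIV) (finite_subsets_at_top UNIV)"
      by (intro Weierstrass_m_test_general) auto
    moreover have "\<forall>\<^sub>F Y in finite_subsets_at_top UNIV.
        continuous_on (cball w 1) (\<lambda>v. \<Sum>m\<in>Y. theta_term s v \<tau> m) \<and>
        (\<lambda>v. \<Sum>m\<in>Y. theta_term s v \<tau> m) holomorphic_on ball w 1"
      unfolding theta_term_def
      by (intro always_eventually allI conjI continuous_intros holomorphic_intros)
    ultimately have "(\<lambda>v. infsum (theta_term s v \<tau>) UNIV) holomorphic_on ball w 1"
      by (auto intro: holomorphic_uniform_limit)
    thus ?thesis
      unfolding analytic_at_ball by (intro exI[of _ 1]) auto
  qed
  thus ?thesis
    using analytic_imp_holomorphic analytic_on_analytic_at by blast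
qed

lemma theta_holomorphic_arg:
  assumes "Im \<tau> > 0"
  shows "(\<lambda>v. theta2 v \<tau>) holomorphic_on A" "(\<lambda>v. theta3 v \<tau>) holomorphic_on A"
  using theta_term_holomorphic_sum[OF assms, of "1/2"] theta_term_holomorphic_sum[OF assms, of 0]
  by (auto simp: theta2_eq_infsum[abs_def] theta3_eq_infsum[abs_def] intro: holomorphic_on_subset)

lemma exp_of_int_2pi: "exp (2 * of_int m * \<i> * of_real pi) = (1::complex)"
  using exp_eq_1[of "2 * of_int m * \<i> * of_real pi"] by auto

lemma theta3_plus_pi: "theta3 (v + of_real pi) \<tau> = theta3 v \<tau>"
proof -
  have "theta_term 0 (v + of_real pi) \<tau> m = theta_term 0 v \<tau> m" for m
    using exp_of_int_2pi[of m] by (simp add: theta_term_def exp_add algebra_simps)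
  thus ?thesis unfolding theta3_eq_infsum by (metis (no_types, lifting) infsum_cong)
qed

lemma theta2_plus_pi: "theta2 (v + of_real pi) \<tau> = - theta2 v \<tau>"
proof -
  have "theta_term (1/2) (v + of_real pi) \<tau> m = - theta_term (1/2) v \<tau> m" for m
    using exp_of_int_2pi[of m] by (simp add: theta_term_def exp_add algebra_simps)
  hence "theta_term (1/2) (v + of_real pi) \<tau> = (\<lambda>m. - theta_term (1/2) v \<tau> m)" by blast
  thus ?thesis by (simp add: theta2_eq_infsum infsum_uminus)
qed

lemma theta3_minus [simp]: "theta3 (- v) \<tau> = theta3 v \<tau>"
  unfolding theta3_eq_infsum
  by (rule infsum_reindex_bij_witness[of _ uminus uminus]) (auto simp: theta_term_def power2_eq_square)

lemma theta2_minus [simp]: "theta2 (- v) \<tau> = theta2 v \<tau>"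
  unfolding theta2_eq_infsum
  by (rule infsum_reindex_bij_witness[of _ "\<lambda>m. - m - 1" "\<lambda>m. - m - 1"])
     (auto simp: theta_term_half power2_eq_square algebra_simps)

text \<open>
  Since \<open>(m + 1/2)\<^sup>2 = m\<^sup>2 + m + 1/4\<close>, half a quasi-period turns one series into the other. This transfers
  identities from \<open>\<theta>\<^sub>3\<close> to \<open>\<theta>\<^sub>2\<close>.
\<close>

lemma theta2_eq_theta3:
  "theta2 v \<tau> = exp (of_real pi * \<i> * \<tau> / 2 + \<i> * v) * theta3 (v + of_real pi * \<tau>) \<tau>"
proof -
  have "theta_term (1/2) v \<tau> m = 
      exp (of_real pi * \<i> * \<tau> / 2 + \<i> * v) * theta_term 0 (v + of_real pi * \<tau>) \<tau> m" for m
    unfolding theta_term_half theta_term_0 exp_add[symmetric]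
    by (rule arg_cong[of _ _ exp]) (simp add: power2_eq_square algebra_simps)
  hence "theta_term (1/2) v \<tau> = (\<lambda>m. exp (of_real pi * \<i> * \<tau> / 2 + \<i> * v) * theta_term 0 (v + of_real pi * \<tau>) \<tau> m)"
    by blast
  thus ?thesis
    by (simp add: theta2_eq_infsum theta3_eq_infsum infsum_cmult_right')
qed

lemma theta3_quasiperiod:
  "theta3 (v + 2 * (of_real pi * \<tau>)) \<tau> = exp (- 2 * of_real pi * \<i> * \<tau> - 2 * \<i> * v) * theta3 v \<tau>"
proof -
  have "theta3 (v + 2 * (of_real pi * \<tau>)) \<tau> = (\<Sum>\<^sub>\<infinity>m. exp (- 2 * of_real pi * \<i> * \<tau> - 2 * \<i> * v) * theta_term 0 v \<tau> m)"
    unfolding theta3_eq_infsum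
  proof (rule infsum_reindex_bij_witness[of _ "\<lambda>m. m - 1" "\<lambda>m. m + 1"])
    fix m :: int
    show "exp (- 2 * of_real pi * \<i> * \<tau> - 2 * \<i> * v) * theta_term 0 v \<tau> (m + 1) =
        theta_term 0 (v + 2 * (of_real pi * \<tau>)) \<tau> m"
      unfolding theta_term_def exp_add[symmetric]
      by (rule arg_cong[of _ _ exp]) (simp add: power2_eq_square algebra_simps)
  qed auto
  thus ?thesis by (simp add: theta3_eq_infsum infsum_cmult_right')
qed

lemma theta2_half_quasiperiod:
  "theta2 (v + of_real pi * \<tau>) \<tau> = exp (- of_real pi * \<i> * \<tau> / 2 - \<i> * v) * theta3 v \<tau>"
proof -
  have "theta2 (v + of_real pi * \<tau>) \<tau> = exp (of_real pi * \<i> * \<tau> / 2 + \<i> * (v + of_real pi * \<tau>)) * 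
      theta3 (v + 2 * (of_real pi * \<tau>)) \<tau>"
    by (subst theta2_eq_theta3) (simp add: algebra_simps)
  also have "\<dots> = exp (of_real pi * \<i> * \<tau> / 2 + \<i> * (v + of_real pi * \<tau>) + (- 2 * of_real pi * \<i> * \<tau> - 2 * \<i> * v)) * theta3 v \<tau>"
    unfolding theta3_quasiperiod by (simp only: exp_add mult.assoc)
  also have "of_real pi * \<i> * \<tau> / 2 + \<i> * (v + of_real pi * \<tau>) + (- 2 * of_real pi * \<i> * \<tau> - 2 * \<i> * v) = - of_real pi * \<i> * \<tau> / 2 - \<i> * v"
    by (simp add: algebra_simps)
  finally show ?thesis .
qed

lemma has_sum_product_pairs:
  fixes f g :: "_ \<Rightarrow> complex"
  assumes "(\<lambda>x. norm (f x)) summable_on A" "(\<lambda>x. norm (g x)) summable_on B"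
  shows "((\<lambda>(x, y). f x * g y) has_sum (infsum f A * infsum g B)) (A \<times> B)"
proof -
  have "(\<lambda>p. norm ((\<lambda>(x, y). f x * g y) p)) summable_on A \<times> B"
    unfolding Infinite_Sum.abs_summable_on_Sigma_iff
    using assms by (auto simp: norm_mult infsum_cmult_right' abs_mult infsum_nonneg intro!: summable_on_cmult_right summable_on_cmult_left)
  hence s: "(\<lambda>(x, y). f x * g y) summable_on A \<times> B"
    by (rule abs_summable_summable)
  have "infsum (\<lambda>(x, y). f x * g y) (A \<times> B) = infsum f A * infsum g B"
    using infsum_Sigma'_banach[of "\<lambda>x y. f x * g y" A "\<lambda>_. B"] s by (simp add: infsum_cmult_left' infsum_cmult_right')
  thus ?thesis using s by (simp add: has_sum_iff)
qed

text \<open>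
  Multiplying out the two series on the left gives a sum over the lattice of pairs \<open>(m, n)\<close> of
  integers. The quadratic form \<open>m\<^sup>2 + n\<^sup>2\<close> becomes \<open>2 a\<^sup>2 + 2 b\<^sup>2\<close> in the coordinates
  \<open>a = (m + n)/2\<close>, \<open>b = (m - n)/2\<close>, which are both integers or both half-integers.
\<close>

lemma theta3_mult_theta3:
  assumes \<tau>: "Im \<tau> > 0"
  shows "theta3 (x + y) \<tau> * theta3 (x - y) \<tau> =
    theta3 (2 * x) (2 * \<tau>) * theta3 (2 * y) (2 * \<tau>) + theta2 (2 * x) (2 * \<tau>) * theta2 (2 * y) (2 * \<tau>)"
proof -
  define F where "F = (\<lambda>(m, n). theta_term 0 (x + y) \<tau> m * theta_term 0 (x - y) \<tau> n)"
  have F: "(F has_sum (theta3 (x + y) \<tau> * theta3 (x - y) \<tau>)) UNIV"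
    using has_sum_product_pairs[OF theta_term_abs_summable theta_term_abs_summable, OF \<tau> \<tau>, of 0 "x+y" 0 "x-y"]
    by (simp add: F_def theta3_eq_infsum)
  have \<tau>2: "Im (2 * \<tau>) > 0" using \<tau> by simp
  have G: "((\<lambda>(a, b). theta_term s (2 * x) (2 * \<tau>) a * theta_term s (2 * y) (2 * \<tau>) b)
      has_sum (infsum (theta_term s (2 * x) (2 * \<tau>)) UNIV * infsum (theta_term s (2 * y) (2 * \<tau>)) UNIV)) UNIV" for s
    using has_sum_product_pairs[OF theta_term_abs_summable theta_term_abs_summable, OF \<tau>2 \<tau>2, of s "2*x" s "2*y"]
    by simp
  have e: "(F has_sum (theta3 (2 * x) (2 * \<tau>) * theta3 (2 * y) (2 * \<tau>))) {(m, n). even (m + n)}"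
    unfolding theta3_eq_infsum
  proof (rule has_sum_reindex_bij_witness[of UNIV "\<lambda>(m, n). ((m + n) div 2, (m - n) div 2)" "\<lambda>(a, b). (a + b, a - b)",
      THEN iffD1, OF _ _ _ _ _ refl G[of 0]])
    fix p :: "int \<times> int"
    obtain a b where p: "p = (a, b)" by (cases p)
    show "F ((\<lambda>(a, b). (a + b, a - b)) p) =
         (\<lambda>(a, b). theta_term 0 (2 * x) (2 * \<tau>) a * theta_term 0 (2 * y) (2 * \<tau>) b) p"
      unfolding p F_def theta_term_half theta_term_0 prod.case exp_add[symmetric]
      by (rule arg_cong[of _ _ exp]) (simp add: power2_eq_square algebra_simps)
  qed (auto, presburger+)
  have o: "(F has_sum (theta2 (2 * x) (2 * \<tau>) * theta2 (2 * y) (2 * \<tau>))) {(m, n). odd (m + n)}"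
    unfolding theta2_eq_infsum
  proof (rule has_sum_reindex_bij_witness[of UNIV "\<lambda>(m, n). ((m + n - 1) div 2, (m - n - 1) div 2)" "\<lambda>(a, b). (a + b + 1, a - b)",
      THEN iffD1, OF _ _ _ _ _ refl G[of "1/2"]])
    fix p :: "int \<times> int"
    obtain a b where p: "p = (a, b)" by (cases p)
    show "F ((\<lambda>(a, b). (a + b + 1, a - b)) p) =
         (\<lambda>(a, b). theta_term (1/2) (2 * x) (2 * \<tau>) a * theta_term (1/2) (2 * y) (2 * \<tau>) b) p"
      unfolding p F_def theta_term_half theta_term_0 prod.case exp_add[symmetric]
      by (rule arg_cong[of _ _ exp]) (simp add: power2_eq_square algebra_simps)
  qed (auto, presburger+)
  have "(F has_sum (theta3 (2 * x) (2 * \<tau>) * theta3 (2 * y) (2 * \<tau>) + theta2 (2 * x) (2 * \<tau>) * theta2 (2 * y) (2 * \<tau>)))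
      ({(m, n). even (m + n)} \<union> {(m, n). odd (m + n)})"
    using e o by (rule has_sum_Un_disjoint) auto
  moreover have "{(m, n). even (m + n)} \<union> {(m, n). odd (m + n)} = (UNIV :: (int \<times> int) set)"
    by auto
  ultimately show ?thesis
    using F has_sum_unique by metis
qed

text \<open>
  The preceding identity with \<open>x\<close> moved by half a quasi-period of \<open>\<tau>\<close>; then \<open>2 x\<close> moves by half a
  quasi-period of \<open>2 \<tau>\<close>, which exchanges the two functions on the right.
\<close>

lemma theta2_mult_theta2:
  assumes \<tau>: "Im \<tau> > 0"
  shows "theta2 (x + y) \<tau> * theta2 (x - y) \<tau> =
    theta2 (2 * x) (2 * \<tau>) * theta3 (2 * y) (2 * \<tau>) + theta3 (2 * x) (2 * \<tau>) * theta2 (2 * y) (2 * \<tau>)"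
proof -
  define p where "p = complex_of_real pi * \<tau>"
  define E where "E = exp (of_real pi * \<i> * \<tau> + 2 * \<i> * x)"
  have E': "exp (of_real pi * \<i> * (2 * \<tau>) / 2 + \<i> * (2 * x)) = E"
    by (simp add: E_def algebra_simps)
  have E'': "exp (- of_real pi * \<i> * (2 * \<tau>) / 2 - \<i> * (2 * x)) = inverse E"
    unfolding E_def exp_minus[symmetric] by (simp add: algebra_simps)
  have "theta2 (x + y) \<tau> * theta2 (x - y) \<tau> =
      (exp (of_real pi * \<i> * \<tau> / 2 + \<i> * (x + y)) * exp (of_real pi * \<i> * \<tau> / 2 + \<i> * (x - y))) *
       (theta3 ((x + p) + y) \<tau> * theta3 ((x + p) - y) \<tau>)"
    unfolding theta2_eq_theta3[of "x + y"] theta2_eq_theta3[of "x - y"]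
    by (simp add: p_def algebra_simps)
  also have "exp (of_real pi * \<i> * \<tau> / 2 + \<i> * (x + y)) * exp (of_real pi * \<i> * \<tau> / 2 + \<i> * (x - y)) = E"
    unfolding E_def exp_add[symmetric] by (rule arg_cong[of _ _ exp]) (simp add: algebra_simps)
  also have "theta3 ((x + p) + y) \<tau> * theta3 ((x + p) - y) \<tau> =
     theta3 (2 * x + of_real pi * (2 * \<tau>)) (2 * \<tau>) * theta3 (2 * y) (2 * \<tau>) +
     theta2 (2 * x + of_real pi * (2 * \<tau>)) (2 * \<tau>) * theta2 (2 * y) (2 * \<tau>)"
    unfolding theta3_mult_theta3[OF \<tau>] by (simp add: p_def algebra_simps)
  also have "theta2 (2 * x + of_real pi * (2 * \<tau>)) (2 * \<tau>) = inverse E * theta3 (2 * x) (2 * \<tau>)"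
    unfolding theta2_half_quasiperiod E'' ..
  also have "theta3 (2 * x + of_real pi * (2 * \<tau>)) (2 * \<tau>) = inverse E * theta2 (2 * x) (2 * \<tau>)"
    unfolding theta2_eq_theta3[of "2 * x"] E' by (simp add: E_def)
  finally show ?thesis
    by (simp add: E_def algebra_simps)
qed

section \<open>Multiplication of the argument and of the period by n\<close>

definition centred_shift :: "nat \<Rightarrow> nat \<Rightarrow> real" where
  "centred_shift n j = (2 * real j + 1 - real n) * pi / (2 * real n)"

lemma sum_centred_shift: "(\<Sum>j<n. centred_shift n j) = 0"
proof -
  have "(\<Sum>j<m. 2 * real j + 1 - real n) = real m * (real m - real n)" for m
    by (induction m) (auto simp: algebra_simps)
  from this[of n] show ?thesis
    by (simp add: centred_shift_def sum_divide_distrib[symmetric] sum_distrib_right[symmetric])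
qed

lemma int_recurrence_const:
  fixes D :: "int \<Rightarrow> 'b"
  assumes "\<And>M. D (M + 1) = D M"
  shows "D M = D 0"
proof (induction M rule: int_induct[where k = 0])
  case (step2 i)
  thus ?case using assms[of "i - 1"] by simp
qed (use assms in auto)

text \<open>
  The product of the \<open>n\<close> series is a sum over \<open>g \<in> \<int>\<^sup>n\<close>; collect the terms with \<open>\<Sum>g = N\<close> into the
  coefficient \<open>C N\<close> of \<open>exp (2 \<i> u N)\<close>. Adding 1 to all entries of \<open>g\<close> changes \<open>\<Sum>g\<^sup>2\<close> by \<open>2N + n\<close> and
  leaves \<open>\<Sum>\<^sub>j g\<^sub>j s\<^sub>j\<close> fixed, the shifts \<open>s\<^sub>j\<close> being centred: this gives \<open>C (N + n)\<close> in terms of \<open>C N\<close>. Rotating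
  \<open>g\<close> cyclically multiplies each term by \<open>exp (- 2 \<pi> \<i> N / n)\<close>, so \<open>C N = 0\<close> unless \<open>n\<close> divides \<open>N\<close>.
  Hence \<open>C\<close> is determined by \<open>C 0\<close>, and the series is that of \<open>C 0 * \<theta>\<^sub>3(n u, n \<tau>)\<close>. Half a
  quasi-period of \<open>\<tau>\<close> in \<open>u\<close> is half a quasi-period of \<open>n \<tau>\<close> in \<open>n u\<close>, so the constant is the same
  for \<open>\<theta>\<^sub>2\<close>.
\<close>

lemma theta_multiplication:
  assumes \<tau>: "Im \<tau> > 0" and n: "n \<ge> 1"
  obtains c where
    "\<And>u. (\<Prod>j<n. theta3 (u + of_real (centred_shift n j)) \<tau>) = c * theta3 (of_nat n * u) (of_nat n * \<tau>)"
    "\<And>u. (\<Prod>j<n. theta2 (u + of_real (centred_shift n j)) \<tau>) = c * theta2 (of_nat n * u) (of_nat n * \<tau>)"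
proof -
  define s where "s = centred_shift n"
  define B where "B = PiE {..<n} (\<lambda>_. UNIV :: int set)"
  define S where "S g = (\<Sum>j<n. g j)" for g :: "nat \<Rightarrow> int"
  define e where "e g = 2 * of_real pi * \<i> * \<tau> * of_int (\<Sum>j<n. (g j)\<^sup>2) + 2 * \<i> * of_real (\<Sum>j<n. of_int (g j) * s j)"
    for g :: "nat \<Rightarrow> int"
  define E where "E g = exp (e g)" for g
  define C where "C N = infsum E {g \<in> B. S g = N}" for N
  have prod_term: "(\<Prod>j<n. theta_term 0 (u + of_real (s j)) \<tau> (g j)) = E g * exp (2 * \<i> * u * of_int (S g))" for u g
  proof -
    have "(\<Prod>j<n. theta_term 0 (u + of_real (s j)) \<tau> (g j)) =
        exp (\<Sum>j<n. 2 * of_real pi * \<i> * (of_int (g j))\<^sup>2 * \<tau> + 2 * of_int (g j) * \<i> * (u + of_real (s j)))"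
      unfolding theta_term_0 by (simp add: exp_sum)
    also have "(\<Sum>j<n. 2 * of_real pi * \<i> * (of_int (g j))\<^sup>2 * \<tau> + 2 * of_int (g j) * \<i> * (u + of_real (s j))) =
        e g + 2 * \<i> * u * of_int (S g)"
      by (simp add: e_def S_def sum.distrib sum_distrib_left algebra_simps)
    finally show ?thesis by (simp add: E_def exp_add)
  qed
  have summ: "(\<lambda>g. E g * exp (2 * \<i> * u * of_int (S g))) summable_on B" for u
  proof -
    let ?f = "\<lambda>j m. norm (theta_term 0 (u + of_real (s j)) \<tau> m)"
    have f: "?f j summable_on UNIV" for j
      by (rule theta_term_abs_summable[OF \<tau>])
    have "infsum (\<lambda>g. \<Prod>j<n. ?f j (g j)) B = (\<Prod>j<n. infsum (?f j) UNIV)"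
      unfolding B_def by (rule infsum_prod_PiE_abs) (use f in auto)
    moreover have "infsum (?f j) UNIV > 0" for j
    proof -
      have "0 < ?f j 0" by (simp add: theta_term_0)
      also have "\<dots> = infsum (?f j) {0}" by simp
      also have "\<dots> \<le> infsum (?f j) UNIV"
        using f by (intro infsum_mono_neutral) auto
      finally show ?thesis .
    qed
    \<comment> \<open>A family that is not summable has sum 0 by convention, so a nonzero sum proves summability.\<close>
    ultimately have "infsum (\<lambda>g. \<Prod>j<n. ?f j (g j)) B \<noteq> 0"
      by (simp add: prod_pos less_imp_neq[symmetric])
    hence "(\<lambda>g. \<Prod>j<n. ?f j (g j)) summable_on B"
      using infsum_not_exists by blast
    hence "(\<lambda>g. norm (E g * exp (2 * \<i> * u * of_int (S g)))) summable_on B"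
      unfolding prod_term[symmetric] prod_norm by simp
    thus ?thesis by (rule abs_summable_summable)
  qed
  have expansion: "(\<Prod>j<n. theta3 (u + of_real (s j)) \<tau>) = (\<Sum>\<^sub>\<infinity>N. C N * exp (2 * \<i> * u * of_int N))" for u
  proof -
    let ?T = "\<lambda>g. E g * exp (2 * \<i> * u * of_int (S g))"
    have bij: "bij_betw snd (Sigma UNIV (\<lambda>N. {g \<in> B. S g = N})) B"
      by (rule bij_betw_byWitness[where f' = "\<lambda>g. (S g, g)"]) auto
    have inner: "infsum ?T {g \<in> B. S g = N} = C N * exp (2 * \<i> * u * of_int N)" for N
    proof -
      have "infsum ?T {g \<in> B. S g = N} = infsum (\<lambda>g. E g * exp (2 * \<i> * u * of_int N)) {g \<in> B. S g = N}"
        by (rule infsum_cong) auto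
      thus ?thesis by (simp add: C_def infsum_cmult_left')
    qed
    have "(\<Prod>j<n. theta3 (u + of_real (s j)) \<tau>) = infsum ?T B"
      unfolding theta3_eq_infsum prod_term[symmetric] B_def
      by (rule infsum_prod_PiE_abs[symmetric]) (auto intro: theta_term_abs_summable[OF \<tau>])
    also have "infsum ?T B = infsum (\<lambda>(N, g). ?T g) (Sigma UNIV (\<lambda>N. {g \<in> B. S g = N}))"
      using infsum_reindex_bij_betw[OF bij, of ?T] by (simp add: case_prod_unfold)
    also have "\<dots> = (\<Sum>\<^sub>\<infinity>N. infsum ?T {g \<in> B. S g = N})"
      using summ[of u] summable_on_reindex_bij_betw[OF bij, of ?T]
      by (intro infsum_Sigma'_banach[symmetric]) (simp add: case_prod_unfold)
    finally show ?thesis unfolding inner .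
  qed
  have shift: "C (N + int n) = exp (2 * of_real pi * \<i> * \<tau> * of_int (2 * N + int n)) * C N" for N
  proof -
    have "C (N + int n) = infsum (\<lambda>g. exp (2 * of_real pi * \<i> * \<tau> * of_int (2 * N + int n)) * E g) {g \<in> B. S g = N}"
      unfolding C_def
    proof (rule infsum_reindex_bij_witness[symmetric, of _ "\<lambda>g. restrict (\<lambda>j. g j - 1) {..<n}" "\<lambda>g. restrict (\<lambda>j. g j + 1) {..<n}"])
      fix g assume g: "g \<in> {g \<in> B. S g = N}"
      show "restrict (\<lambda>j. restrict (\<lambda>j. g j + 1) {..<n} j - 1) {..<n} = g"
        using g by (auto simp: B_def PiE_def extensional_def restrict_def)
      show "restrict (\<lambda>j. g j + 1) {..<n} \<in> {g \<in> B. S g = N + int n}"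
        using g by (auto simp: B_def S_def sum.distrib)
      have "e (restrict (\<lambda>j. g j + 1) {..<n}) = 2 * of_real pi * \<i> * \<tau> * of_int (2 * N + int n) + e g"
      proof -
        have "(\<Sum>j<n. (g j + 1)\<^sup>2) = (\<Sum>j<n. (g j)\<^sup>2) + (2 * N + int n)"
          using g by (auto simp: S_def power2_eq_square algebra_simps sum.distrib simp flip: sum_distrib_right)
        moreover have "(\<Sum>j<n. of_int (g j + 1) * s j) = (\<Sum>j<n. of_int (g j) * s j)"
          using sum_centred_shift[of n] by (simp add: s_def algebra_simps sum.distrib)
        ultimately show ?thesis
          unfolding e_def by (simp add: algebra_simps cong: sum.cong_simp)
      qed
      thus "E (restrict (\<lambda>j. g j + 1) {..<n}) = exp (2 * of_real pi * \<i> * \<tau> * of_int (2 * N + int n)) * E g"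
        by (simp only: E_def exp_add)
    next
      fix g assume g: "g \<in> {g \<in> B. S g = N + int n}"
      show "restrict (\<lambda>j. restrict (\<lambda>j. g j - 1) {..<n} j + 1) {..<n} = g"
        using g by (auto simp: B_def PiE_def extensional_def restrict_def)
      show "restrict (\<lambda>j. g j - 1) {..<n} \<in> {g \<in> B. S g = N}"
        using g by (auto simp: B_def S_def sum_subtractf)
    qed
    thus ?thesis by (simp add: C_def infsum_cmult_right')
  qed
  have rotate: "C N = exp (- 2 * of_real pi * \<i> * of_int N / of_nat n) * C N" for N
  proof -
    define r where "r j = (if Suc j = n then 0 else Suc j)" for j
    define r' where "r' j = (if j = 0 then n - 1 else j - 1)" for j
    have r: "r j < n" "r' j < n" "r' (r j) = j" "r (r' j) = j" if "j < n" for j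
      using that by (auto simp: r_def r'_def)
    have bij: "bij_betw r {..<n} {..<n}"
      by (rule bij_betw_byWitness[where f' = r']) (use r in auto)
    have reindex: "(\<Sum>j<n. h (r j)) = (\<Sum>j<n. h j)" for h :: "nat \<Rightarrow> 'z :: comm_monoid_add"
      using sum.reindex_bij_betw[OF bij, of h] .
    have "C N = infsum (\<lambda>g. exp (- 2 * of_real pi * \<i> * of_int N / of_nat n) * E g) {g \<in> B. S g = N}"
      unfolding C_def
    proof (rule infsum_reindex_bij_witness[symmetric, of _ "\<lambda>g. restrict (g \<circ> r') {..<n}" "\<lambda>g. restrict (g \<circ> r) {..<n}"])
      fix g assume g: "g \<in> {g \<in> B. S g = N}"
      show "restrict (restrict (g \<circ> r) {..<n} \<circ> r') {..<n} = g"
        using g r by (auto simp: B_def PiE_def extensional_def restrict_def)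
      show "restrict (restrict (g \<circ> r') {..<n} \<circ> r) {..<n} = g"
        using g r by (auto simp: B_def PiE_def extensional_def restrict_def)
      show "restrict (g \<circ> r) {..<n} \<in> {g \<in> B. S g = N}"
        using g reindex[of g] by (auto simp: B_def S_def)
      show "restrict (g \<circ> r') {..<n} \<in> {g \<in> B. S g = N}"
        using g reindex[of "g \<circ> r'"] r by (auto simp: B_def S_def)
      have "e (restrict (g \<circ> r) {..<n}) = - 2 * of_real pi * \<i> * of_int N / of_nat n + e g + 2 * of_int (g 0) * \<i> * of_real pi"
      proof -
        have sj: "s j = s (r j) - pi / real n + (if r j = 0 then pi else 0)" if "j < n" for j
          using that n by (auto simp: s_def centred_shift_def r_def of_nat_diff field_simps)
        have "(\<Sum>j<n. of_int (g (r j)) * s j) =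
            (\<Sum>j<n. of_int (g (r j)) * (s (r j) - pi / real n + (if r j = 0 then pi else 0)))"
          by (intro sum.cong refl) (subst sj, auto)
        also have "\<dots> = (\<Sum>j<n. of_int (g j) * (s j - pi / real n + (if j = 0 then pi else 0)))"
          by (rule reindex)
        also have "\<dots> = (\<Sum>j<n. of_int (g j) * s j) - (\<Sum>j<n. of_int (g j)) * pi / real n + (\<Sum>j<n. of_int (g j) * (if j = 0 then pi else 0))"
          by (simp add: algebra_simps sum.distrib sum_subtractf sum_distrib_left sum_distrib_right sum_divide_distrib)
        also have "(\<Sum>j<n. real_of_int (g j)) = real_of_int N"
          using g by (auto simp: S_def)
        also have "(\<Sum>j<n. of_int (g j) * (if j = 0 then pi else 0)) = of_int (g 0) * pi"
          using n by (subst sum.remove[of _ 0]) (auto intro!: sum.neutral)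
        finally have 1: "(\<Sum>j<n. of_int (g (r j)) * s j) = (\<Sum>j<n. of_int (g j) * s j) - of_int N * pi / real n + of_int (g 0) * pi" .
        have "e (restrict (g \<circ> r) {..<n}) = 2 * of_real pi * \<i> * \<tau> * of_int (\<Sum>j<n. (g (r j))\<^sup>2) + 2 * \<i> * of_real (\<Sum>j<n. of_int (g (r j)) * s j)"
          unfolding e_def by (simp cong: sum.cong_simp)
        also have "(\<Sum>j<n. (g (r j))\<^sup>2) = (\<Sum>j<n. (g j)\<^sup>2)"
          by (rule reindex[of "\<lambda>j. (g j)\<^sup>2"])
        finally show ?thesis unfolding 1 e_def by (simp add: algebra_simps)
      qed
      thus "E (restrict (g \<circ> r) {..<n}) = exp (- 2 * of_real pi * \<i> * of_int N / of_nat n) * E g"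
        by (simp only: E_def exp_add exp_of_int_2pi mult_1_right)
    qed
    thus ?thesis by (simp add: C_def infsum_cmult_right')
  qed
  have C0: "C N = 0" if "\<not> int n dvd N" for N
  proof (rule ccontr)
    assume "C N \<noteq> 0"
    hence "exp (- 2 * of_real pi * \<i> * of_int N / of_nat n) = (1 :: complex)"
      using rotate[of N] by simp
    then obtain k :: int where "Im (- 2 * of_real pi * \<i> * of_int N / of_nat n :: complex) = of_int (2 * k) * pi"
      unfolding exp_eq_1 by blast
    hence "pi * real_of_int N = pi * (- (of_int k * real n))"
      using n by (simp add: field_simps)
    hence "real_of_int N = - (of_int k * real n)"
      using mult_left_cancel[OF pi_neq_zero] by blast
    hence "N = - (k * int n)"
      by (metis of_int_minus of_int_mult of_int_of_nat_eq of_int_eq_iff)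
    thus False using that by simp
  qed
  have Cn: "C (int n * M) = exp (2 * of_real pi * \<i> * (of_int M)\<^sup>2 * (of_nat n * \<tau>)) * C 0" for M
  proof -
    define D where "D M = exp (- (2 * of_real pi * \<i> * (of_int M)\<^sup>2 * (of_nat n * \<tau>))) * C (int n * M)" for M
    have "D (M + 1) = D M" for M
    proof -
      have "D (M + 1) = exp (- (2 * of_real pi * \<i> * (of_int (M + 1))\<^sup>2 * (of_nat n * \<tau>))) * C (int n * M + int n)"
        by (simp add: D_def algebra_simps)
      also have "\<dots> = exp (- (2 * of_real pi * \<i> * (of_int (M + 1))\<^sup>2 * (of_nat n * \<tau>)) + 2 * of_real pi * \<i> * \<tau> * of_int (2 * (int n * M) + int n)) * C (int n * M)"
        unfolding shift exp_add by (simp only: mult.assoc)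
      also have "- (2 * of_real pi * \<i> * (of_int (M + 1))\<^sup>2 * (of_nat n * \<tau>)) + 2 * of_real pi * \<i> * \<tau> * of_int (2 * (int n * M) + int n)
          = - (2 * of_real pi * \<i> * (of_int M)\<^sup>2 * (of_nat n * \<tau>))"
        by (simp add: power2_eq_square algebra_simps)
      finally show ?thesis by (simp add: D_def)
    qed
    hence "D M = D 0" by (rule int_recurrence_const)
    thus ?thesis by (simp add: D_def exp_minus field_simps)
  qed
  have t3: "(\<Prod>j<n. theta3 (u + of_real (s j)) \<tau>) = C 0 * theta3 (of_nat n * u) (of_nat n * \<tau>)" for u
  proof -
    have "(\<Prod>j<n. theta3 (u + of_real (s j)) \<tau>) = (\<Sum>\<^sub>\<infinity>N\<in>range (\<lambda>M. int n * M). C N * exp (2 * \<i> * u * of_int N))"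
      unfolding expansion
    proof (rule infsum_cong_neutral)
      fix N assume "N \<in> UNIV - range (\<lambda>M. int n * M)"
      hence "C N = 0" by (intro C0) (auto elim!: dvdE)
      thus "C N * exp (2 * \<i> * u * of_int N) = 0" by simp
    qed auto
    also have "\<dots> = (\<Sum>\<^sub>\<infinity>M. C (int n * M) * exp (2 * \<i> * u * of_int (int n * M)))"
      by (subst infsum_reindex) (use n in \<open>auto simp: inj_on_def o_def\<close>)
    also have "\<dots> = (\<Sum>\<^sub>\<infinity>M. C 0 * theta_term 0 (of_nat n * u) (of_nat n * \<tau>) M)"
      unfolding Cn theta_term_0 exp_add by (intro infsum_cong) (simp add: algebra_simps)
    finally show ?thesis by (simp add: theta3_eq_infsum infsum_cmult_right')
  qed
  have t2: "(\<Prod>j<n. theta2 (u + of_real (s j)) \<tau>) = C 0 * theta2 (of_nat n * u) (of_nat n * \<tau>)" for u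
  proof -
    have "(\<Prod>j<n. theta2 (u + of_real (s j)) \<tau>) =
        (\<Prod>j<n. exp (of_real pi * \<i> * \<tau> / 2 + \<i> * (u + of_real (s j)))) * (\<Prod>j<n. theta3 ((u + of_real pi * \<tau>) + of_real (s j)) \<tau>)"
      unfolding prod.distrib[symmetric] by (intro prod.cong refl) (subst theta2_eq_theta3, simp add: algebra_simps)
    also have "(\<Prod>j<n. exp (of_real pi * \<i> * \<tau> / 2 + \<i> * (u + of_real (s j)))) =
        exp (of_nat n * (of_real pi * \<i> * \<tau> / 2 + \<i> * u) + \<i> * of_real (\<Sum>j<n. s j))"
      unfolding exp_sum[OF finite_lessThan, symmetric]
      by (simp add: sum.distrib sum_distrib_left algebra_simps)
    also have "(\<Sum>j<n. s j) = 0" unfolding s_def by (rule sum_centred_shift)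
    finally show ?thesis
      unfolding t3 theta2_eq_theta3[of "of_nat n * u"] by (simp add: algebra_simps)
  qed
  show thesis using that[of "C 0"] t2 t3 unfolding s_def by blast
qed

section \<open>Addition and Landen formulas, zeros, and the derivative at 0\<close>

text \<open>
  In the classical notation this is \<open>\<theta>\<^sub>1\<close> with the sign for which its derivative at 0 is positive on the
  imaginary axis.
\<close>

definition theta1 :: "complex \<Rightarrow> complex \<Rightarrow> complex" where
  "theta1 v \<tau> = theta2 (v - of_real pi / 2) \<tau>"

definition theta4 :: "complex \<Rightarrow> complex \<Rightarrow> complex" where
  "theta4 v \<tau> = theta3 (v + of_real pi / 2) \<tau>"

lemma theta3_minus_pi: "theta3 (v - of_real pi) \<tau> = theta3 v \<tau>"
  using theta3_plus_pi[of "v - of_real pi" \<tau>] by simp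

lemma theta2_minus_pi: "theta2 (v - of_real pi) \<tau> = - theta2 v \<tau>"
  using theta2_plus_pi[of "v - of_real pi" \<tau>] by simp

lemma theta4_alt: "theta4 v \<tau> = theta3 (v - of_real pi / 2) \<tau>"
proof -
  have "v + of_real pi / 2 = (v - of_real pi / 2) + of_real pi"
    by (simp add: complex_eq_iff)
  thus ?thesis unfolding theta4_def by (simp only: theta3_plus_pi)
qed

lemma theta2_half_pi: "theta2 (of_real pi / 2) \<tau> = 0"
proof -
  have "of_real pi / 2 = - (of_real pi / 2) + complex_of_real pi"
    by (simp add: complex_eq_iff)
  hence "theta2 (of_real pi / 2) \<tau> = - theta2 (- (of_real pi / 2)) \<tau>"
    using theta2_plus_pi[of "- (of_real pi / 2)" \<tau>] by simp
  thus ?thesis by simp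
qed

lemma theta1_0 [simp]: "theta1 0 \<tau> = 0"
  using theta2_half_pi[of \<tau>] by (simp add: theta1_def)

context
  fixes \<tau> :: complex
  assumes \<tau>: "Im \<tau> > 0"
begin

lemma theta4_mult_theta4:
  "theta4 (x + y) \<tau> * theta4 (x - y) \<tau> =
     theta3 (2 * x) (2 * \<tau>) * theta3 (2 * y) (2 * \<tau>) - theta2 (2 * x) (2 * \<tau>) * theta2 (2 * y) (2 * \<tau>)"
proof -
  have "theta4 (x + y) \<tau> * theta4 (x - y) \<tau> =
      theta3 ((x + of_real pi / 2) + y) \<tau> * theta3 ((x + of_real pi / 2) - y) \<tau>"
    by (simp add: theta4_def algebra_simps)
  also have "2 * (x + of_real pi / 2) = 2 * x + of_real pi" by simp
  ultimately show ?thesis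
    unfolding theta3_mult_theta3[OF \<tau>] by (simp add: theta3_plus_pi theta2_plus_pi)
qed

lemma theta1_mult_theta1:
  "theta1 (x + y) \<tau> * theta1 (x - y) \<tau> =
     theta3 (2 * x) (2 * \<tau>) * theta2 (2 * y) (2 * \<tau>) - theta2 (2 * x) (2 * \<tau>) * theta3 (2 * y) (2 * \<tau>)"
proof -
  have "theta1 (x + y) \<tau> * theta1 (x - y) \<tau> =
      theta2 ((x - of_real pi / 2) + y) \<tau> * theta2 ((x - of_real pi / 2) - y) \<tau>"
    by (simp add: theta1_def algebra_simps)
  also have "2 * (x - of_real pi / 2) = 2 * x - of_real pi" by simp
  ultimately show ?thesis
    unfolding theta2_mult_theta2[OF \<tau>] by (simp add: theta3_minus_pi theta2_minus_pi)
qed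

lemma theta_squares:
  "(theta3 x \<tau>)\<^sup>2 = theta3 (2 * x) (2 * \<tau>) * theta3 0 (2 * \<tau>) + theta2 (2 * x) (2 * \<tau>) * theta2 0 (2 * \<tau>)"
  "(theta2 x \<tau>)\<^sup>2 = theta2 (2 * x) (2 * \<tau>) * theta3 0 (2 * \<tau>) + theta3 (2 * x) (2 * \<tau>) * theta2 0 (2 * \<tau>)"
  "(theta4 0 \<tau>)\<^sup>2 = (theta3 0 (2 * \<tau>))\<^sup>2 - (theta2 0 (2 * \<tau>))\<^sup>2"
  using theta3_mult_theta3[OF \<tau>, of x 0] theta2_mult_theta2[OF \<tau>, of x 0] theta4_mult_theta4[of 0 0]
  by (simp_all add: power2_eq_square)

text \<open>
  By the product formulas both sides are polynomials in the values of \<open>\<theta>\<^sub>2\<close> and \<open>\<theta>\<^sub>3\<close> at \<open>2 x\<close>,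
  \<open>2 y\<close> and 0 for the period \<open>2 \<tau>\<close>, and these polynomials are equal. The same holds for the next lemma.
\<close>

lemma theta4_addition:
  "(theta3 x \<tau>)\<^sup>2 * (theta3 y \<tau>)\<^sup>2 - (theta2 x \<tau>)\<^sup>2 * (theta2 y \<tau>)\<^sup>2 =
     theta4 (x + y) \<tau> * theta4 (x - y) \<tau> * (theta4 0 \<tau>)\<^sup>2"
  unfolding theta4_mult_theta4 theta_squares by (simp add: power2_eq_square algebra_simps)

lemma theta1_addition:
  "(theta3 x \<tau>)\<^sup>2 * (theta2 y \<tau>)\<^sup>2 - (theta2 x \<tau>)\<^sup>2 * (theta3 y \<tau>)\<^sup>2 =
     theta1 (x + y) \<tau> * theta1 (x - y) \<tau> * (theta4 0 \<tau>)\<^sup>2"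
  unfolding theta1_mult_theta1 theta_squares by (simp add: power2_eq_square algebra_simps)

text \<open>
  Choosing \<open>y = - \<pi>/4\<close> in a product formula kills one of its two summands, because \<open>\<theta>\<^sub>2(\<pi>/2) = 0\<close>.
\<close>

lemma theta3_theta4_landen: "theta3 v \<tau> * theta4 v \<tau> = theta4 (2 * v) (2 * \<tau>) * theta4 0 (2 * \<tau>)"
proof -
  define h where "h = complex_of_real pi / 4"
  have "theta3 v \<tau> * theta4 v \<tau> = theta3 ((v + h) + (- h)) \<tau> * theta3 ((v + h) - (- h)) \<tau>"
    by (simp add: theta4_def h_def algebra_simps)
  also have "\<dots> = theta3 (2 * (v + h)) (2 * \<tau>) * theta3 (- (2 * h)) (2 * \<tau>) + theta2 (2 * (v + h)) (2 * \<tau>) * theta2 (- (2 * h)) (2 * \<tau>)"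
    unfolding theta3_mult_theta3[OF \<tau>] by simp
  also have "2 * h = of_real pi / 2" by (simp add: h_def)
  also have "2 * (v + h) = 2 * v + of_real pi / 2" by (simp add: h_def)
  finally show ?thesis by (simp add: theta2_half_pi theta4_def)
qed

lemma theta1_theta2_landen: "theta1 v \<tau> * theta2 v \<tau> = theta1 (2 * v) (2 * \<tau>) * theta4 0 (2 * \<tau>)"
proof -
  define h where "h = complex_of_real pi / 4"
  have "theta1 v \<tau> * theta2 v \<tau> = theta2 ((v - h) + h) \<tau> * theta2 ((v - h) - h) \<tau>"
    by (simp add: theta1_def h_def algebra_simps)
  also have "\<dots> = theta2 (2 * (v - h)) (2 * \<tau>) * theta3 (2 * h) (2 * \<tau>) + theta3 (2 * (v - h)) (2 * \<tau>) * theta2 (2 * h) (2 * \<tau>)"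
    unfolding theta2_mult_theta2[OF \<tau>] by simp
  also have "2 * h = of_real pi / 2" by (simp add: h_def)
  also have "2 * (v - h) = 2 * v - of_real pi / 2" by (simp add: h_def)
  finally show ?thesis by (simp add: theta2_half_pi theta4_def theta1_def)
qed

lemma theta1_theta4_landen: "theta1 v \<tau> * theta2 0 \<tau> = 2 * theta1 v (2 * \<tau>) * theta4 v (2 * \<tau>)"
proof -
  define h where "h = (v - of_real pi / 2) / 2"
  have h: "2 * h = v - of_real pi / 2" "h + h = v - of_real pi / 2"
    by (simp_all add: h_def)
  have "theta1 v \<tau> * theta2 0 \<tau> = theta2 (h + h) \<tau> * theta2 (h - h) \<tau>"
    unfolding h by (simp add: theta1_def)
  also have "\<dots> = 2 * theta2 (2 * h) (2 * \<tau>) * theta3 (2 * h) (2 * \<tau>)"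
    by (subst theta2_mult_theta2[OF \<tau>]) simp
  finally show ?thesis unfolding h by (simp add: theta1_def theta4_alt)
qed

lemma theta1_duplication:
  "theta1 (2 * v) \<tau> * (theta2 0 \<tau> * theta3 0 \<tau> * theta4 0 \<tau>) =
     2 * theta1 v \<tau> * theta2 v \<tau> * theta3 v \<tau> * theta4 v \<tau>"
proof -
  have "theta3 0 \<tau> * theta4 0 \<tau> = (theta4 0 (2 * \<tau>))\<^sup>2"
    using theta3_theta4_landen[of 0] by (simp add: power2_eq_square)
  hence "theta1 (2 * v) \<tau> * (theta2 0 \<tau> * theta3 0 \<tau> * theta4 0 \<tau>) = 
      (theta1 (2 * v) \<tau> * theta2 0 \<tau>) * (theta4 0 (2 * \<tau>))\<^sup>2"
    by (simp add: mult.assoc)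
  also have "\<dots> = 2 * (theta1 (2 * v) (2 * \<tau>) * theta4 0 (2 * \<tau>)) * (theta4 (2 * v) (2 * \<tau>) * theta4 0 (2 * \<tau>))"
    unfolding theta1_theta4_landen by (simp add: power2_eq_square)
  also have "\<dots> = 2 * (theta1 v \<tau> * theta2 v \<tau>) * (theta3 v \<tau> * theta4 v \<tau>)"
    unfolding theta1_theta2_landen theta3_theta4_landen ..
  finally show ?thesis by simp
qed

lemma theta2_0_square: "(theta2 0 \<tau>)\<^sup>2 = 2 * theta2 0 (2 * \<tau>) * theta3 0 (2 * \<tau>)"
  using theta_squares(2)[of 0] by simp

end

text \<open>
  The two series run over even and odd \<open>m\<close> of the series on the right.
\<close>

lemma theta3_plus_theta2:
  assumes \<tau>: "Im \<tau> > 0"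
  shows "theta3 v \<tau> + theta2 v \<tau> = theta3 (v / 2) (\<tau> / 4)"
proof -
  have "Im (\<tau> / 4) > 0" using \<tau> by (simp add: Im_divide_numeral)
  hence A: "(theta_term 0 (v / 2) (\<tau> / 4) has_sum theta3 (v / 2) (\<tau> / 4)) UNIV"
    unfolding theta3_eq_infsum by (intro has_sum_infsum theta_term_summable)
  have "(theta_term 0 (v / 2) (\<tau> / 4) has_sum theta3 v \<tau>) {m. even m}"
    unfolding theta3_eq_infsum
    by (rule has_sum_reindex_bij_witness[of UNIV "\<lambda>m. m div 2" "\<lambda>m. 2 * m",
          THEN iffD1, OF _ _ _ _ _ refl has_sum_infsum[OF theta_term_summable[OF \<tau>]]])
       (auto simp: theta_term_0 algebra_simps)
  moreover have "(theta_term 0 (v / 2) (\<tau> / 4) has_sum theta2 v \<tau>) {m. odd m}"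
    unfolding theta2_eq_infsum
    by (rule has_sum_reindex_bij_witness[of UNIV "\<lambda>m. m div 2" "\<lambda>m. 2 * m + 1",
          THEN iffD1, OF _ _ _ _ _ refl has_sum_infsum[OF theta_term_summable[OF \<tau>]]])
       (auto simp: theta_term_0 theta_term_half power2_eq_square algebra_simps add_divide_distrib, presburger)
  ultimately have "(theta_term 0 (v / 2) (\<tau> / 4) has_sum (theta3 v \<tau> + theta2 v \<tau>)) ({m. even m} \<union> {m. odd m})"
    by (rule has_sum_Un_disjoint) auto
  also have "{m. even m} \<union> {m. odd m} = (UNIV :: int set)" by auto
  finally show ?thesis using A has_sum_unique by metis
qed

text \<open>
  Outside a finite set \<open>S\<close> the terms carry a small factor \<open>c\<close> relative to a fixed summable majorant;
  this is how limits at the cusp are obtained.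
\<close>

lemma infsum_finite_part_bound:
  fixes f :: "'a \<Rightarrow> complex"
  assumes f: "f summable_on UNIV" and S: "finite S"
    and bound: "\<And>m. m \<notin> S \<Longrightarrow> norm (f m) \<le> c * M m" and M: "M summable_on UNIV" "\<And>m. M m \<ge> 0" and c: "c \<ge> 0"
  shows "norm (infsum f UNIV - sum f S) \<le> c * infsum M UNIV"
proof -
  have M': "(\<lambda>m. c * M m) summable_on - S"
    by (intro summable_on_cmult_right summable_on_subset_banach[OF M(1)]) auto
  have "infsum f UNIV = infsum f S + infsum f (- S)"
    using infsum_Un_disjoint[of f S "- S"] S f by (simp add: summable_on_subset_banach[OF f])
  hence "norm (infsum f UNIV - sum f S) = norm (infsum f (- S))" using S by simp
  also have "\<dots> \<le> infsum (\<lambda>m. norm (f m)) (- S)"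
  proof (rule norm_infsum_bound)
    show "(\<lambda>m. norm (f m)) summable_on - S"
      by (rule Infinite_Sum.abs_summable_on_comparison_test'[OF M']) (use bound in auto)
  qed
  also have "\<dots> \<le> infsum (\<lambda>m. c * M m) (- S)"
    by (rule infsum_mono) (use bound M' in \<open>auto intro!: Infinite_Sum.abs_summable_on_comparison_test'[OF M']\<close>)
  also have "\<dots> \<le> infsum (\<lambda>m. c * M m) UNIV"
    by (rule infsum_mono_neutral[OF M' summable_on_cmult_right[OF M(1)]]) (use M c in auto)
  finally show ?thesis by (simp add: infsum_cmult_right')
qed

text \<open>
  Relative to its size at \<open>\<tau> = \<i>\<close>, a term with \<open>m \<noteq> 0\<close> has gained the factor
  \<open>exp (- 2 \<pi> m\<^sup>2 (Im \<tau> - 1))\<close>.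
\<close>

lemma theta3_near_cusp:
  obtains C where "\<And>x \<tau>. Im \<tau> \<ge> 1 \<Longrightarrow> norm (theta3 (of_real x) \<tau> - 1) \<le> C * exp (- 2 * pi * (Im \<tau> - 1))"
proof
  define M where "M m = norm (theta_term 0 0 \<i> m)" for m
  fix x \<tau> assume \<tau>: "Im \<tau> \<ge> 1"
  have "norm (infsum (theta_term 0 (of_real x) \<tau>) UNIV - sum (theta_term 0 (of_real x) \<tau>) {0}) \<le> exp (- 2 * pi * (Im \<tau> - 1)) * infsum M UNIV"
  proof (rule infsum_finite_part_bound)
    show "M summable_on UNIV"
      unfolding M_def by (rule theta_term_abs_summable) simp
    fix m :: int assume "m \<notin> {0}"
    hence "0 < m\<^sup>2" by simp
    hence "1 \<le> m\<^sup>2" by linarith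
    hence "real_of_int 1 \<le> real_of_int (m\<^sup>2)" by (simp only: of_int_le_iff)
    hence "(Im \<tau> - 1) * 1 \<le> (Im \<tau> - 1) * (real_of_int m)\<^sup>2"
      using \<tau> by (intro mult_left_mono) auto
    hence "2 * pi * (Im \<tau> - 1) \<le> 2 * pi * ((Im \<tau> - 1) * (real_of_int m)\<^sup>2)"
      by (intro mult_left_mono) auto
    thus "norm (theta_term 0 (of_real x) \<tau> m) \<le> exp (- 2 * pi * (Im \<tau> - 1)) * M m"
      by (simp add: theta_term_0 M_def exp_add[symmetric] power2_eq_square algebra_simps)
  qed (use \<tau> in \<open>auto simp: M_def intro!: theta_term_summable\<close>)
  thus "norm (theta3 (of_real x) \<tau> - 1) \<le> infsum M UNIV * exp (- 2 * pi * (Im \<tau> - 1))"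
    by (simp add: theta3_eq_infsum theta_term_0 mult.commute)
qed

text \<open>
  The leading terms are those with \<open>m = 0\<close> and \<open>m = -1\<close>; for the others \<open>m\<^sup>2 + m \<ge> 1\<close>. The
  estimate holds on a strip of complex \<open>w\<close>, so that it can be differentiated.
\<close>

lemma theta2_near_cusp:
  obtains C where "\<And>w \<tau>. Im \<tau> \<ge> 1 \<Longrightarrow> \<bar>Im w\<bar> \<le> 1 \<Longrightarrow>
    norm (theta2 w \<tau> / exp (of_real pi * \<i> * \<tau> / 2) - 2 * cos w) \<le> C * exp (- 2 * pi * (Im \<tau> - 1))"
proof
  define M where "M m = (norm (theta_term (1/2) \<i> \<i> m) + norm (theta_term (1/2) (-\<i>) \<i> m)) * exp (pi / 2)" for m
  fix w \<tau> :: complex assume \<tau>: "Im \<tau> \<ge> 1" and w: "\<bar>Im w\<bar> \<le> 1"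
  define f where "f m = exp (- (of_real pi * \<i> * \<tau> / 2)) * theta_term (1/2) w \<tau> m" for m
  have f: "f m = exp (2 * of_real pi * \<i> * ((of_int m)\<^sup>2 + of_int m) * \<tau> + (2 * of_int m + 1) * \<i> * w)" for m
    unfolding f_def theta_term_half exp_add[symmetric] by (rule arg_cong[of _ _ exp]) simp
  have "norm (infsum f UNIV - sum f {0, -1}) \<le> exp (- 2 * pi * (Im \<tau> - 1)) * infsum M UNIV"
  proof (rule infsum_finite_part_bound)
    show "f summable_on UNIV"
      unfolding f_def using \<tau> by (intro summable_on_cmult_right theta_term_summable) auto
    show "M summable_on UNIV"
      unfolding M_def by (intro summable_on_cmult_left summable_on_add theta_term_abs_summable) auto
    fix m :: int assume m: "m \<notin> {0, -1}"
    define r where "r = real_of_int m"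
    have "1 \<le> m\<^sup>2 + m"
    proof -
      have "m \<ge> 1 \<or> m \<le> -2" using m by auto
      hence "0 < m * (m + 1)" by (auto intro: mult_neg_neg)
      thus ?thesis by (simp add: power2_eq_square algebra_simps)
    qed
    hence "real_of_int 1 \<le> real_of_int (m\<^sup>2 + m)" by (simp only: of_int_le_iff)
    hence "(Im \<tau> - 1) * 1 \<le> (Im \<tau> - 1) * (r\<^sup>2 + r)"
      using \<tau> by (intro mult_left_mono) (auto simp: r_def)
    hence 1: "2 * pi * (Im \<tau> - 1) \<le> 2 * pi * ((Im \<tau> - 1) * (r\<^sup>2 + r))"
      by (intro mult_left_mono) auto
    have "\<bar>(2 * r + 1) * Im w\<bar> \<le> \<bar>2 * r + 1\<bar> * 1"
      unfolding abs_mult using w by (intro mult_left_mono) auto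
    hence 2: "- ((2 * r + 1) * Im w) \<le> \<bar>2 * r + 1\<bar>"
      using abs_ge_minus_self[of "(2 * r + 1) * Im w"] order_trans by simp
    have "norm (f m) = exp (- (2 * pi * (Im \<tau> * (r\<^sup>2 + r))) - (2 * r + 1) * Im w)"
      by (simp add: f r_def power2_eq_square algebra_simps)
    also have "\<dots> \<le> exp (- 2 * pi * (Im \<tau> - 1) + (- (2 * pi * (r\<^sup>2 + r)) + \<bar>2 * r + 1\<bar>))"
      using 1 2 by (simp add: algebra_simps)
    also have "exp (- (2 * pi * (r\<^sup>2 + r)) + \<bar>2 * r + 1\<bar>) \<le> M m"
    proof -
      have M: "M m = exp (- (2 * pi * (r\<^sup>2 + r)) - (2 * r + 1)) + exp (- (2 * pi * (r\<^sup>2 + r)) + (2 * r + 1))"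
        unfolding M_def distrib_right r_def
        by (simp add: theta_term_half exp_add[symmetric] power2_eq_square algebra_simps)
      have "\<bar>2 * r + 1\<bar> = 2 * r + 1 \<or> \<bar>2 * r + 1\<bar> = - (2 * r + 1)" by linarith
      thus ?thesis unfolding M by (elim disjE; simp only: diff_conv_add_uminus) auto
    qed
    hence "exp (- 2 * pi * (Im \<tau> - 1) + (- (2 * pi * (r\<^sup>2 + r)) + \<bar>2 * r + 1\<bar>)) \<le> exp (- 2 * pi * (Im \<tau> - 1)) * M m"
      unfolding exp_add[of "- 2 * pi * (Im \<tau> - 1)"] by (intro mult_left_mono) auto
    finally show "norm (f m) \<le> exp (- 2 * pi * (Im \<tau> - 1)) * M m" .
  qed (auto simp: M_def)
  moreover have "infsum f UNIV = theta2 w \<tau> / exp (of_real pi * \<i> * \<tau> / 2)"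
    unfolding f_def theta2_eq_infsum infsum_cmult_right' by (simp add: exp_minus field_simps)
  moreover have "sum f {0, -1} = 2 * cos w"
    by (simp add: f cos_exp_eq exp_minus algebra_simps)
  ultimately show "norm (theta2 w \<tau> / exp (of_real pi * \<i> * \<tau> / 2) - 2 * cos w) \<le> infsum M UNIV * exp (- 2 * pi * (Im \<tau> - 1))"
    by (simp add: mult.commute)
qed

lemma cusp_decay:
  assumes "y > 0"
  shows "(\<lambda>k::nat. C * exp (- 2 * pi * (2 ^ k * y - 1))) \<longlonglongrightarrow> 0"
    and "eventually (\<lambda>k::nat. 2 ^ k * y \<ge> 1) sequentially"
proof -
  have *: "filterlim (\<lambda>k::nat. 2 ^ k * y) at_top sequentially"
    using assms by real_asymp
  show "eventually (\<lambda>k::nat. 2 ^ k * y \<ge> 1) sequentially"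
    using * by (simp add: filterlim_at_top)
  show "(\<lambda>k::nat. C * exp (- 2 * pi * (2 ^ k * y - 1))) \<longlonglongrightarrow> 0"
    using assms by real_asymp
qed

text \<open>
  By the Landen formula for \<open>\<theta>\<^sub>3 \<theta>\<^sub>4\<close> a real zero for \<open>\<tau>\<close> produces a real zero for \<open>2 \<tau>\<close>, hence one
  for each \<open>2\<^sup>k \<tau>\<close>. But near the cusp \<open>\<theta>\<^sub>3\<close> is uniformly close to 1 on the real line.
\<close>

lemma theta3_nonzero_real:
  assumes \<tau>: "Im \<tau> > 0"
  shows "theta3 (of_real x) \<tau> \<noteq> 0"
proof
  assume zero: "theta3 (of_real x) \<tau> = 0"
  have "\<exists>x. theta3 (of_real x) (2 ^ k * \<tau>) = 0" for k
  proof (induction k)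
    case 0
    thus ?case using zero by auto
  next
    case (Suc k)
    then obtain x where x: "theta3 (of_real x) (2 ^ k * \<tau>) = 0" by blast
    have "Im (2 ^ k * \<tau>) > 0" using \<tau> by simp
    from theta3_theta4_landen[OF this, of "of_real x"] x
    have "theta4 (2 * of_real x) (2 ^ Suc k * \<tau>) = 0 \<or> theta4 0 (2 ^ Suc k * \<tau>) = 0"
      by (simp add: mult.assoc)
    hence "theta3 (of_real (2 * x + pi / 2)) (2 ^ Suc k * \<tau>) = 0 \<or> theta3 (of_real (pi / 2)) (2 ^ Suc k * \<tau>) = 0"
      by (simp add: theta4_def)
    thus ?case by blast
  qed
  then obtain a where a: "\<And>k. theta3 (of_real (a k)) (2 ^ k * \<tau>) = 0" by metis
  obtain C where C: "\<And>x \<tau>. Im \<tau> \<ge> 1 \<Longrightarrow> norm (theta3 (of_real x) \<tau> - 1) \<le> C * exp (- 2 * pi * (Im \<tau> - 1))"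
    using theta3_near_cusp by blast
  have "eventually (\<lambda>k. C * exp (- 2 * pi * (2 ^ k * Im \<tau> - 1)) < 1) sequentially"
    using cusp_decay(1)[OF \<tau>] by (rule order_tendstoD) auto
  with cusp_decay(2)[OF \<tau>] have "eventually (\<lambda>_. False) sequentially"
  proof eventually_elim
    case (elim k)
    show ?case using C[of "2 ^ k * \<tau>" "a k"] a[of k] elim by simp
  qed
  thus False by simp
qed

lemma theta4_0_nonzero: "Im \<tau> > 0 \<Longrightarrow> theta4 0 \<tau> \<noteq> 0"
  using theta3_nonzero_real[of \<tau> "pi / 2"] by (simp add: theta4_def)

lemma theta3_0_nonzero: "Im \<tau> > 0 \<Longrightarrow> theta3 0 \<tau> \<noteq> 0"
  using theta3_nonzero_real[of \<tau> 0] by simp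

text \<open>
  Again a zero would persist under doubling of \<open>\<tau>\<close>, although \<open>\<theta>\<^sub>2(0)\<close>, suitably normalised,
  tends to 2 at the cusp.
\<close>

lemma theta2_0_nonzero:
  assumes \<tau>: "Im \<tau> > 0"
  shows "theta2 0 \<tau> \<noteq> 0"
proof
  assume zero: "theta2 0 \<tau> = 0"
  have zeros: "theta2 0 (2 ^ k * \<tau>) = 0" for k
  proof (induction k)
    case 0
    thus ?case using zero by auto
  next
    case (Suc k)
    have "Im (2 ^ k * \<tau>) > 0" using \<tau> by simp
    from theta2_0_square[OF this] Suc theta3_0_nonzero[of "2 ^ Suc k * \<tau>"] \<tau> show ?case
      by (simp add: mult.assoc)
  qed
  obtain C where C: "\<And>w \<tau>. Im \<tau> \<ge> 1 \<Longrightarrow> \<bar>Im w\<bar> \<le> 1 \<Longrightarrow>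
    norm (theta2 w \<tau> / exp (of_real pi * \<i> * \<tau> / 2) - 2 * cos w) \<le> C * exp (- 2 * pi * (Im \<tau> - 1))"
    using theta2_near_cusp by blast
  have "eventually (\<lambda>k. C * exp (- 2 * pi * (2 ^ k * Im \<tau> - 1)) < 2) sequentially"
    using cusp_decay(1)[OF \<tau>] by (rule order_tendstoD) auto
  with cusp_decay(2)[OF \<tau>] have "eventually (\<lambda>_. False) sequentially"
  proof eventually_elim
    case (elim k)
    show ?case using C[of "2 ^ k * \<tau>" 0] zeros[of k] elim by simp
  qed
  thus False by simp
qed

lemma theta1_has_derivative:
  assumes "Im \<tau> > 0"
  shows "((\<lambda>v. theta1 v \<tau>) has_field_derivative deriv (\<lambda>v. theta1 v \<tau>) z) (at z)"
proof -
  have "(\<lambda>v. v - complex_of_real pi / 2) holomorphic_on UNIV"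
    by (intro holomorphic_intros)
  from holomorphic_on_compose[OF this theta_holomorphic_arg(1)[OF assms]]
  have "(\<lambda>v. theta1 v \<tau>) holomorphic_on UNIV"
    by (simp add: theta1_def[abs_def] o_def)
  thus ?thesis using holomorphic_derivI[OF _ open_UNIV] by blast
qed

text \<open>
  The Landen formulas show that the quotient \<open>J\<close> of the two sides is invariant under \<open>\<tau> \<mapsto> 2 \<tau>\<close>. Along
  \<open>2\<^sup>k \<tau>\<close> the normalised functions \<open>\<theta>\<^sub>1\<close> tend to \<open>2 sin\<close> locally uniformly, hence so do their
  derivatives, and \<open>J\<close> tends to 1. Being constant along this sequence, it equals 1.
\<close>

theorem jacobi_derivative_formula:
  assumes \<tau>: "Im \<tau> > 0"
  shows "deriv (\<lambda>v. theta1 v \<tau>) 0 = theta2 0 \<tau> * theta3 0 \<tau> * theta4 0 \<tau>"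
proof -
  define d where "d t = deriv (\<lambda>v. theta1 v t) 0" for t
  define J where "J t = d t / (theta2 0 t * theta3 0 t * theta4 0 t)" for t
  have d: "((\<lambda>v. theta1 v t) has_field_derivative d t) (at 0)" if "Im t > 0" for t
    unfolding d_def by (rule theta1_has_derivative[OF that])
  have J2: "J (2 * t) = J t" if t: "Im t > 0" for t
  proof -
    have t2: "Im (2 * t) > 0" using t by simp
    have "(\<lambda>v. theta2 v t) field_differentiable at 0"
      using theta_holomorphic_arg(1)[OF t, of UNIV] by (simp add: holomorphic_on_def)
    then obtain e where e: "((\<lambda>v. theta2 v t) has_field_derivative e) (at 0)"
      by (auto simp: field_differentiable_def)
    have "((\<lambda>v. theta1 v t * theta2 v t) has_field_derivative (d t * theta2 0 t)) (at 0)"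
      using DERIV_mult[OF d[OF t] e] by simp
    moreover have "((\<lambda>v. theta1 (2 * v) (2 * t) * theta4 0 (2 * t)) has_field_derivative (2 * d (2 * t) * theta4 0 (2 * t))) (at 0)"
    proof -
      have "((\<lambda>v. theta1 v (2 * t)) \<circ> (\<lambda>v. 2 * v) has_field_derivative d (2 * t) * 2) (at 0)"
        by (rule DERIV_chain) (use d[OF t2] in \<open>auto intro!: derivative_eq_intros\<close>)
      thus ?thesis by (auto simp: o_def intro!: derivative_eq_intros)
    qed
    ultimately have eq: "2 * d (2 * t) * theta4 0 (2 * t) = d t * theta2 0 t"
      unfolding theta1_theta2_landen[OF t] using DERIV_unique by blast
    have nz: "theta2 0 t \<noteq> 0" "theta3 0 t \<noteq> 0" "theta4 0 t \<noteq> 0" 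
             "theta2 0 (2 * t) \<noteq> 0" "theta3 0 (2 * t) \<noteq> 0" "theta4 0 (2 * t) \<noteq> 0"
      using t t2 by (simp_all add: theta2_0_nonzero theta3_0_nonzero theta4_0_nonzero)
    have sq: "theta2 0 t * theta2 0 t = 2 * theta2 0 (2 * t) * theta3 0 (2 * t)"
      using theta2_0_square[OF t] by (simp add: power2_eq_square)
    have sq': "theta3 0 t * theta4 0 t = theta4 0 (2 * t) * theta4 0 (2 * t)"
      using theta3_theta4_landen[OF t, of 0] by simp
    have "J (2 * t) = (2 * d (2 * t) * theta4 0 (2 * t)) / ((2 * theta2 0 (2 * t) * theta3 0 (2 * t)) * (theta4 0 (2 * t) * theta4 0 (2 * t)))"
      using nz by (simp add: J_def)
    also have "\<dots> = J t"
      unfolding eq sq[symmetric] sq'[symmetric] using nz by (simp add: J_def)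
    finally show ?thesis .
  qed
  define T where "T k = 2 ^ k * \<tau>" for k
  have T: "Im (T k) > 0" for k using \<tau> by (simp add: T_def)
  have JT: "J (T k) = J \<tau>" for k
  proof (induction k)
    case (Suc k)
    thus ?case using J2[OF T[of k]] by (simp add: T_def mult.assoc)
  qed (simp add: T_def)
  define E where "E k = exp (of_real pi * \<i> * T k / 2)" for k
  obtain C where C: "\<And>w \<tau>. Im \<tau> \<ge> 1 \<Longrightarrow> \<bar>Im w\<bar> \<le> 1 \<Longrightarrow>
    norm (theta2 w \<tau> / exp (of_real pi * \<i> * \<tau> / 2) - 2 * cos w) \<le> C * exp (- 2 * pi * (Im \<tau> - 1))"
    using theta2_near_cusp by blast
  obtain C' where C': "\<And>x \<tau>. Im \<tau> \<ge> 1 \<Longrightarrow> norm (theta3 (of_real x) \<tau> - 1) \<le> C' * exp (- 2 * pi * (Im \<tau> - 1))"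
    using theta3_near_cusp by blast
  have large: "eventually (\<lambda>k. Im (T k) \<ge> 1) sequentially"
    using cusp_decay(2)[OF \<tau>] by (simp add: T_def)
  have decay: "(\<lambda>k. c * exp (- 2 * pi * (Im (T k) - 1))) \<longlonglongrightarrow> 0" for c
    using cusp_decay(1)[OF \<tau>, of c] by (simp add: T_def)
  have lim3: "(\<lambda>k. theta3 (of_real x) (T k)) \<longlonglongrightarrow> 1" for x
    by (rule Lim_transform2[OF tendsto_const Lim_null_comparison[OF _ decay[of C']]])
       (use large in eventually_elim, use C' in \<open>simp add: norm_minus_commute\<close>)
  have lim2: "(\<lambda>k. theta2 0 (T k) / E k) \<longlonglongrightarrow> 2"
    by (rule Lim_transform2[OF tendsto_const Lim_null_comparison[OF _ decay[of C]]])
       (use large in eventually_elim, use C[of _ 0] in \<open>simp add: norm_minus_commute E_def\<close>)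
  have lim1: "(\<lambda>k. d (T k) / E k) \<longlonglongrightarrow> 2"
  proof -
    have ul: "uniform_limit (cball 0 1) (\<lambda>k v. theta1 v (T k) / E k) (\<lambda>v. 2 * sin v) sequentially"
    proof (rule uniform_limitI)
      fix \<epsilon> :: real assume "\<epsilon> > 0"
      hence "eventually (\<lambda>k. C * exp (- 2 * pi * (Im (T k) - 1)) < \<epsilon>) sequentially"
        using decay[of C] by (intro order_tendstoD)
      with large show "\<forall>\<^sub>F k in sequentially. \<forall>v\<in>cball 0 1. dist (theta1 v (T k) / E k) (2 * sin v) < \<epsilon>"
      proof eventually_elim
        case (elim k)
        show ?case
        proof
          fix v :: complex assume v: "v \<in> cball 0 1"
          hence "\<bar>Im (v - of_real pi / 2)\<bar> \<le> 1"
            using abs_Im_le_cmod[of v] by simp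
          hence "norm (theta1 v (T k) / E k - 2 * cos (v - of_real pi / 2)) \<le> C * exp (- 2 * pi * (Im (T k) - 1))"
            unfolding theta1_def E_def by (intro C elim)
          moreover have "cos (v - of_real pi / 2) = sin v"
            using sin_cos_eq[of v] cos_minus[of "of_real pi / 2 - v"] by simp
          ultimately show "dist (theta1 v (T k) / E k) (2 * sin v) < \<epsilon>"
            using elim by (simp add: dist_norm)
        qed
      qed
    qed
    have der: "((\<lambda>v. theta1 v (T k) / E k) has_field_derivative deriv (\<lambda>v. theta1 v (T k)) w / E k) (at w)" for k w
      by (intro DERIV_cdivide theta1_has_derivative T)
    have "\<forall>\<^sub>F k in sequentially. continuous_on (cball 0 1) (\<lambda>v. theta1 v (T k) / E k) \<and>
        (\<forall>w\<in>ball 0 1. ((\<lambda>v. theta1 v (T k) / E k) has_field_derivative deriv (\<lambda>v. theta1 v (T k)) w / E k) (at w))"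
      using der by (intro always_eventually allI conjI ballI) (meson DERIV_continuous_on has_field_derivative_at_within)+
    then obtain g' where g': "\<And>w. w \<in> ball 0 1 \<Longrightarrow> ((\<lambda>v. 2 * sin v) has_field_derivative g' w) (at w) \<and>
        (\<lambda>k. deriv (\<lambda>v. theta1 v (T k)) w / E k) \<longlonglongrightarrow> g' w"
      using has_complex_derivative_uniform_limit[OF _ ul, of "\<lambda>k w. deriv (\<lambda>v. theta1 v (T k)) w / E k"] by auto
    have "((\<lambda>v::complex. 2 * sin v) has_field_derivative 2) (at 0)"
      by (auto intro!: derivative_eq_intros)
    hence "g' 0 = 2" using g'[of 0] DERIV_unique by (metis centre_in_ball zero_less_one)
    thus ?thesis using g'[of 0] by (simp add: d_def)
  qed
  have "(\<lambda>k. (d (T k) / E k) / ((theta2 0 (T k) / E k) * theta3 (of_real 0) (T k) * theta3 (of_real (pi / 2)) (T k))) \<longlonglongrightarrow> 2 / (2 * 1 * 1)"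
    by (intro tendsto_intros lim1 lim2 lim3) auto
  moreover have "(d (T k) / E k) / ((theta2 0 (T k) / E k) * theta3 (of_real 0) (T k) * theta3 (of_real (pi / 2)) (T k)) = J (T k)" for k
    by (simp add: J_def theta4_def E_def)
  ultimately have "(\<lambda>k. J (T k)) \<longlonglongrightarrow> 1" by simp
  hence "J \<tau> = 1" unfolding JT using LIMSEQ_const_iff by blast
  thus ?thesis
    using theta2_0_nonzero[OF \<tau>] theta3_0_nonzero[OF \<tau>] theta4_0_nonzero[OF \<tau>] by (simp add: J_def d_def)
qed

section \<open>The quotient of theta functions\<close>

definition theta_quot :: "complex \<Rightarrow> complex \<Rightarrow> complex" where
  "theta_quot \<tau> u = theta2 u \<tau> / theta3 u \<tau>"

text \<open>
  Differentiating the addition formula for \<open>\<theta>\<^sub>1(x + u) \<theta>\<^sub>1(x - u)\<close> in \<open>x\<close> at \<open>x = u\<close> expresses the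
  Wronskian of \<open>\<theta>\<^sub>2\<close> and \<open>\<theta>\<^sub>3\<close> by \<open>\<theta>\<^sub>1(2u) \<theta>\<^sub>1'(0)\<close>, which the duplication formula and Jacobi's formula
  reduce, up to sign, to \<open>\<theta>\<^sub>1(u) \<theta>\<^sub>4(u) \<theta>\<^sub>4(0)\<^sup>2\<close>. Its square is a polynomial in \<open>\<theta>\<^sub>2\<^sup>2\<close> and \<open>\<theta>\<^sub>3\<^sup>2\<close>.
\<close>

lemma theta_quot_ode:
  assumes \<tau>: "Im \<tau> > 0" and nz: "theta2 u \<tau> \<noteq> 0" "theta3 u \<tau> \<noteq> 0"
  obtains D where "(theta_quot \<tau> has_field_derivative D) (at u)"
    "D\<^sup>2 = (omega1 \<tau>)\<^sup>2 * (((sqrt_k \<tau>)\<^sup>2 - (theta_quot \<tau> u)\<^sup>2) * (1 - (sqrt_k \<tau>)\<^sup>2 * (theta_quot \<tau> u)\<^sup>2))"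
proof -
  define a b where "a = theta2 u \<tau>" and "b = theta3 u \<tau>"
  have nz: "a \<noteq> 0" "b \<noteq> 0" using nz by (auto simp: a_def b_def)
  define A B where "A = theta2 0 \<tau>" and "B = theta3 0 \<tau>"
  have AB: "A \<noteq> 0" "B \<noteq> 0" "theta4 0 \<tau> \<noteq> 0"
    using \<tau> by (simp_all add: A_def B_def theta2_0_nonzero theta3_0_nonzero theta4_0_nonzero)
  obtain a' where a': "((\<lambda>v. theta2 v \<tau>) has_field_derivative a') (at u)"
    using holomorphic_derivI[OF theta_holomorphic_arg(1)[OF \<tau>, of UNIV] open_UNIV] by blast
  obtain b' where b': "((\<lambda>v. theta3 v \<tau>) has_field_derivative b') (at u)"
    using holomorphic_derivI[OF theta_holomorphic_arg(2)[OF \<tau>, of UNIV] open_UNIV] by blast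
  have der: "(theta_quot \<tau> has_field_derivative (a' * b - a * b') / b\<^sup>2) (at u)"
    unfolding theta_quot_def[abs_def]
    using DERIV_divide[OF a' b'] nz by (simp add: a_def b_def power2_eq_square)
  have "((\<lambda>x. (theta3 x \<tau>)\<^sup>2 * a\<^sup>2 - (theta2 x \<tau>)\<^sup>2 * b\<^sup>2) has_field_derivative (- 2 * a * b * (a' * b - a * b'))) (at u)"
    by (rule derivative_eq_intros a' b' refl)+ (simp add: a_def b_def power2_eq_square algebra_simps)
  moreover have "((\<lambda>x. theta1 (x + u) \<tau> * theta1 (x - u) \<tau> * (theta4 0 \<tau>)\<^sup>2) has_field_derivative
      (theta1 (2 * u) \<tau> * deriv (\<lambda>v. theta1 v \<tau>) 0 * (theta4 0 \<tau>)\<^sup>2)) (at u)"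
  proof -
    have 1: "((\<lambda>v. theta1 v \<tau>) \<circ> (\<lambda>x. x + u) has_field_derivative deriv (\<lambda>v. theta1 v \<tau>) (u + u) * 1) (at u)"
      by (rule DERIV_chain) (auto intro!: derivative_eq_intros theta1_has_derivative[OF \<tau>])
    have 2: "((\<lambda>v. theta1 v \<tau>) \<circ> (\<lambda>x. x - u) has_field_derivative deriv (\<lambda>v. theta1 v \<tau>) (u - u) * 1) (at u)"
      by (rule DERIV_chain) (auto intro!: derivative_eq_intros theta1_has_derivative[OF \<tau>])
    show ?thesis
      using DERIV_cmult_right[OF DERIV_mult[OF 1 2], of "(theta4 0 \<tau>)\<^sup>2"] by (simp add: o_def mult_2 mult.commute)
  qed
  ultimately have "- 2 * a * b * (a' * b - a * b') = theta1 (2 * u) \<tau> * deriv (\<lambda>v. theta1 v \<tau>) 0 * (theta4 0 \<tau>)\<^sup>2"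
    unfolding a_def b_def theta1_addition[OF \<tau>] using DERIV_unique by blast
  also have "\<dots> = (theta1 (2 * u) \<tau> * (theta2 0 \<tau> * theta3 0 \<tau> * theta4 0 \<tau>)) * (theta4 0 \<tau>)\<^sup>2"
    unfolding jacobi_derivative_formula[OF \<tau>] ..
  also have "\<dots> = - 2 * a * b * (- theta1 u \<tau> * theta4 u \<tau> * (theta4 0 \<tau>)\<^sup>2)"
    unfolding theta1_duplication[OF \<tau>] by (simp add: a_def b_def)
  finally have W: "a' * b - a * b' = - theta1 u \<tau> * theta4 u \<tau> * (theta4 0 \<tau>)\<^sup>2"
    using mult_left_cancel[of "- 2 * a * b"] nz by (metis mult_eq_0_iff neg_equal_0_iff_equal zero_neq_numeral)
  have W2: "(a' * b - a * b')\<^sup>2 = (b\<^sup>2 * A\<^sup>2 - a\<^sup>2 * B\<^sup>2) * (b\<^sup>2 * B\<^sup>2 - a\<^sup>2 * A\<^sup>2)"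
  proof -
    have "b\<^sup>2 * A\<^sup>2 - a\<^sup>2 * B\<^sup>2 = theta1 u \<tau> * theta1 u \<tau> * (theta4 0 \<tau>)\<^sup>2"
         "b\<^sup>2 * B\<^sup>2 - a\<^sup>2 * A\<^sup>2 = theta4 u \<tau> * theta4 u \<tau> * (theta4 0 \<tau>)\<^sup>2"
      using theta1_addition[OF \<tau>, of u 0] theta4_addition[OF \<tau>, of u 0]
      by (simp_all add: a_def b_def A_def B_def)
    thus ?thesis unfolding W by (simp add: power2_eq_square)
  qed
  have "((a' * b - a * b') / b\<^sup>2)\<^sup>2 = (B\<^sup>2)\<^sup>2 * (((A / B)\<^sup>2 - (a / b)\<^sup>2) * (1 - (A / B)\<^sup>2 * (a / b)\<^sup>2))"
  proof -
    have "b\<^sup>2 * A\<^sup>2 - a\<^sup>2 * B\<^sup>2 = b\<^sup>2 * B\<^sup>2 * ((A / B)\<^sup>2 - (a / b)\<^sup>2)"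
         "b\<^sup>2 * B\<^sup>2 - a\<^sup>2 * A\<^sup>2 = b\<^sup>2 * B\<^sup>2 * (1 - (A / B)\<^sup>2 * (a / b)\<^sup>2)"
      using nz AB by (simp_all add: power_divide right_diff_distrib)
    thus ?thesis unfolding power_divide[of "a' * b - a * b'"] W2 using nz by (simp add: power2_eq_square)
  qed
  thus thesis
    using that[OF der] by (simp add: a_def b_def A_def B_def omega1_def sqrt_k_def theta_quot_def)
qed

section \<open>Numerator and denominator of the product\<close>

definition esym :: "nat \<Rightarrow> (nat \<Rightarrow> 'a :: comm_ring_1) \<Rightarrow> nat \<Rightarrow> 'a" where
  "esym n b j = (\<Sum>I | I \<subseteq> {1..n div 2} \<and> card I = j. \<Prod>i\<in>I. b i)"

text \<open>
  Numerator and denominator are taken over an arbitrary ring: they are used for each \<open>\<tau>\<close> over the complex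
  numbers, and once over the field of meromorphic functions.
\<close>

definition cb_num :: "nat \<Rightarrow> (nat \<Rightarrow> 'a :: comm_ring_1) \<Rightarrow> 'a poly" where
  "cb_num n b = Polynomial.monom 1 (n mod 2) * (\<Prod>i=1..n div 2. [:- b i, 0, 1:])"

definition cb_den :: "nat \<Rightarrow> (nat \<Rightarrow> 'a :: comm_ring_1) \<Rightarrow> 'a poly" where
  "cb_den n b = (\<Prod>i=1..n div 2. [:1, 0, - b i:])"

lemma prod_diff_expand:
  fixes x y :: "'a :: comm_ring_1"
  shows "(\<Prod>i=1..m. x - b i * y) =
     (\<Sum>j\<le>m. (-1) ^ j * (\<Sum>I | I \<subseteq> {1..m} \<and> card I = j. \<Prod>i\<in>I. b i) * y ^ j * x ^ (m - j))"
proof -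
  have "(\<Prod>i=1..m. x - b i * y) = (\<Prod>i=1..m. - (b i * y) + x)" by simp
  also have "\<dots> = (\<Sum>I\<in>Pow {1..m}. (\<Prod>i\<in>I. - (b i * y)) * (\<Prod>i\<in>{1..m} - I. x))"
    by (rule prod_add) simp
  also have "\<dots> = (\<Sum>I\<in>Pow {1..m}. (-1) ^ card I * (\<Prod>i\<in>I. b i) * y ^ card I * x ^ (m - card I))"
  proof (rule sum.cong[OF refl])
    fix I assume I: "I \<in> Pow {1..m}"
    hence "finite I" using finite_subset by auto
    hence "card ({1..m} - I) = m - card I" using I by (simp add: card_Diff_subset)
    moreover have "(\<Prod>i\<in>I. - (b i * y)) = (-1) ^ card I * (\<Prod>i\<in>I. b i) * y ^ card I"
      by (simp add: prod_uminus prod.distrib)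
    ultimately show "(\<Prod>i\<in>I. - (b i * y)) * (\<Prod>i\<in>{1..m} - I. x) = (-1) ^ card I * (\<Prod>i\<in>I. b i) * y ^ card I * x ^ (m - card I)"
      by simp
  qed
  also have "\<dots> = (\<Sum>j\<le>m. \<Sum>I | I \<in> Pow {1..m} \<and> card I = j. (-1) ^ card I * (\<Prod>i\<in>I. b i) * y ^ card I * x ^ (m - card I))"
    by (rule sum.group[symmetric]) (auto dest: card_mono[rotated])
  also have "\<dots> = (\<Sum>j\<le>m. (-1) ^ j * (\<Sum>I | I \<subseteq> {1..m} \<and> card I = j. \<Prod>i\<in>I. b i) * y ^ j * x ^ (m - j))"
    by (intro sum.cong refl) (simp add: sum_distrib_left sum_distrib_right)
  finally show ?thesis .
qed

lemma esym_0: "esym n b 0 = 1"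
proof -
  have "{I. I \<subseteq> {1..n div 2} \<and> card I = 0} = {{}}"
    using finite_subset by (auto simp: card_eq_0_iff)
  thus ?thesis by (simp add: esym_def)
qed

lemma monom_2: "Polynomial.monom (1 :: 'a :: comm_ring_1) 2 = [:0, 0, 1:]"
  by (simp add: numeral_2_eq_2 monom_Suc monom_0)

lemma cb_num_expand:
  "cb_num n b = Polynomial.monom 1 (n mod 2) * (Polynomial.monom 1 (2 * (n div 2)) +
     (\<Sum>j=1..n div 2. Polynomial.monom ((-1) ^ j * esym n b j) (2 * (n div 2) - 2 * j)))"
proof -
  define m where "m = n div 2"
  have "(\<Prod>i=1..m. [:- b i, 0, 1:]) = (\<Prod>i=1..m. Polynomial.monom 1 2 - [:b i:] * 1)"
    by (simp add: monom_2)
  also have "\<dots> = (\<Sum>j\<le>m. Polynomial.monom ((-1) ^ j * esym n b j) (2 * m - 2 * j))"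
    unfolding prod_diff_expand
  proof (rule sum.cong[OF refl])
    fix j
    have "(\<Sum>I | I \<subseteq> {1..m} \<and> card I = j. \<Prod>i\<in>I. [:b i:]) = [:esym n b j:]"
      by (simp add: esym_def m_def prod_to_poly sum_to_poly)
    moreover have "(-1 :: 'a poly) ^ j = [:(-1) ^ j:]"
      by (induction j) (auto simp: one_pCons)
    moreover have "Polynomial.monom (1 :: 'a) 2 ^ (m - j) = Polynomial.monom 1 (2 * m - 2 * j)"
      by (simp add: monom_power diff_mult_distrib mult.commute)
    ultimately show "(-1) ^ j * (\<Sum>I | I \<subseteq> {1..m} \<and> card I = j. \<Prod>i\<in>I. [:b i:]) * 1 ^ j * Polynomial.monom 1 2 ^ (m - j) =
        Polynomial.monom ((-1) ^ j * esym n b j) (2 * m - 2 * j)"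
      by (simp add: smult_monom)
  qed
  also have "\<dots> = Polynomial.monom 1 (2 * m) + (\<Sum>j=1..m. Polynomial.monom ((-1) ^ j * esym n b j) (2 * m - 2 * j))"
    by (simp add: atMost_atLeast0 sum.atLeast_Suc_atMost esym_0)
  finally show ?thesis by (simp add: cb_num_def m_def)
qed

lemma cb_den_expand:
  "cb_den n b = 1 + (\<Sum>j=1..n div 2. Polynomial.monom ((-1) ^ j * esym n b j) (2 * j))"
proof -
  define m where "m = n div 2"
  have "(\<Prod>i=1..m. [:1, 0, - b i:]) = (\<Prod>i=1..m. 1 - [:b i:] * Polynomial.monom 1 2)"
    by (simp add: monom_2 one_pCons)
  also have "\<dots> = (\<Sum>j\<le>m. Polynomial.monom ((-1) ^ j * esym n b j) (2 * j))"
    unfolding prod_diff_expand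
  proof (rule sum.cong[OF refl])
    fix j
    have "(\<Sum>I | I \<subseteq> {1..m} \<and> card I = j. \<Prod>i\<in>I. [:b i:]) = [:esym n b j:]"
      by (simp add: esym_def m_def prod_to_poly sum_to_poly)
    moreover have "(-1 :: 'a poly) ^ j = [:(-1) ^ j:]"
      by (induction j) (auto simp: one_pCons)
    moreover have "Polynomial.monom (1 :: 'a) 2 ^ j = Polynomial.monom 1 (2 * j)"
      by (simp add: monom_power mult.commute)
    ultimately show "(-1) ^ j * (\<Sum>I | I \<subseteq> {1..m} \<and> card I = j. \<Prod>i\<in>I. [:b i:]) * Polynomial.monom 1 2 ^ j * 1 ^ (m - j) =
        Polynomial.monom ((-1) ^ j * esym n b j) (2 * j)"
      by (simp add: smult_monom)
  qed
  also have "\<dots> = 1 + (\<Sum>j=1..m. Polynomial.monom ((-1) ^ j * esym n b j) (2 * j))"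
    by (simp add: atMost_atLeast0 sum.atLeast_Suc_atMost esym_0 monom_0 one_pCons)
  finally show ?thesis by (simp add: cb_den_def m_def)
qed

lemma prod_pair_ends:
  fixes g :: "nat \<Rightarrow> 'a :: comm_monoid_mult"
  shows "(\<Prod>j<n. g j) = (if odd n then g (n div 2) else 1) * (\<Prod>i=1..n div 2. g (i - 1) * g (n - i))"
proof -
  define m where "m = n div 2"
  have "{..<n} = ({..<m} \<union> {n - m..<n}) \<union> (if odd n then {m} else {})"
    by (auto simp: m_def; presburger)
  also have "prod g \<dots> = prod g ({..<m} \<union> {n - m..<n}) * prod g (if odd n then {m} else {})"
    by (rule prod.union_disjoint) (auto simp: m_def elim!: oddE)
  also have "prod g ({..<m} \<union> {n - m..<n}) = prod g {..<m} * prod g {n - m..<n}"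
    by (rule prod.union_disjoint) (auto simp: m_def)
  also have "prod g {..<m} = (\<Prod>i=1..m. g (i - 1))"
    by (rule prod.reindex_bij_witness[of _ "\<lambda>i. i - 1" Suc]) auto
  also have "prod g {n - m..<n} = (\<Prod>i=1..m. g (n - i))"
    by (rule prod.reindex_bij_witness[of _ "\<lambda>i. n - i" "\<lambda>i. n - i"]) (auto simp: m_def)
  finally show ?thesis by (simp add: m_def prod.distrib mult.commute)
qed

text \<open>
  With \<open>z = Z\<^sub>\<tau>(u)\<close> and \<open>b = Z\<^sub>\<tau>(v)\<^sup>2\<close>, numerator and denominator of the Blaschke factor
  \<open>(z\<^sup>2 - b) / (1 - b z\<^sup>2)\<close> become, up to sign, the left-hand sides of the two addition formulas when they are
  multiplied by \<open>(\<theta>\<^sub>3(u) \<theta>\<^sub>3(v))\<^sup>2\<close>. A shift by \<open>\<pi>/2\<close> turns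
  \<open>\<theta>\<^sub>1\<close> and \<open>\<theta>\<^sub>4\<close> into \<open>\<theta>\<^sub>2\<close> and \<open>\<theta>\<^sub>3\<close>.
\<close>

lemma theta_quot_blaschke_factor:
  assumes \<tau>: "Im \<tau> > 0" and "theta3 u \<tau> \<noteq> 0" "theta3 v \<tau> \<noteq> 0" and a: "a = of_real pi / 2 - v"
  shows "((theta_quot \<tau> u)\<^sup>2 - (theta2 v \<tau>)\<^sup>2 / (theta3 v \<tau>)\<^sup>2) * (theta3 u \<tau> * theta3 v \<tau>)\<^sup>2 =
           theta2 (u - a) \<tau> * theta2 (u + a) \<tau> * (theta4 0 \<tau>)\<^sup>2"
    and "(1 - (theta2 v \<tau>)\<^sup>2 / (theta3 v \<tau>)\<^sup>2 * (theta_quot \<tau> u)\<^sup>2) * (theta3 u \<tau> * theta3 v \<tau>)\<^sup>2 =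
           theta3 (u - a) \<tau> * theta3 (u + a) \<tau> * (theta4 0 \<tau>)\<^sup>2"
proof -
  have 1: "theta1 (u + v) \<tau> = theta2 (u - a) \<tau>" "theta4 (u + v) \<tau> = theta3 (u - a) \<tau>"
    by (simp_all add: theta1_def theta4_alt a algebra_simps)
  have u: "u - v - of_real pi / 2 = (u + a) - of_real pi"
    by (simp add: a complex_eq_iff)
  have 2: "theta1 (u - v) \<tau> = - theta2 (u + a) \<tau>" "theta4 (u - v) \<tau> = theta3 (u + a) \<tau>"
    by (simp_all only: theta1_def theta4_alt u theta2_minus_pi theta3_minus_pi)
  show "((theta_quot \<tau> u)\<^sup>2 - (theta2 v \<tau>)\<^sup>2 / (theta3 v \<tau>)\<^sup>2) * (theta3 u \<tau> * theta3 v \<tau>)\<^sup>2 =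
           theta2 (u - a) \<tau> * theta2 (u + a) \<tau> * (theta4 0 \<tau>)\<^sup>2"
    using theta1_addition[OF \<tau>, of u v] assms(2,3) unfolding 1 2 theta_quot_def
    by (simp add: power_divide power_mult_distrib divide_simps) (simp add: algebra_simps)
  show "(1 - (theta2 v \<tau>)\<^sup>2 / (theta3 v \<tau>)\<^sup>2 * (theta_quot \<tau> u)\<^sup>2) * (theta3 u \<tau> * theta3 v \<tau>)\<^sup>2 =
           theta3 (u - a) \<tau> * theta3 (u + a) \<tau> * (theta4 0 \<tau>)\<^sup>2"
    using theta4_addition[OF \<tau>, of u v] assms(2,3) unfolding 1 2 theta_quot_def
    by (simp add: power_divide power_mult_distrib divide_simps) (simp add: algebra_simps)
qed

text \<open>
  The \<open>i\<close>-th Blaschke factor contributes the quotients with the shifts \<open>\<plusminus>(n - 2 i + 1) \<pi> / 2n\<close>; for odd \<open>n\<close>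
  the factor \<open>z\<close> contributes the shift 0. Together these are all centred shifts. The identity is stated for
  numerator and denominator with a common factor \<open>w \<noteq> 0\<close>, so that it also covers the zeros of the denominator.
\<close>

lemma cb_param:
  assumes \<tau>: "Im \<tau> > 0" and n: "n \<ge> 1" and u: "theta3 u \<tau> \<noteq> 0"
  defines "b \<equiv> (\<lambda>i. cb_b n i \<tau>)"
  obtains w where "w \<noteq> 0"
    "poly (cb_num n b) (theta_quot \<tau> u) = w * theta2 (of_nat n * u) (of_nat n * \<tau>)"
    "poly (cb_den n b) (theta_quot \<tau> u) = w * theta3 (of_nat n * u) (of_nat n * \<tau>)"
proof -
  define m where "m = n div 2"
  define z where "z = theta_quot \<tau> u"
  define v where "v i = (2 * real i - 1) * pi / (2 * real n)" for i
  define a where "a i = pi / 2 - v i" for i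
  have v3: "theta3 (of_real (v i)) \<tau> \<noteq> 0" for i by (rule theta3_nonzero_real[OF \<tau>])
  have b: "b i = (theta2 (of_real (v i)) \<tau>)\<^sup>2 / (theta3 (of_real (v i)) \<tau>)\<^sup>2" for i
    by (simp add: b_def cb_b_def v_def)
  have shifts: "centred_shift n (i - 1) = - a i" "centred_shift n (n - i) = a i" if "i \<in> {1..m}" for i
    using that n by (auto simp: centred_shift_def a_def v_def of_nat_diff m_def field_simps)
  have mid: "centred_shift n m = 0" if "odd n"
    using that by (auto simp: centred_shift_def m_def elim!: oddE)
  obtain c where c:
    "\<And>u. (\<Prod>j<n. theta3 (u + of_real (centred_shift n j)) \<tau>) = c * theta3 (of_nat n * u) (of_nat n * \<tau>)"
    "\<And>u. (\<Prod>j<n. theta2 (u + of_real (centred_shift n j)) \<tau>) = c * theta2 (of_nat n * u) (of_nat n * \<tau>)"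
    using theta_multiplication[OF \<tau> n] by blast
  have c0: "c \<noteq> 0"
  proof
    assume "c = 0"
    hence "(\<Prod>j<n. theta3 (0 + of_real (centred_shift n j)) \<tau>) = 0" using c(1)[of 0] by simp
    thus False using theta3_nonzero_real[OF \<tau>] by auto
  qed
  define W where "W = theta3 u \<tau> ^ (n mod 2) * (\<Prod>i=1..m. (theta3 u \<tau> * theta3 (of_real (v i)) \<tau>)\<^sup>2)"
  have W0: "W \<noteq> 0" using u v3 by (auto simp: W_def)
  define h where "h = (theta4 0 \<tau>)\<^sup>2 ^ m"
  have h0: "h \<noteq> 0" using theta4_0_nonzero[OF \<tau>] by (simp add: h_def)
  have odd: "(if odd n then x else 1) = x ^ (n mod 2)" for x :: complex
    by (auto simp: odd_iff_mod_2_eq_one even_iff_mod_2_eq_zero)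
  have gen: "(\<Prod>i=1..m. f i * x) = (\<Prod>i=1..m. f i) * x ^ m" for f :: "nat \<Rightarrow> complex" and x
    by (simp add: prod.distrib)
  have pr: "(\<Prod>i=1..m. f (u - of_real (a i)) * f (u + of_real (a i))) =
      (\<Prod>i=1..m. f (u + of_real (centred_shift n (i - 1))) * f (u + of_real (centred_shift n (n - i))))" for f :: "complex \<Rightarrow> complex"
    by (rule prod.cong[OF refl]) (simp only: shifts of_real_minus add_uminus_conv_diff)
  have num: "poly (cb_num n b) z * W = (\<Prod>j<n. theta2 (u + of_real (centred_shift n j)) \<tau>) * h"
  proof -
    have "poly (cb_num n b) z * W = (z * theta3 u \<tau>) ^ (n mod 2) *
        (\<Prod>i=1..m. (z\<^sup>2 - b i) * (theta3 u \<tau> * theta3 (of_real (v i)) \<tau>)\<^sup>2)"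
      by (simp add: cb_num_def W_def m_def poly_prod poly_monom prod.distrib power_mult_distrib power2_eq_square)
    also have "\<dots> = theta2 u \<tau> ^ (n mod 2) * (\<Prod>i=1..m. theta2 (u - of_real (a i)) \<tau> * theta2 (u + of_real (a i)) \<tau> * (theta4 0 \<tau>)\<^sup>2)"
      unfolding z_def b
      by (intro arg_cong2[where f = "(*)"] prod.cong theta_quot_blaschke_factor(1)[OF \<tau> u v3] refl)
         (use u in \<open>auto simp: theta_quot_def a_def\<close>)
    also have "\<dots> = theta2 u \<tau> ^ (n mod 2) * (\<Prod>i=1..m. theta2 (u + of_real (centred_shift n (i - 1))) \<tau> * theta2 (u + of_real (centred_shift n (n - i))) \<tau>) * h"
      unfolding gen pr[of "\<lambda>x. theta2 x \<tau>"] h_def by (simp only: mult.assoc)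
    also have "theta2 u \<tau> ^ (n mod 2) = (if odd n then theta2 (u + of_real (centred_shift n m)) \<tau> else 1)"
      unfolding odd[symmetric] using mid by auto
    finally show ?thesis unfolding prod_pair_ends[of _ n] m_def .
  qed
  have den: "poly (cb_den n b) z * W = (\<Prod>j<n. theta3 (u + of_real (centred_shift n j)) \<tau>) * h"
  proof -
    have "poly (cb_den n b) z * W = theta3 u \<tau> ^ (n mod 2) *
        (\<Prod>i=1..m. (1 - b i * z\<^sup>2) * (theta3 u \<tau> * theta3 (of_real (v i)) \<tau>)\<^sup>2)"
      by (simp add: cb_den_def W_def m_def poly_prod prod.distrib power_mult_distrib power2_eq_square mult_ac)
    also have "\<dots> = theta3 u \<tau> ^ (n mod 2) * (\<Prod>i=1..m. theta3 (u - of_real (a i)) \<tau> * theta3 (u + of_real (a i)) \<tau> * (theta4 0 \<tau>)\<^sup>2)"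
      unfolding z_def b
      by (intro arg_cong2[where f = "(*)"] prod.cong theta_quot_blaschke_factor(2)[OF \<tau> u v3] refl)
         (auto simp: a_def)
    also have "\<dots> = theta3 u \<tau> ^ (n mod 2) * (\<Prod>i=1..m. theta3 (u + of_real (centred_shift n (i - 1))) \<tau> * theta3 (u + of_real (centred_shift n (n - i))) \<tau>) * h"
      unfolding gen pr[of "\<lambda>x. theta3 x \<tau>"] h_def by (simp only: mult.assoc)
    also have "theta3 u \<tau> ^ (n mod 2) = (if odd n then theta3 (u + of_real (centred_shift n m)) \<tau> else 1)"
      unfolding odd[symmetric] using mid by auto
    finally show ?thesis unfolding prod_pair_ends[of _ n] m_def .
  qed
  show thesis
    by (rule that[of "c * h / W"]) (use num den W0 h0 c0 in \<open>auto simp: c z_def field_simps\<close>)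
qed

section \<open>The imaginary axis\<close>

lemma cnj_theta3: "cnj (theta3 v \<tau>) = theta3 (cnj v) (- cnj \<tau>)"
proof -
  have "cnj (theta3 v \<tau>) = (\<Sum>\<^sub>\<infinity>m. cnj (theta_term 0 v \<tau> m))"
    unfolding theta3_eq_infsum by (rule infsum_cnj[symmetric])
  also have "\<dots> = theta3 (cnj v) (- cnj \<tau>)"
    unfolding theta3_eq_infsum
    by (rule infsum_reindex_bij_witness[of _ uminus uminus])
       (auto simp: theta_term_0 exp_cnj)
  finally show ?thesis .
qed

lemma Im_axis: "t > 0 \<Longrightarrow> Im (\<i> * of_real t) > 0"
  by simp

lemma continuous_on_theta_real:
  assumes "Im \<tau> > 0"
  shows "continuous_on A (\<lambda>x::real. theta2 (of_real x) \<tau>)" "continuous_on A (\<lambda>x::real. theta3 (of_real x) \<tau>)"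
proof -
  have o: "continuous_on A (of_real :: real \<Rightarrow> complex)" by (intro continuous_intros)
  have "continuous_on UNIV (\<lambda>v. theta2 v \<tau>)" "continuous_on UNIV (\<lambda>v. theta3 v \<tau>)"
    by (intro holomorphic_on_imp_continuous_on theta_holomorphic_arg assms)+
  from this[THEN continuous_on_compose2, OF o]
  show "continuous_on A (\<lambda>x::real. theta2 (of_real x) \<tau>)" "continuous_on A (\<lambda>x::real. theta3 (of_real x) \<tau>)"
    by auto
qed

lemma theta3_axis_real: "Im (theta3 (of_real x) (\<i> * of_real t)) = 0"
  using arg_cong[OF cnj_theta3[of "of_real x" "\<i> * of_real t"], of Im] by simp

text \<open>
  On the imaginary axis \<open>\<theta>\<^sub>3\<close> is real and without zeros on the real line, and all terms of
  \<open>\<theta>\<^sub>3(0)\<close> are positive.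
\<close>

lemma theta3_axis_pos:
  assumes t: "t > 0"
  shows "Re (theta3 (of_real x) (\<i> * of_real t)) > 0"
proof (rule ccontr)
  define f where "f y = Re (theta3 (of_real y) (\<i> * of_real t))" for y :: real
  have nz: "f y \<noteq> 0" for y
    using theta3_nonzero_real[OF Im_axis[OF t], of y] theta3_axis_real[of y t] by (auto simp: f_def complex_eq_iff)
  have cont: "continuous_on A f" for A
    unfolding f_def by (intro continuous_intros continuous_on_theta_real Im_axis t)
  have "f 0 > 0"
  proof -
    have s: "theta_term 0 0 (\<i> * of_real t) summable_on UNIV" 
      by (rule theta_term_summable[OF Im_axis[OF t]])
    have "f 0 = infsum (\<lambda>m. Re (theta_term 0 0 (\<i> * of_real t) m)) UNIV"
      unfolding f_def theta3_eq_infsum using infsum_Re[OF s] by simp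
    also have "\<dots> \<ge> infsum (\<lambda>m. Re (theta_term 0 0 (\<i> * of_real t) m)) {0}"
      using summable_on_Re[OF s] by (intro infsum_mono_neutral) (auto simp: theta_term_0 Re_exp)
    finally show ?thesis by (simp add: theta_term_0)
  qed
  assume "\<not> Re (theta3 (of_real x) (\<i> * of_real t)) > 0"
  hence "f x \<le> 0" by (simp add: f_def)
  have "connected (f ` UNIV)"
    by (intro connected_continuous_image cont) auto
  hence "0 \<in> f ` UNIV"
    using \<open>f 0 > 0\<close> \<open>f x \<le> 0\<close> unfolding connected_iff_interval by (meson less_imp_le rangeI)
  thus False using nz by auto
qed

text \<open>
  Both \<open>\<theta>\<^sub>3 + \<theta>\<^sub>2\<close> and \<open>\<theta>\<^sub>3 - \<theta>\<^sub>2\<close> are values of \<open>\<theta>\<^sub>3\<close> for the period \<open>\<tau>/4\<close> at real points, hence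
  positive.
\<close>

lemma theta_quot_axis:
  assumes t: "t > 0"
  obtains r where "\<bar>r\<bar> < 1" "theta_quot (\<i> * of_real t) (of_real x) = of_real r"
proof -
  define a b where "a = theta3 (of_real x) (\<i> * of_real t)" and "b = theta2 (of_real x) (\<i> * of_real t)"
  have "t / 4 > 0" using t by simp
  note pos = this[THEN theta3_axis_pos]
  have plus: "a + b = theta3 (of_real (x / 2)) (\<i> * of_real (t / 4))"
    using theta3_plus_theta2[OF Im_axis[OF t], of "of_real x"] by (simp add: a_def b_def)
  have minus: "a - b = theta3 (of_real ((x + pi) / 2)) (\<i> * of_real (t / 4))"
    using theta3_plus_theta2[OF Im_axis[OF t], of "of_real x + of_real pi"]
    by (simp add: a_def b_def theta3_plus_pi theta2_plus_pi)
  have "Re (a + b) > 0" "Re (a - b) > 0" "Im (a + b) = 0"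
    unfolding plus minus by (rule pos theta3_axis_real)+
  moreover have "Im a = 0" "Re a > 0"
    unfolding a_def by (rule theta3_axis_pos[OF t] theta3_axis_real)+
  ultimately have *: "\<bar>Re b\<bar> < Re a" "a = of_real (Re a)" "b = of_real (Re b)" "Re a > 0"
    by (auto simp: complex_eq_iff)
  show thesis
  proof (rule that[of "Re b / Re a"])
    show "\<bar>Re b / Re a\<bar> < 1" using * by (simp add: abs_divide)
    have "theta_quot (\<i> * of_real t) (of_real x) = b / a" by (simp add: theta_quot_def a_def b_def)
    also have "\<dots> = of_real (Re b / Re a)" using * by (metis of_real_divide)
    finally show "theta_quot (\<i> * of_real t) (of_real x) = of_real (Re b / Re a)" .
  qed
qed

lemma norm_theta_quot_axis: "t > 0 \<Longrightarrow> norm (theta_quot (\<i> * of_real t) (of_real x)) < 1"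
  using theta_quot_axis[of t x] by (metis norm_of_real)

text \<open>
  Compactness provides a limit point inside the disc for the identity theorem.
\<close>

lemma infinite_theta_quot_range:
  assumes t: "t > 0"
  obtains A where "infinite A" "compact A" "A \<subseteq> ball 0 1" "\<And>z. z \<in> A \<Longrightarrow> \<exists>x. z = theta_quot (\<i> * of_real t) (of_real x)"
proof -
  define f where "f = (\<lambda>x. theta_quot (\<i> * of_real t) (of_real x))"
  define A where "A = f ` {0..pi/2}"
  have nz: "theta3 (of_real x) (\<i> * of_real t) \<noteq> 0" for x by (rule theta3_nonzero_real[OF Im_axis[OF t]])
  have cont: "continuous_on {0..pi/2} f"
    unfolding f_def theta_quot_def using nz
    by (intro continuous_intros continuous_on_theta_real Im_axis t) auto
  have "f 0 \<noteq> f (pi / 2)"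
    using theta2_0_nonzero[OF Im_axis[OF t]] theta3_0_nonzero[OF Im_axis[OF t]]
    by (simp add: f_def theta_quot_def theta2_half_pi)
  moreover have "f 0 \<in> A" "f (pi / 2) \<in> A" by (auto simp: A_def)
  moreover have "connected A" unfolding A_def by (intro connected_continuous_image cont) auto
  ultimately have "infinite A" using connected_finite_iff_sing[of A] by blast
  moreover have "compact A" unfolding A_def by (intro compact_continuous_image cont) auto
  moreover have "A \<subseteq> ball 0 1" using norm_theta_quot_axis[OF t] by (auto simp: A_def f_def)
  ultimately show thesis using that[of A] by (auto simp: A_def f_def)
qed

section \<open>The Chebyshev-Blaschke product\<close>

lemma cb_b_eq_square: "cb_b n i \<tau> = (theta_quot \<tau> (of_real ((2 * real i - 1) * pi / (2 * real n))))\<^sup>2"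
  by (simp add: cb_b_def theta_quot_def power_divide)

lemma cb_b_axis:
  assumes t: "t > 0"
  obtains r where "\<bar>r\<bar> < 1" "cb_b n i (\<i> * of_real t) = (of_real r)\<^sup>2"
  using theta_quot_axis[OF t] unfolding cb_b_eq_square by metis

lemma poly_cb_num: "poly (cb_num n b) z = z ^ (n mod 2) * (\<Prod>i=1..n div 2. z\<^sup>2 - b i)"
  by (simp add: cb_num_def poly_prod poly_monom power2_eq_square)

lemma poly_cb_den: "poly (cb_den n b) z = (\<Prod>i=1..n div 2. 1 - b i * z\<^sup>2)"
  by (simp add: cb_den_def poly_prod power2_eq_square algebra_simps)

lemma cb_den_nonzero_disc:
  assumes t: "t > 0" and z: "norm z < 1"
  shows "poly (cb_den n (\<lambda>i. cb_b n i (\<i> * of_real t))) z \<noteq> 0"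
proof
  assume "poly (cb_den n (\<lambda>i. cb_b n i (\<i> * of_real t))) z = 0"
  then obtain i where i: "cb_b n i (\<i> * of_real t) * z\<^sup>2 = 1"
    by (auto simp: poly_cb_den)
  obtain r where r: "\<bar>r\<bar> < 1" "cb_b n i (\<i> * of_real t) = (of_real r)\<^sup>2"
    using cb_b_axis[OF t] by blast
  have "norm (of_real r * z) < 1 * 1"
    unfolding norm_mult norm_of_real using r z by (intro mult_strict_mono') auto
  moreover have "norm (of_real r * z) ^ 2 = 1"
    using i r(2) by (metis norm_one norm_power power_mult_distrib)
  ultimately show False
    using power_strict_mono[of "norm (of_real r * z)" 1 2] by simp
qed

lemma finite_blaschke_holomorphic:
  assumes "finite_blaschke_product f"
  shows "f holomorphic_on ball 0 1"
proof -
  obtain c and as :: "complex list" where as: "\<forall>a\<in>set as. norm a < 1"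
    and f: "\<forall>z\<in>ball 0 1. f z = c * (\<Prod>a\<leftarrow>as. (z - a) / (1 - cnj a * z))"
    using assms by (auto simp: finite_blaschke_product_def)
  have "(\<lambda>z. \<Prod>a\<leftarrow>as. (z - a) / (1 - cnj a * z)) holomorphic_on ball 0 1"
    using as
  proof (induction as)
    case (Cons a as)
    have "1 - cnj a * z \<noteq> 0" if "z \<in> ball 0 1" for z
    proof
      assume "1 - cnj a * z = 0"
      hence "norm (cnj a * z) = norm (1 :: complex)" by (metis eq_iff_diff_eq_0)
      moreover have "norm (cnj a * z) < 1 * 1"
        unfolding norm_mult using that Cons.prems by (intro mult_strict_mono') auto
      ultimately show False by simp
    qed
    moreover have "(\<lambda>z. \<Prod>a\<leftarrow>as. (z - a) / (1 - cnj a * z)) holomorphic_on ball 0 1"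
      using Cons by simp
    ultimately show ?case by (auto intro!: holomorphic_intros)
  qed simp
  hence "(\<lambda>z. c * (\<Prod>a\<leftarrow>as. (z - a) / (1 - cnj a * z))) holomorphic_on ball 0 1"
    by (intro holomorphic_intros)
  thus ?thesis
    by (rule holomorphic_transform) (use f in auto)
qed

lemma cb_finite_blaschke:
  fixes n :: nat
  assumes t: "t > 0"
  defines "b \<equiv> (\<lambda>i. cb_b n i (\<i> * of_real t))"
  assumes f: "\<And>z. z \<in> ball 0 1 \<Longrightarrow> f z = poly (cb_num n b) z / poly (cb_den n b) z"
  shows "finite_blaschke_product f"
proof -
  have "\<exists>r. \<bar>r\<bar> < 1 \<and> b i = (of_real r)\<^sup>2" for i
    using cb_b_axis[OF t] unfolding b_def by metis
  then obtain r where r: "\<And>i. \<bar>r i\<bar> < 1" "\<And>i. b i = (of_real (r i :: real))\<^sup>2" by metis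
  define as :: "complex list" where "as = replicate (n mod 2) 0 @ concat (map (\<lambda>i. [of_real (r i), - of_real (r i)]) [1..<Suc (n div 2)])"
  have "f z = 1 * (\<Prod>a\<leftarrow>as. (z - a) / (1 - cnj a * z))" if "z \<in> ball 0 1" for z :: complex
  proof -
    have conc: "prod_list (map h (concat (map (\<lambda>i. [of_real (r i), - of_real (r i)]) is))) =
        prod_list (map (\<lambda>i. h (of_real (r i)) * h (- of_real (r i))) is)" for h :: "complex \<Rightarrow> complex" and "is"
      by (induction "is") (auto simp: mult.assoc)
    have "(\<Prod>a\<leftarrow>as. (z - a) / (1 - cnj a * z)) =
        z ^ (n mod 2) * (\<Prod>i\<leftarrow>[1..<Suc (n div 2)]. (z - of_real (r i)) / (1 - of_real (r i) * z) * ((z + of_real (r i)) / (1 + of_real (r i) * z)))"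
      unfolding as_def by (simp add: conc prod_list_replicate map_replicate_const del: upt_Suc)
    also have "(\<lambda>i. (z - of_real (r i)) / (1 - of_real (r i) * z) * ((z + of_real (r i)) / (1 + of_real (r i) * z))) =
        (\<lambda>i. (z\<^sup>2 - b i) / (1 - b i * z\<^sup>2))"
      unfolding times_divide_times_eq r(2) by (simp add: power2_eq_square algebra_simps)
    also have "(\<Prod>i\<leftarrow>[1..<Suc (n div 2)]. (z\<^sup>2 - b i) / (1 - b i * z\<^sup>2)) = (\<Prod>i=1..n div 2. (z\<^sup>2 - b i) / (1 - b i * z\<^sup>2))"
      by (subst prod.distinct_set_conv_list[symmetric]) (auto simp: atLeastLessThanSuc_atLeastAtMost simp del: upt_Suc)
    finally show ?thesis
      using f[OF that] by (simp add: poly_cb_num poly_cb_den prod_dividef)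
  qed
  moreover have "\<forall>a\<in>set as. norm a < 1" using r(1) by (auto simp: as_def)
  ultimately show ?thesis
    unfolding finite_blaschke_product_def by (intro exI[of _ 1] exI[of _ as]) simp
qed

text \<open>
  That the quotient satisfies the functional equation is \<open>cb_param\<close>. Conversely, two functions that satisfy
  it agree on the values of \<open>Z\<^sub>\<tau>\<close> at real points, which accumulate inside the disc, and finite Blaschke
  products are holomorphic there.
\<close>

lemma chebyshev_blaschke_iff:
  assumes t: "t > 0" and n: "n \<ge> 1"
  defines "b \<equiv> (\<lambda>i. cb_b n i (\<i> * of_real t))"
  shows "chebyshev_blaschke n (\<i> * of_real t) f \<longleftrightarrow>
    (\<forall>z\<in>ball 0 1. f z = poly (cb_num n b) z / poly (cb_den n b) z)"
proof -
  define \<tau> where "\<tau> = \<i> * complex_of_real t"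
  have \<tau>: "Im \<tau> > 0" using t by (simp add: \<tau>_def)
  define F where "F z = poly (cb_num n b) z / poly (cb_den n b) z" for z
  have F: "F (theta_quot \<tau> u) = theta2 (of_nat n * u) (of_nat n * \<tau>) / theta3 (of_nat n * u) (of_nat n * \<tau>)"
    if "theta3 u \<tau> \<noteq> 0" for u
    using cb_param[OF \<tau> n that] unfolding F_def b_def \<tau>_def by (metis mult_divide_mult_cancel_left)
  have param: "chebyshev_blaschke n \<tau> f \<longleftrightarrow> finite_blaschke_product f \<and>
      (\<forall>u. theta3 u \<tau> \<noteq> 0 \<and> norm (theta_quot \<tau> u) < 1 \<longrightarrow> f (theta_quot \<tau> u) = F (theta_quot \<tau> u))"
    unfolding chebyshev_blaschke_def theta_quot_def[symmetric]
    using F by (auto simp: theta_quot_def)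
  have "chebyshev_blaschke n \<tau> f \<longleftrightarrow> (\<forall>z\<in>ball 0 1. f z = F z)"
  proof
    assume "\<forall>z\<in>ball 0 1. f z = F z"
    thus "chebyshev_blaschke n \<tau> f"
      unfolding param using cb_finite_blaschke[OF t, of f n] by (auto simp: F_def b_def)
  next
    assume cb: "chebyshev_blaschke n \<tau> f"
    obtain A where A: "infinite A" "compact A" "A \<subseteq> ball 0 1" 
      "\<And>z. z \<in> A \<Longrightarrow> \<exists>x. z = theta_quot (\<i> * of_real t) (of_real x)"
      using infinite_theta_quot_range[OF t] by blast
    obtain \<xi> where \<xi>: "\<xi> \<in> A" "\<xi> islimpt A"
      using A(1,2) unfolding compact_eq_Bolzano_Weierstrass by blast
    have "f holomorphic_on ball 0 1"
      using cb finite_blaschke_holomorphic unfolding param by blast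
    moreover have "F holomorphic_on ball 0 1"
      unfolding F_def[abs_def] b_def using cb_den_nonzero_disc[OF t] by (intro holomorphic_intros) auto
    ultimately have hol: "(\<lambda>z. f z - F z) holomorphic_on ball 0 1" by (intro holomorphic_intros)
    have zero: "f z - F z = 0" if zA: "z \<in> A" for z
    proof -
      obtain x where x: "z = theta_quot \<tau> (of_real x)" using A(4)[OF zA] by (auto simp: \<tau>_def)
      have "norm z < 1" using A(3) zA by auto
      thus ?thesis using cb theta3_nonzero_real[OF \<tau>, of x] unfolding param x by auto
    qed
    show "\<forall>z\<in>ball 0 1. f z = F z"
    proof
      fix z :: complex assume "z \<in> ball 0 1"
      hence "f z - F z = 0"
        using analytic_continuation[OF hol _ _ A(3) _ \<xi>(2) zero] \<xi>(1) A(3) by auto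
      thus "f z = F z" by simp
    qed
  qed
  thus ?thesis by (simp add: F_def \<tau>_def)
qed

lemma cb_num_nonzero: "cb_num n (b :: nat \<Rightarrow> 'a :: idom) \<noteq> 0"
  by (auto simp: cb_num_def monom_eq_0_iff)

text \<open>
  With \<open>f = p / q\<close> this is \<open>f'\<^sup>2 (k - z\<^sup>2) (1 - k z\<^sup>2) = n\<^sup>2 \<rho>\<^sup>2 (k\<^sub>n - f\<^sup>2) (1 - k\<^sub>n f\<^sup>2)\<close>, multiplied by
  \<open>q\<^sup>4\<close>. It is obtained by differentiating \<open>f(Z\<^sub>\<tau>(u)) = Z\<^bsub>n\<tau>\<^esub>(n u)\<close> and inserting the differential equations
  of the two quotients; as an identity of polynomials it has to be checked at infinitely many \<open>z\<close> only.
\<close>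

lemma cb_ode:
  fixes t :: real
  assumes t: "t > 0" and n: "n \<ge> 1"
  defines "\<tau> \<equiv> \<i> * of_real t"
  defines "p \<equiv> cb_num n (\<lambda>i. cb_b n i \<tau>)" and "q \<equiv> cb_den n (\<lambda>i. cb_b n i \<tau>)"
  defines "\<kappa> \<equiv> sqrt_k \<tau>" and "\<kappa>n \<equiv> sqrt_k (of_nat n * \<tau>)"
  shows "(pderiv p * q - p * pderiv q)\<^sup>2 * ([:\<kappa>\<^sup>2, 0, -1:] * [:1, 0, - (\<kappa>\<^sup>2):]) =
     Polynomial.smult ((of_nat n)\<^sup>2 * (omega1 (of_nat n * \<tau>) / omega1 \<tau>)\<^sup>2)
       ((Polynomial.smult (\<kappa>n\<^sup>2) (q\<^sup>2) - p\<^sup>2) * (q\<^sup>2 - Polynomial.smult (\<kappa>n\<^sup>2) (p\<^sup>2)))"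
    (is "?L = ?R")
proof -
  have \<tau>: "Im \<tau> > 0" using t by (simp add: \<tau>_def)
  have n\<tau>: "Im (of_nat n * \<tau>) > 0" using t n by (simp add: \<tau>_def)
  obtain A where A: "infinite A" "\<And>z. z \<in> A \<Longrightarrow> \<exists>x. z = theta_quot \<tau> (of_real x)"
    using infinite_theta_quot_range[OF t] unfolding \<tau>_def by metis
  \<comment> \<open>The finitely many excluded points are those where one of the two functions \<open>\<theta>\<^sub>2\<close> vanishes.\<close>
  define A' where "A' = A - ({z. poly p z = 0} \<union> {0})"
  have "infinite A'"
    unfolding A'_def using A(1) poly_roots_finite[OF cb_num_nonzero] by (intro Diff_infinite_finite) (auto simp: p_def)
  moreover have "A' \<subseteq> {z. poly (?L - ?R) z = 0}"
  proof
    fix z assume z: "z \<in> A'"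
    then obtain x where x: "z = theta_quot \<tau> (of_real x)" using A(2) by (auto simp: A'_def)
    define u where "u = complex_of_real x"
    have u3: "theta3 u \<tau> \<noteq> 0" unfolding u_def by (rule theta3_nonzero_real[OF \<tau>])
    have u2: "theta2 u \<tau> \<noteq> 0" using z x by (auto simp: A'_def theta_quot_def u_def)
    have nu3: "theta3 (of_nat n * u) (of_nat n * \<tau>) \<noteq> 0"
      using theta3_nonzero_real[OF n\<tau>, of "real n * x"] by (simp add: u_def)
    have F: "poly p (theta_quot \<tau> v) / poly q (theta_quot \<tau> v) = theta_quot (of_nat n * \<tau>) (of_nat n * v)"
      if "theta3 v \<tau> \<noteq> 0" for v
      using cb_param[OF \<tau> n that] unfolding p_def q_def theta_quot_def by (metis mult_divide_mult_cancel_left)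
    obtain w where w: "w \<noteq> 0" "poly p z = w * theta2 (of_nat n * u) (of_nat n * \<tau>)" "poly q z = w * theta3 (of_nat n * u) (of_nat n * \<tau>)"
      using cb_param[OF \<tau> n u3] unfolding p_def q_def x u_def by metis
    have nu2: "theta2 (of_nat n * u) (of_nat n * \<tau>) \<noteq> 0" using w z by (auto simp: A'_def)
    have q0: "poly q z \<noteq> 0" using w nu3 by simp
    obtain D where D: "(theta_quot \<tau> has_field_derivative D) (at u)"
        "D\<^sup>2 = (omega1 \<tau>)\<^sup>2 * ((\<kappa>\<^sup>2 - z\<^sup>2) * (1 - \<kappa>\<^sup>2 * z\<^sup>2))"
      using theta_quot_ode[OF \<tau> u2 u3] unfolding \<kappa>_def x u_def by metis
    obtain E where E: "(theta_quot (of_nat n * \<tau>) has_field_derivative E) (at (of_nat n * u))"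
        "E\<^sup>2 = (omega1 (of_nat n * \<tau>))\<^sup>2 * ((\<kappa>n\<^sup>2 - (poly p z / poly q z)\<^sup>2) * (1 - \<kappa>n\<^sup>2 * (poly p z / poly q z)\<^sup>2))"
      using theta_quot_ode[OF n\<tau> nu2 nu3] F[OF u3] unfolding \<kappa>n_def x u_def by metis
    define N where "N = poly (pderiv p) z * poly q z - poly p z * poly (pderiv q) z"
    have "((\<lambda>z. poly p z / poly q z) has_field_derivative N / (poly q z)\<^sup>2) (at (theta_quot \<tau> u))"
      using DERIV_divide[OF poly_DERIV[of p z] poly_DERIV[of q z] q0] by (simp add: N_def power2_eq_square x u_def mult.commute)
    from DERIV_chain2[OF this D(1)]
    have 1: "((\<lambda>v. poly p (theta_quot \<tau> v) / poly q (theta_quot \<tau> v)) has_field_derivative N / (poly q z)\<^sup>2 * D) (at u)" .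
    have "((\<lambda>v. of_nat n * v) has_field_derivative of_nat n) (at u)" by (auto intro!: derivative_eq_intros)
    from DERIV_chain2[OF E(1) this]
    have 2: "((\<lambda>v. theta_quot (of_nat n * \<tau>) (of_nat n * v)) has_field_derivative E * of_nat n) (at u)" .
    have "open {v. theta3 v \<tau> \<noteq> 0}"
      by (intro open_Collect_neq holomorphic_on_imp_continuous_on theta_holomorphic_arg[OF \<tau>] continuous_intros)
    hence "((\<lambda>v. poly p (theta_quot \<tau> v) / poly q (theta_quot \<tau> v)) has_field_derivative E * of_nat n) (at u)"
      using has_field_derivative_transform_within_open[OF 2, of "{v. theta3 v \<tau> \<noteq> 0}"] u3 F by simp
    hence ND: "N / (poly q z)\<^sup>2 * D = E * of_nat n" using 1 DERIV_unique by blast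
    have om: "omega1 \<tau> \<noteq> 0" using theta3_0_nonzero[OF \<tau>] by (simp add: omega1_def)
    define P where "P = (\<kappa>\<^sup>2 - z\<^sup>2) * (1 - \<kappa>\<^sup>2 * z\<^sup>2)"
    define G where "G = (\<kappa>n\<^sup>2 * (poly q z)\<^sup>2 - (poly p z)\<^sup>2) * ((poly q z)\<^sup>2 - \<kappa>n\<^sup>2 * (poly p z)\<^sup>2)"
    have G: "(\<kappa>n\<^sup>2 - (poly p z / poly q z)\<^sup>2) * (1 - \<kappa>n\<^sup>2 * (poly p z / poly q z)\<^sup>2) = G / ((poly q z)\<^sup>2)\<^sup>2"
    proof -
      have "\<kappa>n\<^sup>2 - (poly p z / poly q z)\<^sup>2 = (\<kappa>n\<^sup>2 * (poly q z)\<^sup>2 - (poly p z)\<^sup>2) / (poly q z)\<^sup>2"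
           "1 - \<kappa>n\<^sup>2 * (poly p z / poly q z)\<^sup>2 = ((poly q z)\<^sup>2 - \<kappa>n\<^sup>2 * (poly p z)\<^sup>2) / (poly q z)\<^sup>2"
        using q0 by (simp_all add: power_divide diff_divide_distrib)
      thus ?thesis by (simp add: G_def power2_eq_square)
    qed
    have "N\<^sup>2 * D\<^sup>2 / ((poly q z)\<^sup>2)\<^sup>2 = E\<^sup>2 * (of_nat n)\<^sup>2"
      using arg_cong[OF ND, of "\<lambda>x. x\<^sup>2"] by (simp add: power_mult_distrib power_divide)
    hence "N\<^sup>2 * P * (omega1 \<tau>)\<^sup>2 = (omega1 (of_nat n * \<tau>))\<^sup>2 * G * (of_nat n)\<^sup>2"
      unfolding D(2) E(2) G P_def[symmetric] using q0 by (simp add: field_simps)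
    hence "N\<^sup>2 * P = ((of_nat n)\<^sup>2 * (omega1 (of_nat n * \<tau>) / omega1 \<tau>)\<^sup>2) * G"
      using om by (simp add: power_divide field_simps)
    moreover have "poly ?L z = N\<^sup>2 * P"
    proof -
      have "poly ([:\<kappa>\<^sup>2, 0, -1:] * [:1, 0, - (\<kappa>\<^sup>2):]) z = P"
        by (simp add: P_def power2_eq_square algebra_simps)
      thus ?thesis unfolding N_def by (simp only: poly_mult poly_power poly_diff)
    qed
    moreover have "poly ?R z = ((of_nat n)\<^sup>2 * (omega1 (of_nat n * \<tau>) / omega1 \<tau>)\<^sup>2) * G"
      by (simp add: G_def)
    ultimately have "poly ?L z = poly ?R z" by metis
    thus "z \<in> {z. poly (?L - ?R) z = 0}"
      by (simp only: mem_Collect_eq poly_diff eq_iff_diff_eq_0[symmetric])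
  qed
  ultimately have "infinite {z. poly (?L - ?R) z = 0}" using finite_subset by blast
  hence "?L - ?R = 0" using poly_roots_finite by blast
  thus ?thesis by simp
qed

lemma cb_initial_value:
  assumes \<tau>: "Im \<tau> > 0" and n: "n \<ge> 1"
  shows "poly (cb_num n (\<lambda>i. cb_b n i \<tau>)) (sqrt_k \<tau>) = sqrt_k (of_nat n * \<tau>) * poly (cb_den n (\<lambda>i. cb_b n i \<tau>)) (sqrt_k \<tau>)"
proof -
  have "theta3 0 (of_nat n * \<tau>) \<noteq> 0" using \<tau> n by (intro theta3_0_nonzero) simp
  moreover obtain w where
    "poly (cb_num n (\<lambda>i. cb_b n i \<tau>)) (theta_quot \<tau> 0) = w * theta2 (of_nat n * 0) (of_nat n * \<tau>)"
    "poly (cb_den n (\<lambda>i. cb_b n i \<tau>)) (theta_quot \<tau> 0) = w * theta3 (of_nat n * 0) (of_nat n * \<tau>)"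
    using cb_param[OF \<tau> n theta3_0_nonzero[OF \<tau>]] by blast
  moreover have "theta_quot \<tau> 0 = sqrt_k \<tau>" by (simp add: theta_quot_def sqrt_k_def)
  ultimately show ?thesis by (simp add: sqrt_k_def)
qed

section \<open>Descent to a subfield\<close>

text \<open>
  A subfield as a set closed under the operations of a type class field, with \<open>inverse 0 = 0\<close>. This avoids
  carriers in the power series computations.
\<close>

locale subfield_set =
  fixes K :: "'a :: field set"
  assumes one_in [simp]: "1 \<in> K"
    and add_in: "x \<in> K \<Longrightarrow> y \<in> K \<Longrightarrow> x + y \<in> K"
    and uminus_in: "x \<in> K \<Longrightarrow> - x \<in> K"
    and mult_in: "x \<in> K \<Longrightarrow> y \<in> K \<Longrightarrow> x * y \<in> K"
    and inverse_in: "x \<in> K \<Longrightarrow> inverse x \<in> K"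
begin

lemma zero_in [simp]: "0 \<in> K"
  using add_in[OF one_in uminus_in[OF one_in]] by simp

lemma diff_in: "x \<in> K \<Longrightarrow> y \<in> K \<Longrightarrow> x - y \<in> K"
  using add_in[of x "-y"] uminus_in[of y] by simp

lemma sum_in: "(\<And>i. i \<in> A \<Longrightarrow> f i \<in> K) \<Longrightarrow> sum f A \<in> K"
  by (induction A rule: infinite_finite_induct) (auto intro: add_in)

lemma power_in: "x \<in> K \<Longrightarrow> x ^ n \<in> K"
  by (induction n) (auto intro: mult_in)

lemma of_nat_in [simp]: "of_nat n \<in> K"
  by (induction n) (auto intro: add_in)

lemma numeral_in [simp]: "numeral n \<in> K"
  using of_nat_in[of "numeral n"] by simp

lemmas closed = add_in uminus_in mult_in inverse_in diff_in sum_in power_in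

lemma cancel_in:
  assumes "x * y \<in> K" "y \<in> K" "y \<noteq> 0"
  shows "x \<in> K"
proof -
  have "x = x * y * inverse y"
    using assms(3) by (simp add: mult.assoc)
  thus ?thesis using mult_in[OF assms(1) inverse_in[OF assms(2)]] by metis
qed

definition poly_over :: "'a poly \<Rightarrow> bool" where
  "poly_over p \<longleftrightarrow> (\<forall>i. Polynomial.coeff p i \<in> K)"

lemma poly_over_add: "poly_over p \<Longrightarrow> poly_over q \<Longrightarrow> poly_over (p + q)"
  by (auto simp: poly_over_def intro: closed)

lemma poly_over_mult: "poly_over p \<Longrightarrow> poly_over q \<Longrightarrow> poly_over (p * q)"
  by (auto simp: poly_over_def Polynomial.coeff_mult intro!: closed)

lemma poly_over_smult: "c \<in> K \<Longrightarrow> poly_over p \<Longrightarrow> poly_over (Polynomial.smult c p)"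
  by (auto simp: poly_over_def intro: closed)

lemma poly_over_pCons: "poly_over (pCons a p) \<longleftrightarrow> a \<in> K \<and> poly_over p"
  unfolding poly_over_def by (metis coeff_pCons_0 coeff_pCons_Suc not0_implies_Suc)

lemma poly_over_0 [simp]: "poly_over 0"
  by (simp add: poly_over_def)

lemma poly_over_pcompose: "poly_over p \<Longrightarrow> poly_over q \<Longrightarrow> poly_over (pcompose p q)"
  by (induction p) (auto simp: pcompose_pCons poly_over_pCons intro!: poly_over_add poly_over_mult)

lemma poly_over_eval: "poly_over p \<Longrightarrow> x \<in> K \<Longrightarrow> poly p x \<in> K"
  by (induction p) (auto simp: poly_over_pCons intro!: closed)

lemma fps_inverse_over:
  assumes F: "\<And>i. fps_nth F i \<in> K" and F0: "fps_nth F 0 \<noteq> 0"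
  shows "fps_nth (inverse F) n \<in> K"
proof (induction n rule: less_induct)
  case (less n)
  show ?case
  proof (cases n)
    case 0
    thus ?thesis using F by (auto intro: closed)
  next
    case (Suc m)
    have "inverse F * F = 1" using F0 by (rule inverse_mult_eq_1)
    hence "0 = fps_nth (inverse F * F) n" using Suc by simp
    also have "\<dots> = (\<Sum>i<n. fps_nth (inverse F) i * fps_nth F (n - i)) + fps_nth (inverse F) n * fps_nth F 0"
      by (simp add: fps_mult_nth atLeast0AtMost lessThan_Suc_atMost[symmetric])
    finally have "fps_nth (inverse F) n * fps_nth F 0 = - (\<Sum>i<n. fps_nth (inverse F) i * fps_nth F (n - i))"
      by (simp add: eq_neg_iff_add_eq_0 add.commute)
    moreover have "- (\<Sum>i<n. fps_nth (inverse F) i * fps_nth F (n - i)) \<in> K"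
      using less F by (auto intro!: closed)
    ultimately show ?thesis
      using F F0 by (metis cancel_in)
  qed
qed

text \<open>
  By induction along the continued fraction expansion: write \<open>p / q = F\<^sub>0 + X\<^sup>k p' / q\<close> with \<open>p'(0) \<noteq> 0\<close>
  and pass to \<open>q / p'\<close>, which again is a power series over \<open>K\<close>. The degrees decrease in the sense of the
  given measure, coprimality persists, and when the remainder vanishes \<open>q\<close> is a constant. Coprimality cannot be
  dropped, since a common factor of \<open>p\<close> and \<open>q\<close> does not show in the power series.
\<close>

lemma rational_power_series_descends:
  assumes "a * p + b * q = 1" "poly q 0 \<noteq> 0"
    and "fps_of_poly p = F * fps_of_poly q" "\<And>i. fps_nth F i \<in> K"
  shows "\<exists>c. c \<noteq> 0 \<and> poly_over (Polynomial.smult c p) \<and> poly_over (Polynomial.smult c q)"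
  using assms
proof (induction "max (2 * Polynomial.degree p) (2 * Polynomial.degree q + 1)" arbitrary: a b p q F rule: less_induct)
  case less
  define F0 where "F0 = fps_nth F 0"
  define r where "r = p - Polynomial.smult F0 q"
  have F0: "F0 \<in> K" using less.prems by (simp add: F0_def)
  have p: "p = Polynomial.smult F0 q + r" by (simp add: r_def)
  have r: "fps_of_poly r = (F - fps_const F0) * fps_of_poly q"
    unfolding r_def using less.prems(3)
    by (simp add: fps_of_poly_diff fps_of_poly_smult algebra_simps)
  show ?case
  proof (cases "r = 0")
    case True
    have "(Polynomial.smult F0 a + b) * q = 1"
      using less.prems(1) p True by (simp add: algebra_simps)
    hence "q dvd 1" by (metis dvd_triv_right)
    then obtain q0 where q0: "q = [:q0:]" "q0 \<noteq> 0"
      by (metis is_unit_polyE not_is_unit_0 pCons_0_0)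
    show ?thesis
      by (rule exI[of _ "inverse q0"]) (use p True q0 F0 in \<open>auto simp: poly_over_pCons field_simps\<close>)
  next
    case False
    define D where "D = F - fps_const F0"
    have D0: "D \<noteq> 0" using r False unfolding D_def by auto
    define k where "k = subdegree D"
    have k: "k \<ge> 1"
      unfolding k_def using D0 nth_subdegree_nonzero[OF D0] by (cases "subdegree D") (auto simp: D_def F0_def)
    define F1 where "F1 = fps_shift k D"
    have D: "D = fps_X ^ k * F1"
      unfolding F1_def k_def by (metis subdegree_decompose mult.commute)
    have F10: "fps_nth F1 0 \<noteq> 0"
      unfolding F1_def k_def using D0 by simp
    have F1: "fps_nth F1 i \<in> K" for i
      using less.prems(4) F0 by (auto simp: F1_def D_def intro!: diff_in)
    define p1 where "p1 = poly_shift k r"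
    have p1': "fps_of_poly p1 = F1 * fps_of_poly q"
    proof (rule fps_ext)
      fix n
      have "fps_nth (fps_of_poly p1) n = fps_nth (fps_of_poly r) (n + k)"
        by (simp add: p1_def coeff_poly_shift)
      also have "\<dots> = fps_nth (fps_X ^ k * (F1 * fps_of_poly q)) (n + k)"
        unfolding r D_def[symmetric] D by (simp add: mult.assoc)
      also have "\<dots> = fps_nth (F1 * fps_of_poly q) n"
        by (simp add: fps_X_power_mult_nth)
      finally show "fps_nth (fps_of_poly p1) n = fps_nth (F1 * fps_of_poly q) n" .
    qed
    have r1: "r = Polynomial.monom 1 k * p1"
    proof -
      have "fps_of_poly r = fps_of_poly (Polynomial.monom 1 k * p1)"
        unfolding fps_of_poly_mult fps_of_poly_monom' p1' r D_def[symmetric] D by (simp add: mult.assoc)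
      thus ?thesis by (simp add: fps_of_poly_eq_iff)
    qed
    have p1_0: "p1 \<noteq> 0" using r1 False by auto
    have p10: "poly p1 0 \<noteq> 0"
    proof -
      have "poly p1 0 = fps_nth (fps_of_poly p1) 0" by (simp add: poly_0_coeff_0)
      also have "\<dots> = fps_nth F1 0 * poly q 0" unfolding p1' by (simp add: poly_0_coeff_0)
      finally show ?thesis using F10 less.prems(2) by simp
    qed
    have q: "fps_of_poly q = inverse F1 * fps_of_poly p1"
      using inverse_mult_eq_1[OF F10] unfolding p1' by (simp add: mult.assoc[symmetric])
    have "Polynomial.degree r = k + Polynomial.degree p1"
      unfolding r1 using p1_0 by (subst Polynomial.degree_mult_eq) (auto simp: Polynomial.degree_monom_eq)
    moreover have "Polynomial.degree r \<le> max (Polynomial.degree p) (Polynomial.degree q)"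
      unfolding r_def by (rule degree_diff_le_max[THEN order_trans]) (use Polynomial.degree_smult_le[of F0 q] in \<open>auto simp: max_def\<close>)
    ultimately have deg: "Polynomial.degree p1 + 1 \<le> max (Polynomial.degree p) (Polynomial.degree q)"
      using k by linarith
    have "\<exists>c. c \<noteq> 0 \<and> poly_over (Polynomial.smult c q) \<and> poly_over (Polynomial.smult c p1)"
    proof (rule less.hyps[OF _ _ p10 q fps_inverse_over[OF F1 F10]])
      show "max (2 * Polynomial.degree q) (2 * Polynomial.degree p1 + 1) < max (2 * Polynomial.degree p) (2 * Polynomial.degree q + 1)"
        using deg by (auto simp: max_def split: if_splits)
      show "(Polynomial.smult F0 a + b) * q + (a * Polynomial.monom 1 k) * p1 = 1"
        using less.prems(1) unfolding p r1 by (simp add: algebra_simps)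
    qed
    then obtain c where c: "c \<noteq> 0" "poly_over (Polynomial.smult c q)" "poly_over (Polynomial.smult c p1)"
      by blast
    have "Polynomial.smult c p = Polynomial.smult F0 (Polynomial.smult c q) + Polynomial.monom 1 k * Polynomial.smult c p1"
      unfolding p r1 by (simp add: smult_add_right mult.commute)
    moreover have "poly_over (Polynomial.monom 1 k)"
      by (auto simp: poly_over_def)
    ultimately show ?thesis
      using c F0 by (metis poly_over_add poly_over_mult poly_over_smult)
  qed
qed

text \<open>
  Differentiating the equation and cancelling \<open>F'\<close> gives \<open>2 F'' P + F' P' = c G(F)\<close> with a cubic
  polynomial \<open>G\<close> over \<open>K\<close>. Because of \<open>P\<^sub>0 = 0\<close>, the coefficient of \<open>X\<^sup>n\<close> on the left is
  \<open>(2 n + 1) (n + 1) P\<^sub>1 F\<^bsub>n+1\<^esub>\<close> plus terms in \<open>F\<^sub>0, \<dots>, F\<^sub>n\<close>, while the coefficient on the right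
  involves \<open>F\<^sub>0, \<dots>, F\<^sub>n\<close> only.
\<close>

lemma ode_series_descends:
  fixes F P :: "'a fps" and c \<kappa> :: 'a
  assumes char: "\<And>n. of_nat (Suc n) \<noteq> (0 :: 'a)"
    and ode: "(fps_deriv F)\<^sup>2 * P = fps_const c * ((fps_const (\<kappa>\<^sup>2) - F\<^sup>2) * (1 - fps_const (\<kappa>\<^sup>2) * F\<^sup>2))"
    and nonconst: "fps_deriv F \<noteq> 0"
    and K: "c \<in> K" "\<kappa> \<in> K" "\<And>i. fps_nth P i \<in> K" "fps_nth F 0 \<in> K"
    and P: "fps_nth P 0 = 0" "fps_nth P 1 \<noteq> 0"
  shows "fps_nth F n \<in> K"
proof -
  define k2 where "k2 = \<kappa>\<^sup>2"
  have k2: "k2 \<in> K" using K by (simp add: k2_def power_in)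
  define F' where "F' = fps_deriv F"
  define F'' where "F'' = fps_deriv F'"
  define G where "G = fps_const c * (fps_const (2 * (2 * k2)) * (F * F * F) - fps_const (2 * (1 + k2\<^sup>2)) * F)"
  define C L where "C = fps_const c" and "L = fps_const k2"
  have "F' * F' * P = C * ((L - F * F) * (1 - L * (F * F)))"
    using ode by (simp add: F'_def k2_def C_def L_def power2_eq_square)
  hence "fps_deriv (F' * F' * P) = fps_deriv (C * ((L - F * F) * (1 - L * (F * F))))"
    by simp
  moreover have "fps_deriv C = 0" "fps_deriv L = 0" by (simp_all add: C_def L_def)
  ultimately have "F' * (2 * F'' * P + F' * fps_deriv P) =
      C * (- (2 * F * F') * (1 - L * (F * F)) - L * (2 * F * F') * (L - F * F))"
    by (simp add: F'_def[symmetric] F''_def[symmetric] algebra_simps)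
  also have "\<dots> = F' * G"
  proof -
    have *: "fps_const (2 * (2 * k2)) = 4 * L" "fps_const (2 * (1 + k2\<^sup>2)) = 2 * (1 + L * L)"
      by (simp_all add: L_def power2_eq_square numeral_fps_const)
    show ?thesis unfolding G_def * C_def[symmetric] by (simp add: algebra_simps)
  qed
  finally have eq: "2 * F'' * P + F' * fps_deriv P = G"
    using nonconst by (simp add: F'_def)
  show ?thesis
  proof (induction n rule: less_induct)
    case (less m)
    show ?case
    proof (cases m)
      case 0
      thus ?thesis using K by simp
    next
      case (Suc n)
      have IH: "fps_nth F i \<in> K" if "i \<le> n" for i using less Suc that by auto
      have F': "fps_nth F' i = of_nat (i + 1) * fps_nth F (i + 1)" for i
        by (simp add: F'_def)
      have F'': "fps_nth F'' i = of_nat (i + 1) * (of_nat (i + 2) * fps_nth F (i + 2))" for i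
        by (simp add: F''_def F'_def)
      have prod_in: "fps_nth (A * B) i \<in> K"
        if "\<And>i. i \<le> n \<Longrightarrow> fps_nth A i \<in> K" "\<And>i. i \<le> n \<Longrightarrow> fps_nth B i \<in> K" "i \<le> n" for A B i
        using that by (auto simp: fps_mult_nth intro!: closed)
      have GK: "fps_nth G n \<in> K"
        unfolding G_def using K k2 IH by (auto simp del: fps_const_mult intro!: closed prod_in)
      have "\<exists>y\<in>K. fps_nth (F' * fps_deriv P) n = fps_nth F m * (of_nat m * fps_nth P 1) + y"
      proof
        show "fps_nth (F' * fps_deriv P) n = fps_nth F m * (of_nat m * fps_nth P 1) +
            (\<Sum>i<n. fps_nth F' i * fps_nth (fps_deriv P) (n - i))"
          unfolding fps_mult_nth atLeast0AtMost lessThan_Suc_atMost[symmetric] sum.lessThan_Suc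
          by (simp add: F' Suc algebra_simps)
        show "(\<Sum>i<n. fps_nth F' i * fps_nth (fps_deriv P) (n - i)) \<in> K"
          unfolding F' fps_deriv_nth using IH K by (intro closed of_nat_in) auto
      qed
      then obtain y where y: "y \<in> K" "fps_nth (F' * fps_deriv P) n = fps_nth F m * (of_nat m * fps_nth P 1) + y"
        by blast
      have "\<exists>z\<in>K. fps_nth (F'' * P) n = fps_nth F m * (of_nat (n * m) * fps_nth P 1) + z"
      proof (cases n)
        case 0
        show ?thesis by (rule bexI[of _ 0]) (use 0 P in auto)
      next
        case n: (Suc l)
        show ?thesis
        proof
          show "fps_nth (F'' * P) n = fps_nth F m * (of_nat (n * m) * fps_nth P 1) + (\<Sum>i<l. fps_nth F'' i * fps_nth P (n - i))"
            unfolding fps_mult_nth atLeast0AtMost lessThan_Suc_atMost[symmetric] n sum.lessThan_Suc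
            using P by (simp add: F'' Suc n algebra_simps)
          show "(\<Sum>i<l. fps_nth F'' i * fps_nth P (n - i)) \<in> K"
            unfolding F'' using IH K n by (intro closed of_nat_in) auto
        qed
      qed
      then obtain z where z: "z \<in> K" "fps_nth (F'' * P) n = fps_nth F m * (of_nat (n * m) * fps_nth P 1) + z"
        by blast
      have "fps_nth F m * (of_nat (2 * n + 1) * of_nat m * fps_nth P 1) = fps_nth G n - (2 * z + y)"
      proof -
        have "fps_nth G n = 2 * fps_nth (F'' * P) n + fps_nth (F' * fps_deriv P) n"
          unfolding eq[symmetric] by (simp add: mult.assoc numeral_fps_const)
        also have "\<dots> = fps_nth F m * (of_nat (2 * n + 1) * of_nat m * fps_nth P 1) + (2 * z + y)"
          unfolding y z by (simp add: algebra_simps)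
        finally show ?thesis by simp
      qed
      moreover have "fps_nth G n - (2 * z + y) \<in> K"
        using GK y z by (intro closed) auto
      moreover have "of_nat (2 * n + 1) * of_nat m * fps_nth P 1 \<noteq> 0"
        using char[of "2 * n"] char[of n] P Suc by (simp add: add.commute)
      moreover have "of_nat (2 * n + 1) * of_nat m * fps_nth P 1 \<in> K"
        using K by (intro closed of_nat_in)
      ultimately show ?thesis using cancel_in by metis
    qed
  qed
qed

text \<open>
  Expand \<open>p / q\<close> at \<open>z\<^sub>0\<close>. The preceding lemmas put numerator and denominator into \<open>K[z]\<close> up to a common
  constant, and the normalisation \<open>q(0) = 1\<close> shows that this constant lies in \<open>K\<close>.
\<close>

theorem ode_solution_descends:
  fixes p q P :: "'a poly" and z0 \<kappa> c :: 'a
  assumes char: "\<And>n. of_nat (Suc n) \<noteq> (0 :: 'a)"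
    and ode: "(pderiv p * q - p * pderiv q)\<^sup>2 * P =
          Polynomial.smult c ((Polynomial.smult (\<kappa>\<^sup>2) (q\<^sup>2) - p\<^sup>2) * (q\<^sup>2 - Polynomial.smult (\<kappa>\<^sup>2) (p\<^sup>2)))"
    and nonconst: "(Polynomial.smult (\<kappa>\<^sup>2) (q\<^sup>2) - p\<^sup>2) * (q\<^sup>2 - Polynomial.smult (\<kappa>\<^sup>2) (p\<^sup>2)) \<noteq> 0" "c \<noteq> 0"
    and coprime: "a * p + b * q = 1"
    and init: "poly p z0 = \<kappa> * poly q z0" "poly q z0 \<noteq> 0"
    and K: "c \<in> K" "\<kappa> \<in> K" "z0 \<in> K" "poly_over P"
    and P: "poly P z0 = 0" "poly (pderiv P) z0 \<noteq> 0"
    and norm: "poly q 0 = 1"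
  shows "poly_over p" "poly_over q"
proof -
  define sh where "sh r = pcompose r [:z0, 1:]" for r :: "'a poly"
  have pow: "pcompose (r ^ n) [:z0, 1:] = pcompose r [:z0, 1:] ^ n" for r n
    by (induction n) (simp_all add: pcompose_mult pcompose_1)
  have sh_simps: "sh (r * s) = sh r * sh s" "sh (r + s) = sh r + sh s" "sh (r - s) = sh r - sh s"
      "sh (Polynomial.smult d r) = Polynomial.smult d (sh r)" "sh 1 = 1" "pderiv (sh r) = sh (pderiv r)"
      "poly (sh r) 0 = poly r z0" "sh (r ^ n) = sh r ^ n" for r s d n
    by (simp_all add: sh_def pcompose_mult pcompose_add pcompose_diff pcompose_smult pcompose_1
          pderiv_pcompose poly_pcompose pderiv_pCons pow)
  have unsh: "r = pcompose (sh r) [:- z0, 1:]" for r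
    by (simp add: sh_def pcompose_assoc[symmetric] pcompose_pCons)
  define p' q' where "p' = fps_of_poly (sh p)" and "q' = fps_of_poly (sh q)"
  have q'0: "fps_nth q' 0 \<noteq> 0"
    using init(2) sh_simps(7)[of q] by (simp add: q'_def poly_0_coeff_0)
  hence q': "q' \<noteq> 0" "inverse q' * q' = 1"
    by (auto simp: inverse_mult_eq_1)
  define F where "F = p' * inverse q'"
  have p': "p' = F * q'" using q' by (simp add: F_def mult.assoc)
  define P' where "P' = fps_of_poly (sh P)"
  have P': "fps_nth P' 0 = 0" "fps_nth P' 1 \<noteq> 0"
  proof -
    show "fps_nth P' 0 = 0" using P(1) sh_simps(7)[of P] by (simp add: P'_def poly_0_coeff_0)
    have "fps_nth P' 1 = Polynomial.coeff (pderiv (sh P)) 0" by (simp add: P'_def coeff_pderiv)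
    also have "\<dots> = poly (pderiv P) z0" unfolding sh_simps(6) by (metis poly_0_coeff_0 sh_simps(7))
    finally show "fps_nth P' 1 \<noteq> 0" using P(2) by simp
  qed
  have dF: "fps_of_poly (sh (pderiv p * q - p * pderiv q)) = fps_deriv F * q'\<^sup>2"
  proof -
    have d: "fps_of_poly (sh (pderiv r)) = fps_deriv (fps_of_poly (sh r))" for r
      by (simp add: sh_simps(6)[symmetric] fps_of_poly_pderiv)
    have "fps_of_poly (sh (pderiv p * q - p * pderiv q)) = fps_deriv p' * q' - p' * fps_deriv q'"
      by (simp add: sh_simps fps_of_poly_diff fps_of_poly_mult d p'_def q'_def del: sh_simps(6))
    thus ?thesis unfolding p' by (simp add: power2_eq_square algebra_simps)
  qed
  define R where "R = (Polynomial.smult (\<kappa>\<^sup>2) (q\<^sup>2) - p\<^sup>2) * (q\<^sup>2 - Polynomial.smult (\<kappa>\<^sup>2) (p\<^sup>2))"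
  have R: "fps_of_poly (sh R) = (fps_const (\<kappa>\<^sup>2) - F\<^sup>2) * (1 - fps_const (\<kappa>\<^sup>2) * F\<^sup>2) * q' ^ 4"
  proof -
    have "fps_of_poly (sh R) = (fps_const (\<kappa>\<^sup>2) * q'\<^sup>2 - p'\<^sup>2) * (q'\<^sup>2 - fps_const (\<kappa>\<^sup>2) * p'\<^sup>2)"
      unfolding R_def by (simp add: sh_simps fps_of_poly_diff fps_of_poly_mult fps_of_poly_smult fps_of_poly_power p'_def q'_def)
    thus ?thesis unfolding p' by (simp add: eval_nat_numeral algebra_simps)
  qed
  have "fps_of_poly (sh ((pderiv p * q - p * pderiv q)\<^sup>2 * P)) = fps_of_poly (sh (Polynomial.smult c R))"
    using ode by (simp add: R_def)
  hence "((fps_deriv F)\<^sup>2 * P') * q' ^ 4 =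
      (fps_const c * ((fps_const (\<kappa>\<^sup>2) - F\<^sup>2) * (1 - fps_const (\<kappa>\<^sup>2) * F\<^sup>2))) * q' ^ 4"
    unfolding sh_simps(1,4,8) fps_of_poly_mult fps_of_poly_power dF fps_of_poly_smult R P'_def[symmetric]
    by (simp add: power_mult_distrib algebra_simps flip: power_mult)
  hence odeF: "(fps_deriv F)\<^sup>2 * P' = fps_const c * ((fps_const (\<kappa>\<^sup>2) - F\<^sup>2) * (1 - fps_const (\<kappa>\<^sup>2) * F\<^sup>2))"
    using q' by simp
  have "sh R \<noteq> 0"
    using nonconst(1) unsh[of R] by (auto simp: R_def[symmetric])
  hence "fps_const c * ((fps_const (\<kappa>\<^sup>2) - F\<^sup>2) * (1 - fps_const (\<kappa>\<^sup>2) * F\<^sup>2)) \<noteq> 0"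
    using nonconst(2) R by auto
  hence dF0: "fps_deriv F \<noteq> 0" using odeF by auto
  have z0: "poly_over [:z0, 1:]" "poly_over [:- z0, 1:]"
    using K by (auto simp: poly_over_pCons intro: closed)
  have "fps_nth P' i \<in> K" for i
    using poly_over_pcompose[OF K(4) z0(1)] by (simp add: P'_def sh_def poly_over_def)
  moreover have "fps_nth F 0 \<in> K"
  proof -
    have "fps_nth p' 0 = \<kappa> * fps_nth q' 0"
      using init(1) by (simp add: p'_def q'_def poly_0_coeff_0[symmetric] sh_simps)
    hence "fps_nth F 0 = \<kappa>" using q'0 by (simp add: p')
    thus ?thesis using K by simp
  qed
  ultimately have FK: "fps_nth F n \<in> K" for n
    using ode_series_descends[OF char odeF dF0 K(1,2) _ _ P'] by blast
  have "sh a * sh p + sh b * sh q = 1"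
    using arg_cong[OF coprime, of sh] by (simp add: sh_simps)
  moreover have "poly (sh q) 0 \<noteq> 0" using init(2) by (simp add: sh_simps)
  moreover have "fps_of_poly (sh p) = F * fps_of_poly (sh q)" using p' by (simp add: p'_def q'_def)
  ultimately obtain d where d: "d \<noteq> 0" "poly_over (Polynomial.smult d (sh p))" "poly_over (Polynomial.smult d (sh q))"
    using rational_power_series_descends FK by metis
  have d': "Polynomial.smult d r = pcompose (Polynomial.smult d (sh r)) [:- z0, 1:]" for r
    by (subst unsh[of r]) (simp add: pcompose_smult)
  have "poly_over (Polynomial.smult d p)" "poly_over (Polynomial.smult d q)"
    unfolding d'[of p] d'[of q] using d z0 by (blast intro: poly_over_pcompose)+
  moreover from this have "d \<in> K"
    using poly_over_eval[of "Polynomial.smult d q" 0] norm by simp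
  moreover have "r = Polynomial.smult (inverse d) (Polynomial.smult d r)" for r
    using d(1) by simp
  ultimately show "poly_over p" "poly_over q"
    by (metis poly_over_smult inverse_in)+
qed

end

section \<open>Meromorphic functions and their values on the imaginary axis\<close>

lemma mero_hom:
  assumes "f meromorphic_on upper_half_plane" "g meromorphic_on upper_half_plane"
  shows Mero_add: "Mero (\<lambda>z. f z + g z) = Mero f + Mero g"
    and Mero_diff: "Mero (\<lambda>z. f z - g z) = Mero f - Mero g"
    and Mero_mult: "Mero (\<lambda>z. f z * g z) = Mero f * Mero g"
  using assms by (transfer; force simp: mero_rel_def intro!: meromorphic_intros)+

lemma Mero_minus: "f meromorphic_on upper_half_plane \<Longrightarrow> Mero (\<lambda>z. - f z) = - Mero f"
  by (transfer; force simp: mero_rel_def intro!: meromorphic_intros)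

lemma Mero_0: "Mero (\<lambda>_. 0) = 0"
  by (transfer; force simp: mero_rel_def intro!: meromorphic_intros)

lemma Mero_1: "Mero (\<lambda>_. 1) = 1"
  by (transfer; force simp: mero_rel_def intro!: meromorphic_intros)

lemma Mero_power:
  assumes "f meromorphic_on upper_half_plane"
  shows "Mero (\<lambda>z. f z ^ k) = Mero f ^ k"
proof (induction k)
  case (Suc k)
  have "Mero (\<lambda>z. f z * f z ^ k) = Mero f * Mero (\<lambda>z. f z ^ k)"
    by (rule Mero_mult) (intro meromorphic_intros assms)+
  thus ?case using Suc by simp
qed (simp add: Mero_1)

lemma Mero_sum:
  assumes "\<And>i. i \<in> A \<Longrightarrow> f i meromorphic_on upper_half_plane"
  shows "Mero (\<lambda>z. \<Sum>i\<in>A. f i z) = (\<Sum>i\<in>A. Mero (f i))"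
  using assms
proof (induction A rule: infinite_finite_induct)
  case (insert x A)
  have "Mero (\<lambda>z. f x z + (\<Sum>i\<in>A. f i z)) = Mero (f x) + Mero (\<lambda>z. \<Sum>i\<in>A. f i z)"
    by (rule Mero_add) (use insert.prems in \<open>auto intro!: meromorphic_intros\<close>)
  thus ?case using insert by simp
qed (simp_all add: Mero_0)

lemma Mero_prod:
  assumes "\<And>i. i \<in> A \<Longrightarrow> f i meromorphic_on upper_half_plane"
  shows "Mero (\<lambda>z. \<Prod>i\<in>A. f i z) = (\<Prod>i\<in>A. Mero (f i))"
  using assms
proof (induction A rule: infinite_finite_induct)
  case (insert x A)
  have "Mero (\<lambda>z. f x z * (\<Prod>i\<in>A. f i z)) = Mero (f x) * Mero (\<lambda>z. \<Prod>i\<in>A. f i z)"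
    by (rule Mero_mult) (use insert.prems in \<open>auto intro!: meromorphic_intros\<close>)
  thus ?case using insert by simp
qed (simp_all add: Mero_1)

lemma Mero_of_nat: "Mero (\<lambda>_. of_nat k) = of_nat k"
proof (induction k)
  case (Suc k)
  have "Mero (\<lambda>_. 1 + of_nat k) = Mero (\<lambda>_. 1) + Mero (\<lambda>_. of_nat k)"
    by (rule Mero_add) (intro meromorphic_intros)+
  thus ?case using Suc by (simp add: Mero_1)
qed (simp add: Mero_0)

text \<open>
  The imaginary axis accumulates at \<open>\<i>\<close>. Hence a meromorphic function on the upper half plane is determined
  by its values on the axis.
\<close>

lemma axis_meets_punctured_neighbourhood:
  assumes "\<forall>\<^sub>\<approx>z\<in>upper_half_plane. P z"
  obtains t where "t > 0" "P (\<i> * of_real t)"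
proof -
  have "eventually P (at \<i>)"
    using assms i_in_upper_half_plane by (simp add: eventually_cosparse_open_eq)
  then obtain d where d: "d > 0" "\<And>z. z \<noteq> \<i> \<Longrightarrow> dist z \<i> < d \<Longrightarrow> P z"
    unfolding eventually_at by auto
  have "dist (\<i> * of_real (1 + d / 2)) \<i> = norm (\<i> * of_real (d / 2))"
    unfolding dist_norm by (simp add: algebra_simps)
  also have "\<dots> < d" using d by (simp add: norm_mult)
  finally have "P (\<i> * of_real (1 + d / 2))"
    using d by (intro d(2)) (auto simp: complex_eq_iff)
  thus thesis using that[of "1 + d / 2"] d by auto
qed

lemma Mero_eqI_axis:
  assumes "f meromorphic_on upper_half_plane" "g meromorphic_on upper_half_plane"
    and "\<And>t. t > 0 \<Longrightarrow> f (\<i> * of_real t) = g (\<i> * of_real t)"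
  shows "Mero f = Mero g"
proof -
  have mero: "(\<lambda>z. f z - g z) meromorphic_on upper_half_plane"
    using assms by (intro meromorphic_intros)
  have "\<forall>\<^sub>\<approx>z\<in>upper_half_plane. f z - g z = 0"
  proof (rule ccontr)
    assume "\<not> (\<forall>\<^sub>\<approx>z\<in>upper_half_plane. f z - g z = 0)"
    from mero_nonzero_cosparse[OF mero this] obtain t
      where "t > 0" "f (\<i> * of_real t) - g (\<i> * of_real t) \<noteq> 0"
      by (rule axis_meets_punctured_neighbourhood)
    thus False using assms(3) by simp
  qed
  thus ?thesis unfolding Mero_eq_iff[OF assms(1,2)] by simp
qed

lemma Mero_nonzero_axis:
  assumes "f meromorphic_on upper_half_plane"
    and "\<And>t. t > 0 \<Longrightarrow> f (\<i> * of_real t) \<noteq> 0"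
  shows "Mero f \<noteq> 0"
proof
  assume "Mero f = 0"
  hence "\<forall>\<^sub>\<approx>z\<in>upper_half_plane. f z = 0"
    unfolding Mero_0[symmetric] using assms(1) by (subst (asm) Mero_eq_iff) auto
  then obtain t where "t > 0" "f (\<i> * of_real t) = 0"
    by (rule axis_meets_punctured_neighbourhood)
  thus False using assms(2) by blast
qed

lemma mero_of_nat_Suc_nonzero: "of_nat (Suc k) \<noteq> (0 :: mero)"
  unfolding Mero_of_nat[symmetric] by (rule Mero_nonzero_axis) (auto simp del: of_nat_Suc intro!: meromorphic_intros)

text \<open>
  Pointwise identities between polynomials with varying coefficients are lifted coefficientwise to the field of
  meromorphic functions. The degrees of \<open>p \<tau>\<close> may depend on \<open>\<tau>\<close>.
\<close>

definition represents :: "mero poly \<Rightarrow> (complex \<Rightarrow> complex poly) \<Rightarrow> bool" where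
  "represents P p \<longleftrightarrow> (\<forall>i. (\<lambda>\<tau>. Polynomial.coeff (p \<tau>) i) meromorphic_on upper_half_plane \<and>
     Polynomial.coeff P i = Mero (\<lambda>\<tau>. Polynomial.coeff (p \<tau>) i))"

lemma represents_diff: "represents P p \<Longrightarrow> represents Q q \<Longrightarrow> represents (P - Q) (\<lambda>\<tau>. p \<tau> - q \<tau>)"
  by (auto simp: represents_def Mero_diff intro!: meromorphic_intros)

lemma represents_mult: "represents P p \<Longrightarrow> represents Q q \<Longrightarrow> represents (P * Q) (\<lambda>\<tau>. p \<tau> * q \<tau>)"
  unfolding represents_def Polynomial.coeff_mult
proof
  fix i
  assume *: "\<forall>i. (\<lambda>\<tau>. Polynomial.coeff (p \<tau>) i) meromorphic_on upper_half_plane \<and> Polynomial.coeff P i = Mero (\<lambda>\<tau>. Polynomial.coeff (p \<tau>) i)"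
    "\<forall>i. (\<lambda>\<tau>. Polynomial.coeff (q \<tau>) i) meromorphic_on upper_half_plane \<and> Polynomial.coeff Q i = Mero (\<lambda>\<tau>. Polynomial.coeff (q \<tau>) i)"
  hence m: "(\<lambda>\<tau>. Polynomial.coeff (p \<tau>) j) meromorphic_on upper_half_plane" "(\<lambda>\<tau>. Polynomial.coeff (q \<tau>) j) meromorphic_on upper_half_plane" for j
    by blast+
  have "Mero (\<lambda>\<tau>. \<Sum>j\<le>i. Polynomial.coeff (p \<tau>) j * Polynomial.coeff (q \<tau>) (i - j)) =
      (\<Sum>j\<le>i. Mero (\<lambda>\<tau>. Polynomial.coeff (p \<tau>) j * Polynomial.coeff (q \<tau>) (i - j)))"
    by (rule Mero_sum) (intro meromorphic_intros m)
  also have "\<dots> = (\<Sum>j\<le>i. Polynomial.coeff P j * Polynomial.coeff Q (i - j))"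
    using * by (intro sum.cong refl) (simp add: Mero_mult m)
  finally show "(\<lambda>\<tau>. \<Sum>j\<le>i. Polynomial.coeff (p \<tau>) j * Polynomial.coeff (q \<tau>) (i - j)) meromorphic_on upper_half_plane \<and>
      (\<Sum>j\<le>i. Polynomial.coeff P j * Polynomial.coeff Q (i - j)) = Mero (\<lambda>\<tau>. \<Sum>j\<le>i. Polynomial.coeff (p \<tau>) j * Polynomial.coeff (q \<tau>) (i - j))"
    by (auto intro!: meromorphic_intros m)
qed

lemma represents_smult:
  "f meromorphic_on upper_half_plane \<Longrightarrow> represents P p \<Longrightarrow> represents (Polynomial.smult (Mero f) P) (\<lambda>\<tau>. Polynomial.smult (f \<tau>) (p \<tau>))"
  by (auto simp: represents_def Mero_mult intro!: meromorphic_intros)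

lemma represents_pCons:
  assumes "f meromorphic_on upper_half_plane" "represents P p"
  shows "represents (pCons (Mero f) P) (\<lambda>\<tau>. pCons (f \<tau>) (p \<tau>))"
  unfolding represents_def
proof
  fix i
  show "(\<lambda>\<tau>. Polynomial.coeff (pCons (f \<tau>) (p \<tau>)) i) meromorphic_on upper_half_plane \<and>
     Polynomial.coeff (pCons (Mero f) P) i = Mero (\<lambda>\<tau>. Polynomial.coeff (pCons (f \<tau>) (p \<tau>)) i)"
    using assms by (cases i) (auto simp: represents_def)
qed

lemma represents_0: "represents 0 (\<lambda>_. 0)"
  by (auto simp: represents_def Mero_0 intro!: meromorphic_intros)

lemma represents_1: "represents 1 (\<lambda>_. 1)"
  using represents_pCons[OF _ represents_0, of "\<lambda>_. 1"]
  by (simp add: Mero_1 one_pCons meromorphic_intros)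

lemma represents_power: "represents P p \<Longrightarrow> represents (P ^ k) (\<lambda>\<tau>. p \<tau> ^ k)"
  by (induction k) (auto intro: represents_1 represents_mult)

lemma represents_prod:
  "(\<And>i. i \<in> A \<Longrightarrow> represents (P i) (p i)) \<Longrightarrow> represents (\<Prod>i\<in>A. P i) (\<lambda>\<tau>. \<Prod>i\<in>A. p i \<tau>)"
  by (induction A rule: infinite_finite_induct) (auto intro: represents_1 represents_mult)

lemma represents_pderiv: "represents P p \<Longrightarrow> represents (pderiv P) (\<lambda>\<tau>. pderiv (p \<tau>))"
  unfolding represents_def coeff_pderiv
proof
  fix i
  assume *: "\<forall>i. (\<lambda>\<tau>. Polynomial.coeff (p \<tau>) i) meromorphic_on upper_half_plane \<and> Polynomial.coeff P i = Mero (\<lambda>\<tau>. Polynomial.coeff (p \<tau>) i)"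
  hence m: "(\<lambda>\<tau>. Polynomial.coeff (p \<tau>) j) meromorphic_on upper_half_plane" for j by blast
  have "Mero (\<lambda>\<tau>. of_nat (Suc i) * Polynomial.coeff (p \<tau>) (Suc i)) = Mero (\<lambda>_. of_nat (Suc i)) * Mero (\<lambda>\<tau>. Polynomial.coeff (p \<tau>) (Suc i))"
    by (rule Mero_mult) (intro meromorphic_intros m)+
  thus "(\<lambda>\<tau>. of_nat (Suc i) * Polynomial.coeff (p \<tau>) (Suc i)) meromorphic_on upper_half_plane \<and>
      of_nat (Suc i) * Polynomial.coeff P (Suc i) = Mero (\<lambda>\<tau>. of_nat (Suc i) * Polynomial.coeff (p \<tau>) (Suc i))"
    unfolding Mero_of_nat using * by (auto simp del: of_nat_Suc intro!: meromorphic_intros m)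
qed

lemma represents_eqI:
  assumes "represents P p" "represents Q q" "\<And>t. t > 0 \<Longrightarrow> p (\<i> * of_real t) = q (\<i> * of_real t)"
  shows "P = Q"
  using assms unfolding represents_def by (intro poly_eqI) (metis (no_types, lifting) Mero_eqI_axis)

section \<open>Coprimality\<close>

text \<open>
  Coprimality as an equation: it survives shifts of the variable and the steps of the continued fraction
  expansion.
\<close>

definition bezout :: "'a :: comm_ring_1 \<Rightarrow> 'a \<Rightarrow> bool" where
  "bezout p q \<longleftrightarrow> (\<exists>a b. a * p + b * q = 1)"

lemma bezout_mult:
  assumes "bezout p r" "bezout q r"
  shows "bezout (p * q) r"
proof -
  obtain a b a' b' where "a * p + b * r = 1" "a' * q + b' * r = 1"
    using assms by (auto simp: bezout_def)
  hence "(a * p + b * r) * (a' * q + b' * r) = 1" by simp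
  hence "(a * a') * (p * q) + (a * p * b' + b * a' * q + b * b' * r) * r = 1"
    by (simp add: algebra_simps)
  thus ?thesis unfolding bezout_def by blast
qed

lemma bezout_commute: "bezout p q \<longleftrightarrow> bezout q p"
  unfolding bezout_def by (metis add.commute)

lemma bezout_1: "bezout 1 q"
  unfolding bezout_def by (intro exI[of _ 1] exI[of _ 0]) simp

lemma bezout_prod: "(\<And>i. i \<in> A \<Longrightarrow> bezout (f i) q) \<Longrightarrow> bezout (\<Prod>i\<in>A. f i) q"
  by (induction A rule: infinite_finite_induct) (auto intro: bezout_1 bezout_mult)

lemma bezout_power: "bezout p q \<Longrightarrow> bezout (p ^ k) q"
  by (induction k) (auto intro: bezout_1 bezout_mult)

lemma bezout_cb:
  fixes b :: "nat \<Rightarrow> 'a :: field"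
  assumes "\<And>i j. b i * b j \<noteq> 1"
  shows "bezout (cb_num n b) (cb_den n b)"
proof -
  have 1: "bezout [:- x, 0, 1:] [:1, 0, - y:]" if "x * y \<noteq> 1" for x y :: 'a
  proof -
    have "[:y / (1 - x * y):] * [:- x, 0, 1:] + [:1 / (1 - x * y):] * [:1, 0, - y:] = 1"
      using that by (simp add: one_pCons field_simps)
    thus ?thesis unfolding bezout_def by blast
  qed
  have 2: "bezout [:0, 1:] [:1, 0, - y:]" for y :: 'a
  proof -
    have "[:0, y:] * [:0, 1:] + 1 * [:1, 0, - y:] = 1" by (simp add: one_pCons)
    thus ?thesis unfolding bezout_def by blast
  qed
  have "Polynomial.monom (1 :: 'a) k = [:0, 1:] ^ k" for k
    by (simp add: monom_altdef)
  thus ?thesis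
    unfolding cb_num_def cb_den_def using assms 1 2
    by (intro bezout_mult bezout_prod; subst bezout_commute; intro bezout_prod; subst bezout_commute)
       (auto intro!: bezout_power)
qed

section \<open>The field and the ring of coefficients\<close>

abbreviation MR :: "mero ring" where "MR \<equiv> ring_of_type_algebra"

lemma MR_simps [simp]:
  "carrier MR = UNIV" "\<one>\<^bsub>MR\<^esub> = 1" "\<zero>\<^bsub>MR\<^esub> = 0" "x \<oplus>\<^bsub>MR\<^esub> y = x + y" "x \<otimes>\<^bsub>MR\<^esub> y = x * y"
  by (simp_all add: ring_of_type_algebra_def)

lemma MR_a_inv [simp]: "\<ominus>\<^bsub>MR\<^esub> x = - x"
proof -
  interpret MR: ring MR by (rule ring_from_type_algebra)
  show ?thesis by (rule MR.minus_equality) simp_all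
qed

lemma MR_m_inv [simp]: "x \<noteq> 0 \<Longrightarrow> inv\<^bsub>MR\<^esub> x = inverse x"
proof -
  assume "x \<noteq> 0"
  interpret MR: cring MR by (rule cring_from_type_algebra)
  show ?thesis by (rule MR.comm_inv_char) (use \<open>x \<noteq> 0\<close> in simp_all)
qed

lemma MR_pow [simp]: "x [^]\<^bsub>MR\<^esub> (k :: nat) = x ^ k"
proof -
  interpret MR: ring MR by (rule ring_from_type_algebra)
  show ?thesis by (induction k) (simp_all add: mult.commute)
qed

text \<open>
  In a type class field the closure under inverses includes 0, for which \<open>generate_field\<close> makes no provision.
\<close>

lemma subfield_set_cb_field: "subfield_set (cb_field n)"
proof
  show "1 \<in> cb_field n" using generate_field.one[of MR] by (simp add: cb_field_def)
  show "x + y \<in> cb_field n" "x * y \<in> cb_field n" if "x \<in> cb_field n" "y \<in> cb_field n" for x y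
    using that generate_field.eng_add[of x MR _ y] generate_field.eng_mult[of x MR _ y] by (simp_all add: cb_field_def)
  show "- x \<in> cb_field n" if "x \<in> cb_field n" for x
    using that generate_field.a_inv[of x MR] by (simp add: cb_field_def)
  show "inverse x \<in> cb_field n" if "x \<in> cb_field n" for x
    using that generate_field.m_inv[of x MR] by (cases "x = 0") (auto simp: cb_field_def)
qed

lemma cb_ring_closed:
  shows "1 \<in> cb_ring n"
    and "x \<in> cb_ring n \<Longrightarrow> y \<in> cb_ring n \<Longrightarrow> x + y \<in> cb_ring n"
    and "x \<in> cb_ring n \<Longrightarrow> y \<in> cb_ring n \<Longrightarrow> x * y \<in> cb_ring n"
    and "x \<in> cb_ring n \<Longrightarrow> - x \<in> cb_ring n"
  using generate_ring.one[of MR] generate_ring.eng_add[of x MR _ y] generate_ring.eng_mult[of x MR _ y]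
    generate_ring.a_inv[of x MR]
  by (simp_all add: cb_ring_def)

lemma cb_field_denominator:
  assumes "x \<in> cb_field n"
  shows "\<exists>d\<in>cb_ring n. d \<noteq> 0 \<and> d * x \<in> cb_ring n"
  using assms unfolding cb_field_def
proof (induction rule: generate_field.induct)
  case one
  show ?case by (rule bexI[of _ 1]) (auto intro: cb_ring_closed)
next
  case (incl h)
  hence "h \<in> cb_ring n" unfolding cb_ring_def by (rule generate_ring.incl)
  thus ?case by (intro bexI[of _ 1]) (auto intro: cb_ring_closed)
next
  case (a_inv h)
  then obtain d where "d \<in> cb_ring n" "d \<noteq> 0" "d * h \<in> cb_ring n" by blast
  thus ?case using cb_ring_closed(4)[of "d * h"] by (intro bexI[of _ d]) auto
next
  case (m_inv h)
  then obtain d where d: "d \<in> cb_ring n" "d \<noteq> 0" "d * h \<in> cb_ring n" by blast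
  thus ?case using m_inv.hyps by (intro bexI[of _ "d * h"]) (auto simp: field_simps)
next
  case (eng_add x y)
  then obtain d e where d: "d \<in> cb_ring n" "d \<noteq> 0" "d * x \<in> cb_ring n" "e \<in> cb_ring n" "e \<noteq> 0" "e * y \<in> cb_ring n" by blast
  have "d * e * (x + y) = e * (d * x) + d * (e * y)" by (simp add: algebra_simps)
  also have "\<dots> \<in> cb_ring n"
    by (intro cb_ring_closed(2) cb_ring_closed(3)[OF d(4) d(3)] cb_ring_closed(3)[OF d(1) d(6)])
  finally show ?case using d by (intro bexI[of _ "d * e"]) (auto intro: cb_ring_closed)
next
  case (eng_mult x y)
  then obtain d e where d: "d \<in> cb_ring n" "d \<noteq> 0" "d * x \<in> cb_ring n" "e \<in> cb_ring n" "e \<noteq> 0" "e * y \<in> cb_ring n" by blast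
  have "d * e * (x * y) = (d * x) * (e * y)" by (simp add: algebra_simps)
  also have "\<dots> \<in> cb_ring n" by (rule cb_ring_closed(3)[OF d(3) d(6)])
  finally show ?case using d by (intro bexI[of _ "d * e"]) (auto intro: cb_ring_closed)
qed

lemma cb_field_common_denominator:
  assumes "finite A" "A \<subseteq> cb_field n"
  shows "\<exists>d\<in>cb_ring n. d \<noteq> 0 \<and> (\<forall>x\<in>A. d * x \<in> cb_ring n)"
  using assms
proof (induction A rule: finite_induct)
  case empty
  show ?case by (rule bexI[of _ 1]) (auto intro: cb_ring_closed)
next
  case (insert x A)
  then obtain d where d: "d \<in> cb_ring n" "d \<noteq> 0" "\<forall>x\<in>A. d * x \<in> cb_ring n" by auto
  obtain e where e: "e \<in> cb_ring n" "e \<noteq> 0" "e * x \<in> cb_ring n"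
    using cb_field_denominator[of x n] insert.prems by auto
  have "d * e * y \<in> cb_ring n" if "y \<in> insert x A" for y
  proof (cases "y = x")
    case True
    thus ?thesis using cb_ring_closed(3)[OF d(1) e(3)] by (simp add: mult.assoc)
  next
    case False
    hence "e * (d * y) \<in> cb_ring n" using that d(3) by (intro cb_ring_closed(3)[OF e(1)]) auto
    thus ?thesis by (simp add: mult_ac)
  qed
  thus ?case using d e by (intro bexI[of _ "d * e"]) (auto intro: cb_ring_closed)
qed

lemma MR_eval: "ring.eval MR (rev cs) x = poly (Poly cs) x"
proof -
  interpret MR: ring MR by (rule ring_from_type_algebra)
  have snoc: "MR.eval (p @ [c]) x = MR.eval p x * x + c" for p c
    by (induction p) (auto simp: algebra_simps)
  show ?thesis by (induction cs) (auto simp: snoc)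
qed

lemma algebraic_over_cb_field:
  assumes "subfield_set.poly_over (cb_field n) P" "P \<noteq> 0" "poly P x = 0"
  shows "ring.algebraic MR (cb_field n) x"
proof -
  interpret MR: ring MR by (rule ring_from_type_algebra)
  have "set (Polynomial.coeffs P) \<subseteq> range (Polynomial.coeff P)"
    by (simp add: range_coeff subset_insertI)
  hence sub: "set (Polynomial.coeffs P) \<subseteq> cb_field n"
    using assms(1) by (auto simp: subfield_set.poly_over_def[OF subfield_set_cb_field])
  have "rev (Polynomial.coeffs P) \<in> carrier (univ_poly MR (cb_field n))"
    unfolding univ_poly_def polynomial_def
    using assms(1,2) last_coeffs_eq_coeff_degree[of P]
    using sub by (auto simp: hd_rev)
  moreover have "rev (Polynomial.coeffs P) \<noteq> []" using assms(2) by simp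
  moreover have "MR.eval (rev (Polynomial.coeffs P)) x = \<zero>\<^bsub>MR\<^esub>"
    unfolding MR_eval using assms(3) by simp
  ultimately show ?thesis using MR.algebraicI unfolding over_def by blast
qed

section \<open>The coefficient field of the Chebyshev-Blaschke product\<close>

lemma Mero_cb_S: "Mero (cb_S n j) = esym n (\<lambda>i. Mero (cb_b n i)) j"
proof -
  have "Mero (cb_S n j) = (\<Sum>I | I \<subseteq> {1..n div 2} \<and> card I = j. Mero (\<lambda>\<tau>. \<Prod>i\<in>I. cb_b n i \<tau>))"
    unfolding cb_S_def[abs_def] by (rule Mero_sum) (intro meromorphic_intros cb_meromorphic)
  also have "\<dots> = esym n (\<lambda>i. Mero (cb_b n i)) j"
    unfolding esym_def by (intro sum.cong refl Mero_prod cb_meromorphic)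
  finally show ?thesis .
qed

lemma prod_Fract:
  fixes f g :: "'i \<Rightarrow> 'a :: idom"
  assumes "\<And>i. i \<in> A \<Longrightarrow> g i \<noteq> 0"
  shows "(\<Prod>i\<in>A. Fract (f i) (g i)) = Fract (\<Prod>i\<in>A. f i) (\<Prod>i\<in>A. g i)"
  using assms by (induction A rule: infinite_finite_induct) (auto simp: One_fract_def)

lemma cb_den_nonzero: "cb_den n (b :: nat \<Rightarrow> 'a :: idom) \<noteq> 0"
  by (auto simp: cb_den_def)

lemma cb_rational_eq:
  "cb_rational n = Fract (cb_num n (\<lambda>i. Mero (cb_b n i))) (cb_den n (\<lambda>i. Mero (cb_b n i)))"
  unfolding cb_rational_def by (subst prod_Fract) (auto simp: cb_num_def cb_den_def)

text \<open>
  The differential equation and the initial value at \<open>z = \<surd>k\<close> have coefficients in the field, so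
  \<open>ode_solution_descends\<close> applies. Its side conditions are inequalities between meromorphic functions and follow
  from \<open>\<bar>b\<^sub>i\<bar> < 1\<close>, \<open>\<bar>\<surd>k\<bar> < 1\<close> and the non-vanishing of \<open>\<theta>\<^sub>2(0)\<close> and \<open>\<theta>\<^sub>3(0)\<close> on the imaginary axis.
\<close>

lemma cb_coefficients_in_field:
  assumes n: "n \<ge> 1"
  shows "subfield_set.poly_over (cb_field n) (cb_num n (\<lambda>i. Mero (cb_b n i)))"
    and "subfield_set.poly_over (cb_field n) (cb_den n (\<lambda>i. Mero (cb_b n i)))"
proof -
  interpret subfield_set "cb_field n" by (rule subfield_set_cb_field)
  define B where "B i = Mero (cb_b n i)" for i
  define p where "p = cb_num n B"
  define q where "q = cb_den n B"
  define \<kappa> where "\<kappa> = Mero sqrt_k"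
  define \<kappa>n where "\<kappa>n = Mero (\<lambda>\<tau>. sqrt_k (of_nat n * \<tau>))"
  define \<rho> where "\<rho> = Mero (\<lambda>\<tau>. omega1 (of_nat n * \<tau>) / omega1 \<tau>)"
  note mero = cb_generators_meromorphic[OF n] cb_meromorphic(2)
  have in_K: "\<kappa> \<in> cb_field n" "\<kappa>n \<in> cb_field n" "\<rho> \<in> cb_field n"
    unfolding cb_field_def \<kappa>_def \<kappa>n_def \<rho>_def by (rule generate_field.incl; simp add: cb_generators_def)+
  define P where "P x = [:x\<^sup>2, 0, -1:] * [:1, 0, - (x\<^sup>2):]" for x :: mero
  have rep_num: "represents p (\<lambda>\<tau>. cb_num n (\<lambda>i. cb_b n i \<tau>))"
    unfolding p_def B_def cb_num_def
  proof (intro represents_mult represents_prod)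
    show "represents (Polynomial.monom 1 (n mod 2)) (\<lambda>_. Polynomial.monom 1 (n mod 2))"
      by (auto simp: represents_def Mero_0 Mero_1 intro!: meromorphic_intros)
    show "represents [:- Mero (cb_b n i), 0, 1:] (\<lambda>\<tau>. [:- cb_b n i \<tau>, 0, 1:])" for i
      using represents_pCons[OF _ represents_pCons[OF _ represents_1], of "\<lambda>\<tau>. - cb_b n i \<tau>" "\<lambda>_. 0"] mero
      by (simp add: Mero_minus Mero_0 meromorphic_intros one_pCons)
  qed
  have rep_quad: "represents [:1, 0, - Mero f:] (\<lambda>\<tau>. [:1, 0, - f \<tau>:])" if "f meromorphic_on upper_half_plane" for f
    using represents_pCons[OF _ represents_pCons[OF _ represents_pCons[OF _ represents_0]], of "\<lambda>_. 1" "\<lambda>_. 0" "\<lambda>\<tau>. - f \<tau>"] that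
    by (simp add: Mero_minus Mero_0 Mero_1 meromorphic_intros)
  have rep_den: "represents q (\<lambda>\<tau>. cb_den n (\<lambda>i. cb_b n i \<tau>))"
    unfolding q_def B_def cb_den_def by (intro represents_prod rep_quad mero)
  have rep_P: "represents (P \<kappa>) (\<lambda>\<tau>. [:(sqrt_k \<tau>)\<^sup>2, 0, -1:] * [:1, 0, - ((sqrt_k \<tau>)\<^sup>2):])"
    unfolding P_def \<kappa>_def Mero_power[OF mero(1), symmetric]
  proof (intro represents_mult rep_quad)
    show "(\<lambda>z. (sqrt_k z)\<^sup>2) meromorphic_on upper_half_plane" using mero by (intro meromorphic_intros)
    thus "represents [:Mero (\<lambda>z. (sqrt_k z)\<^sup>2), 0, - 1:] (\<lambda>\<tau>. [:(sqrt_k \<tau>)\<^sup>2, 0, - 1:])"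
      using represents_pCons[OF _ represents_pCons[OF _ represents_pCons[OF _ represents_0]], of "\<lambda>\<tau>. (sqrt_k \<tau>)\<^sup>2" "\<lambda>_. 0" "\<lambda>_. -1"]
      by (simp add: Mero_minus Mero_0 Mero_1 meromorphic_intros)
  qed
  define c where "c = (of_nat n)\<^sup>2 * \<rho>\<^sup>2"
  have c: "c = Mero (\<lambda>\<tau>. (of_nat n)\<^sup>2 * (omega1 (of_nat n * \<tau>) / omega1 \<tau>)\<^sup>2)"
  proof -
    have "Mero (\<lambda>\<tau>. (of_nat n)\<^sup>2 * (omega1 (of_nat n * \<tau>) / omega1 \<tau>)\<^sup>2) =
        Mero (\<lambda>_. (of_nat n)\<^sup>2) * Mero (\<lambda>\<tau>. (omega1 (of_nat n * \<tau>) / omega1 \<tau>)\<^sup>2)"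
      by (rule Mero_mult) (intro meromorphic_intros mero)+
    also have "Mero (\<lambda>\<tau>. (omega1 (of_nat n * \<tau>) / omega1 \<tau>)\<^sup>2) = \<rho>\<^sup>2"
      unfolding \<rho>_def by (rule Mero_power[OF mero(3)])
    also have "Mero (\<lambda>_. (of_nat n)\<^sup>2) = (of_nat n)\<^sup>2"
      using Mero_of_nat[of "n\<^sup>2"] by simp
    finally show ?thesis by (simp add: c_def)
  qed
  have mero_c: "(\<lambda>\<tau>. (of_nat n)\<^sup>2 * (omega1 (of_nat n * \<tau>) / omega1 \<tau>)\<^sup>2) meromorphic_on upper_half_plane"
    by (intro meromorphic_intros mero)
  have mero_kn: "(\<lambda>\<tau>. (sqrt_k (of_nat n * \<tau>))\<^sup>2) meromorphic_on upper_half_plane"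
    by (intro meromorphic_intros mero)
  have kn: "\<kappa>n\<^sup>2 = Mero (\<lambda>\<tau>. (sqrt_k (of_nat n * \<tau>))\<^sup>2)"
    unfolding \<kappa>n_def by (rule Mero_power[OF mero(2), symmetric])
  have ode: "(pderiv p * q - p * pderiv q)\<^sup>2 * P \<kappa> =
      Polynomial.smult c ((Polynomial.smult (\<kappa>n\<^sup>2) (q\<^sup>2) - p\<^sup>2) * (q\<^sup>2 - Polynomial.smult (\<kappa>n\<^sup>2) (p\<^sup>2)))"
    unfolding c kn
  proof (rule represents_eqI)
    let ?p = "\<lambda>\<tau>. cb_num n (\<lambda>i. cb_b n i \<tau>)" and ?q = "\<lambda>\<tau>. cb_den n (\<lambda>i. cb_b n i \<tau>)"
    show "represents ((pderiv p * q - p * pderiv q)\<^sup>2 * P \<kappa>)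
        (\<lambda>\<tau>. (pderiv (?p \<tau>) * ?q \<tau> - ?p \<tau> * pderiv (?q \<tau>))\<^sup>2 *
           ([:(sqrt_k \<tau>)\<^sup>2, 0, -1:] * [:1, 0, - ((sqrt_k \<tau>)\<^sup>2):]))"
      by (rule represents_mult represents_power represents_diff represents_pderiv rep_num rep_den rep_P)+
    show "represents (Polynomial.smult (Mero (\<lambda>\<tau>. (of_nat n)\<^sup>2 * (omega1 (of_nat n * \<tau>) / omega1 \<tau>)\<^sup>2))
        ((Polynomial.smult (Mero (\<lambda>\<tau>. (sqrt_k (of_nat n * \<tau>))\<^sup>2)) (q\<^sup>2) - p\<^sup>2) *
         (q\<^sup>2 - Polynomial.smult (Mero (\<lambda>\<tau>. (sqrt_k (of_nat n * \<tau>))\<^sup>2)) (p\<^sup>2))))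
        (\<lambda>\<tau>. Polynomial.smult ((of_nat n)\<^sup>2 * (omega1 (of_nat n * \<tau>) / omega1 \<tau>)\<^sup>2)
           ((Polynomial.smult ((sqrt_k (of_nat n * \<tau>))\<^sup>2) ((?q \<tau>)\<^sup>2) - (?p \<tau>)\<^sup>2) *
            ((?q \<tau>)\<^sup>2 - Polynomial.smult ((sqrt_k (of_nat n * \<tau>))\<^sup>2) ((?p \<tau>)\<^sup>2))))"
      by (rule represents_smult[OF mero_c] represents_smult[OF mero_kn] represents_mult represents_diff represents_power rep_num rep_den)+
  qed (rule cb_ode[OF _ n])
  have \<tau>: "Im (\<i> * complex_of_real t) > 0" "Im (of_nat n * (\<i> * complex_of_real t)) > 0" if "t > 0" for t
    using that n by simp_all
  have kappa_lt: "norm (sqrt_k (\<i> * of_real t)) < 1" if "t > 0" for t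
    using norm_theta_quot_axis[OF that, of 0] by (simp add: sqrt_k_def theta_quot_def)
  have kappan_lt: "norm (sqrt_k (of_nat n * (\<i> * of_real t))) < 1" if "t > 0" for t
    using kappa_lt[of "real n * t"] that n by (simp add: mult_ac)
  have b_lt: "norm (cb_b n i (\<i> * of_real t)) < 1" if t: "t > 0" for i t
  proof -
    obtain r where "\<bar>r\<bar> < 1" "cb_b n i (\<i> * of_real t) = (of_real r)\<^sup>2" using cb_b_axis[OF t] by blast
    thus ?thesis by (simp add: norm_power power_less_one_iff abs_square_less_1)
  qed
  have not1: "1 - x \<noteq> 0" if "norm x < 1" for x :: complex using that by auto
  have Mero_not1: "Mero f \<noteq> 1" if "f meromorphic_on upper_half_plane" "\<And>t. t > 0 \<Longrightarrow> norm (f (\<i> * of_real t)) < 1" for f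
  proof -
    have "Mero (\<lambda>z. 1 - f z) \<noteq> 0"
      using that not1 by (intro Mero_nonzero_axis) (auto intro!: meromorphic_intros)
    thus ?thesis using Mero_diff[OF _ that(1), of "\<lambda>_. 1"] by (simp add: Mero_1 meromorphic_intros)
  qed
  have BB: "B i * B j \<noteq> 1" for i j
  proof -
    have "Mero (\<lambda>\<tau>. cb_b n i \<tau> * cb_b n j \<tau>) \<noteq> 1"
    proof (rule Mero_not1)
      fix t :: real assume t: "t > 0"
      have "norm (cb_b n i (\<i> * of_real t)) * norm (cb_b n j (\<i> * of_real t)) < 1 * 1"
        using b_lt[OF t] by (intro mult_strict_mono') auto
      thus "norm (cb_b n i (\<i> * of_real t) * cb_b n j (\<i> * of_real t)) < 1" by (simp add: norm_mult)
    qed (intro meromorphic_intros mero)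
    thus ?thesis unfolding B_def by (simp add: Mero_mult mero)
  qed
  have B1: "B i \<noteq> 1" for i unfolding B_def by (rule Mero_not1[OF mero(4) b_lt])
  have kn1: "\<kappa>n\<^sup>2 \<noteq> 1"
    unfolding kn by (rule Mero_not1[OF mero_kn]) (use kappan_lt in \<open>simp add: norm_power abs_square_less_1\<close>)
  have k1: "\<kappa> ^ 4 \<noteq> 1"
    unfolding \<kappa>_def Mero_power[OF mero(1), symmetric]
    by (rule Mero_not1) (use kappa_lt in \<open>auto simp: norm_power power_less_one_iff intro!: meromorphic_intros mero\<close>)
  have k0: "\<kappa> \<noteq> 0"
    unfolding \<kappa>_def using theta2_0_nonzero[OF \<tau>(1)] theta3_0_nonzero[OF \<tau>(1)]
    by (intro Mero_nonzero_axis mero) (simp add: sqrt_k_def)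
  have "\<rho> \<noteq> 0"
    unfolding \<rho>_def using theta3_0_nonzero[OF \<tau>(1)] theta3_0_nonzero[OF \<tau>(2)]
    by (intro Mero_nonzero_axis mero) (simp add: omega1_def)
  hence c0: "c \<noteq> 0"
    using mero_of_nat_Suc_nonzero[of "n - 1"] n by (simp add: c_def)
  \<comment> \<open>Every Blaschke factor has the value 1 at \<open>z = 1\<close>, which makes the right-hand side of the equation easy to evaluate there.\<close>
  have at1: "poly p 1 = poly q 1" "poly q 1 \<noteq> 0"
    using B1 by (auto simp: p_def q_def poly_cb_num poly_cb_den)
  have "poly ((Polynomial.smult (\<kappa>n\<^sup>2) (q\<^sup>2) - p\<^sup>2) * (q\<^sup>2 - Polynomial.smult (\<kappa>n\<^sup>2) (p\<^sup>2))) 1 =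
      - ((\<kappa>n\<^sup>2 - 1) * (poly q 1)\<^sup>2)\<^sup>2"
    using at1 by (simp add: power2_eq_square algebra_simps)
  also have "\<dots> \<noteq> 0" using kn1 at1 by simp
  finally have nonconst: "(Polynomial.smult (\<kappa>n\<^sup>2) (q\<^sup>2) - p\<^sup>2) * (q\<^sup>2 - Polynomial.smult (\<kappa>n\<^sup>2) (p\<^sup>2)) \<noteq> 0"
    by (metis poly_0)
  have eval_num: "poly p \<kappa> = Mero (\<lambda>\<tau>. poly (cb_num n (\<lambda>i. cb_b n i \<tau>)) (sqrt_k \<tau>))"
  proof -
    have "Mero (\<lambda>\<tau>. poly (cb_num n (\<lambda>i. cb_b n i \<tau>)) (sqrt_k \<tau>)) =
        Mero (\<lambda>\<tau>. sqrt_k \<tau> ^ (n mod 2)) * Mero (\<lambda>\<tau>. \<Prod>i=1..n div 2. (sqrt_k \<tau>)\<^sup>2 - cb_b n i \<tau>)"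
      unfolding poly_cb_num by (rule Mero_mult) (intro meromorphic_intros mero)+
    also have "Mero (\<lambda>\<tau>. \<Prod>i=1..n div 2. (sqrt_k \<tau>)\<^sup>2 - cb_b n i \<tau>) = (\<Prod>i=1..n div 2. Mero (\<lambda>\<tau>. (sqrt_k \<tau>)\<^sup>2 - cb_b n i \<tau>))"
      by (rule Mero_prod) (intro meromorphic_intros mero)
    also have "(\<lambda>i. Mero (\<lambda>\<tau>. (sqrt_k \<tau>)\<^sup>2 - cb_b n i \<tau>)) = (\<lambda>i. \<kappa>\<^sup>2 - B i)"
      unfolding \<kappa>_def B_def Mero_power[OF mero(1), symmetric]
      by (intro ext Mero_diff) (intro meromorphic_intros mero)+
    also have "Mero (\<lambda>\<tau>. sqrt_k \<tau> ^ (n mod 2)) = \<kappa> ^ (n mod 2)"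
      unfolding \<kappa>_def by (rule Mero_power[OF mero(1)])
    finally show ?thesis by (simp add: p_def poly_cb_num)
  qed
  have mero_den: "(\<lambda>\<tau>. poly (cb_den n (\<lambda>i. cb_b n i \<tau>)) (sqrt_k \<tau>)) meromorphic_on upper_half_plane"
    unfolding poly_cb_den by (intro meromorphic_intros mero)
  have eval_den: "poly q \<kappa> = Mero (\<lambda>\<tau>. poly (cb_den n (\<lambda>i. cb_b n i \<tau>)) (sqrt_k \<tau>))"
  proof -
    have factor: "Mero (\<lambda>\<tau>. 1 - cb_b n i \<tau> * (sqrt_k \<tau>)\<^sup>2) = 1 - B i * \<kappa>\<^sup>2" for i
    proof -
      have "Mero (\<lambda>\<tau>. 1 - cb_b n i \<tau> * (sqrt_k \<tau>)\<^sup>2) = Mero (\<lambda>_. 1) - Mero (\<lambda>\<tau>. cb_b n i \<tau> * (sqrt_k \<tau>)\<^sup>2)"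
        by (rule Mero_diff) (intro meromorphic_intros mero)+
      also have "Mero (\<lambda>\<tau>. cb_b n i \<tau> * (sqrt_k \<tau>)\<^sup>2) = B i * Mero (\<lambda>\<tau>. (sqrt_k \<tau>)\<^sup>2)"
        unfolding B_def by (rule Mero_mult) (intro meromorphic_intros mero)+
      finally show ?thesis unfolding Mero_1 \<kappa>_def Mero_power[OF mero(1)] .
    qed
    show ?thesis
      unfolding poly_cb_den by (subst Mero_prod) (use factor in \<open>auto simp: q_def poly_cb_den intro!: meromorphic_intros mero\<close>)
  qed
  have init: "poly p \<kappa> = \<kappa>n * poly q \<kappa>"
  proof -
    have "\<kappa>n * poly q \<kappa> = Mero (\<lambda>\<tau>. sqrt_k (of_nat n * \<tau>) * poly (cb_den n (\<lambda>i. cb_b n i \<tau>)) (sqrt_k \<tau>))"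
      unfolding eval_den \<kappa>n_def by (rule Mero_mult[symmetric, OF mero(2) mero_den])
    also have "\<dots> = poly p \<kappa>"
      unfolding eval_num
    proof (rule Mero_eqI_axis[symmetric])
      show "(\<lambda>\<tau>. poly (cb_num n (\<lambda>i. cb_b n i \<tau>)) (sqrt_k \<tau>)) meromorphic_on upper_half_plane"
        unfolding poly_cb_num by (intro meromorphic_intros mero)
    qed (use cb_initial_value[OF \<tau>(1) n] mero mero_den in \<open>auto intro!: meromorphic_intros\<close>)
    finally show ?thesis ..
  qed
  have q0: "poly q \<kappa> \<noteq> 0"
    unfolding eval_den using cb_den_nonzero_disc kappa_lt by (intro Mero_nonzero_axis mero_den) blast
  have P: "poly (P \<kappa>) \<kappa> = 0" "poly_over (P \<kappa>)"
  proof -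
    show "poly (P \<kappa>) \<kappa> = 0" unfolding P_def poly_mult by (simp add: power2_eq_square)
    show "poly_over (P \<kappa>)"
      unfolding P_def by (rule poly_over_mult) (use in_K in \<open>simp_all add: poly_over_pCons closed\<close>)
  qed
  have "poly (pderiv (P \<kappa>)) \<kappa> = - (2 * \<kappa> * (1 - \<kappa> ^ 4))"
    by (simp add: P_def pderiv_mult pderiv_pCons eval_nat_numeral algebra_simps)
  also have "\<dots> \<noteq> 0" using k0 k1 mero_of_nat_Suc_nonzero[of 1] by simp
  finally have P': "poly (pderiv (P \<kappa>)) \<kappa> \<noteq> 0" .
  have cK: "c \<in> cb_field n" unfolding c_def using in_K by (intro closed of_nat_in)
  obtain a b where ab: "a * p + b * q = 1"
    using bezout_cb[of B n] BB unfolding p_def q_def bezout_def by blast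
  have norm: "poly q 0 = 1" by (simp add: q_def poly_cb_den)
  show "poly_over (cb_num n (\<lambda>i. Mero (cb_b n i)))" "poly_over (cb_den n (\<lambda>i. Mero (cb_b n i)))"
    using ode_solution_descends[OF mero_of_nat_Suc_nonzero ode nonconst c0 ab init q0 cK in_K(2,1) P(2,1) P' norm]
    by (simp_all add: p_def q_def B_def[abs_def])
qed

text \<open>
  Up to sign these are coefficients of the denominator.
\<close>

lemma cb_S_in_field:
  assumes n: "n \<ge> 1" and j: "j \<in> {1..n div 2}"
  shows "Mero (cb_S n j) \<in> cb_field n"
proof -
  interpret subfield_set "cb_field n" by (rule subfield_set_cb_field)
  define B where "B i = Mero (cb_b n i)" for i
  have "poly_over (cb_den n B)"
    using cb_coefficients_in_field(2)[OF n] by (simp add: B_def[abs_def])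
  have "Polynomial.coeff (cb_den n B) (2 * j) = (\<Sum>i=1..n div 2. if i = j then (-1) ^ i * esym n B i else 0)"
    unfolding cb_den_expand coeff_add coeff_sum using j by (auto simp: intro!: sum.cong)
  also have "\<dots> = (-1) ^ j * esym n B j"
    using j by (simp add: sum.delta)
  finally have coeff: "Polynomial.coeff (cb_den n B) (2 * j) = (-1) ^ j * esym n B j" .
  have "(-1) ^ j * esym n B j \<in> cb_field n"
    unfolding coeff[symmetric] using \<open>poly_over (cb_den n B)\<close> by (simp add: poly_over_def)
  hence "(-1) ^ j * ((-1) ^ j * esym n B j) \<in> cb_field n"
    by (rule mult_in[OF power_in[OF uminus_in[OF one_in]]])
  moreover have "(-1) ^ j * ((-1) ^ j * x) = x" for x :: mero
    by (simp only: mult.assoc[symmetric] power_mult_distrib[symmetric]) simp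
  ultimately show ?thesis
    by (simp only: Mero_cb_S B_def[abs_def])
qed

theorem theorem9p2:
  fixes n :: nat
  assumes "n \<ge> 1"
  shows "(\<forall>t>0. \<forall>f. chebyshev_blaschke n (\<i> * complex_of_real t) f \<longleftrightarrow>
            (\<forall>z\<in>ball 0 1. f z = z ^ (n mod 2) *
               ((z ^ (2 * (n div 2)) + (\<Sum>j=1..n div 2.
                   (-1) ^ j * cb_S n j (\<i> * complex_of_real t) * z ^ (2 * (n div 2) - 2 * j))) /
                (1 + (\<Sum>j=1..n div 2.
                   (-1) ^ j * cb_S n j (\<i> * complex_of_real t) * z ^ (2 * j))))))
     \<and> (cb_rational n = Fract (Polynomial.monom 1 (n mod 2)) 1 *
           Fract (Polynomial.monom 1 (2 * (n div 2)) + (\<Sum>j=1..n div 2.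
                    Polynomial.monom ((-1) ^ j * Mero (cb_S n j)) (2 * (n div 2) - 2 * j)))
                 (1 + (\<Sum>j=1..n div 2. Polynomial.monom ((-1) ^ j * Mero (cb_S n j)) (2 * j))))
     \<and> (\<forall>j\<in>{1..n div 2}. Mero (cb_S n j) \<in> cb_field n \<and> - Mero (cb_S n j) \<in> cb_field n)
     \<and> (\<exists>p q :: mero poly. (\<forall>i. Polynomial.coeff p i \<in> cb_ring n) \<and>
           (\<forall>i. Polynomial.coeff q i \<in> cb_ring n) \<and> q \<noteq> 0 \<and> cb_rational n = Fract p q)
     \<and> (\<forall>i\<in>{1..n div 2}.
           ring.algebraic ring_of_type_algebra (cb_field n) (Mero (cb_sqrt_b n i)))"
proof (intro conjI allI impI ballI)
  fix t :: real and f
  assume t: "t > 0"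
  define b where "b i = cb_b n i (\<i> * complex_of_real t)" for i
  have S: "cb_S n j (\<i> * complex_of_real t) = esym n b j" for j
    by (simp add: cb_S_def esym_def b_def)
  show "chebyshev_blaschke n (\<i> * complex_of_real t) f \<longleftrightarrow>
            (\<forall>z\<in>ball 0 1. f z = z ^ (n mod 2) *
               ((z ^ (2 * (n div 2)) + (\<Sum>j=1..n div 2.
                   (-1) ^ j * cb_S n j (\<i> * complex_of_real t) * z ^ (2 * (n div 2) - 2 * j))) /
                (1 + (\<Sum>j=1..n div 2.
                   (-1) ^ j * cb_S n j (\<i> * complex_of_real t) * z ^ (2 * j)))))"
    unfolding chebyshev_blaschke_iff[OF t assms] b_def[abs_def, symmetric] S cb_num_expand cb_den_expand
    by (simp add: poly_sum poly_monom)
next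
  show "cb_rational n = Fract (Polynomial.monom 1 (n mod 2)) 1 *
           Fract (Polynomial.monom 1 (2 * (n div 2)) + (\<Sum>j=1..n div 2.
                    Polynomial.monom ((-1) ^ j * Mero (cb_S n j)) (2 * (n div 2) - 2 * j)))
                 (1 + (\<Sum>j=1..n div 2. Polynomial.monom ((-1) ^ j * Mero (cb_S n j)) (2 * j)))"
    unfolding cb_rational_eq Mero_cb_S cb_num_expand cb_den_expand by simp
next
  fix j assume "j \<in> {1..n div 2}"
  thus "Mero (cb_S n j) \<in> cb_field n" "- Mero (cb_S n j) \<in> cb_field n"
    using cb_S_in_field[OF assms] subfield_set.uminus_in[OF subfield_set_cb_field] by blast+
next
  define p q where "p = cb_num n (\<lambda>i. Mero (cb_b n i))" and "q = cb_den n (\<lambda>i. Mero (cb_b n i))"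
  have "finite (range (Polynomial.coeff r))" for r :: "mero poly"
    by (simp add: range_coeff)
  moreover have "range (Polynomial.coeff p) \<union> range (Polynomial.coeff q) \<subseteq> cb_field n"
    using cb_coefficients_in_field[OF assms]
    by (auto simp: subfield_set.poly_over_def[OF subfield_set_cb_field] p_def q_def)
  ultimately have "\<exists>d\<in>cb_ring n. d \<noteq> 0 \<and> (\<forall>x\<in>range (Polynomial.coeff p) \<union> range (Polynomial.coeff q). d * x \<in> cb_ring n)"
    by (intro cb_field_common_denominator finite_UnI)
  then obtain d where d: "d \<noteq> 0" "\<forall>x\<in>range (Polynomial.coeff p) \<union> range (Polynomial.coeff q). d * x \<in> cb_ring n"
    by (elim bexE conjE)
  have "cb_rational n = Fract (Polynomial.smult d p) (Polynomial.smult d q)"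
    unfolding cb_rational_eq p_def[symmetric] q_def[symmetric]
    using d(1) cb_den_nonzero[of n "\<lambda>i. Mero (cb_b n i)"] by (subst eq_fract(1)) (simp_all add: q_def)
  thus "\<exists>p q :: mero poly. (\<forall>i. Polynomial.coeff p i \<in> cb_ring n) \<and>
           (\<forall>i. Polynomial.coeff q i \<in> cb_ring n) \<and> q \<noteq> 0 \<and> cb_rational n = Fract p q"
    using d cb_den_nonzero[of n]
    by (intro exI[of _ "Polynomial.smult d p"] exI[of _ "Polynomial.smult d q"]) (auto simp: q_def)
next
  fix i assume i: "i \<in> {1..n div 2}"
  have "Mero (cb_b n i) = (Mero (cb_sqrt_b n i))\<^sup>2"
    unfolding Mero_power[OF cb_meromorphic(1), symmetric]
    by (rule arg_cong[of _ _ Mero]) (auto simp: cb_b_def cb_sqrt_b_def power_divide)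
  hence "(\<Prod>i'=1..n div 2. (Mero (cb_sqrt_b n i))\<^sup>2 - Mero (cb_b n i')) = 0"
    using i by (intro prod_zero bexI[of _ i]) simp_all
  hence "poly (cb_num n (\<lambda>i. Mero (cb_b n i))) (Mero (cb_sqrt_b n i)) = 0"
    unfolding poly_cb_num by simp
  thus "ring.algebraic ring_of_type_algebra (cb_field n) (Mero (cb_sqrt_b n i))"
    by (intro algebraic_over_cb_field[OF cb_coefficients_in_field(1)[OF assms] cb_num_nonzero])
qed

end
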